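(* There exists an atomic snapshot object implementation in asynchronous crash-prone message-passing systems with $n$ nodes which requires $O(\log n)$ message delays per UPDATE or SCAN operation, where $f<\frac n2$ is the maximum number of crash failures in the system.
   Context: Model: asynchronous message-passing system with $n$ nodes $1,\dots,n$, at most $f$ of which may crash; reliable FIFO channels between every pair of nodes (a message whose send command is completed is eventually delivered if the receiver has not crashed, and messages from $i$ to $j$ are delivered in sending order). Each node is sequential: it has at most one pending SCAN or UPDATE operation at any time. Local computation time is negligible. If $D$ is the maximum delay of messages between nonfaulty nodes in an execution, an operation takes at most $c$ message delays if it completes within time $cD$. Atomic snapshot object: it has $n$ segments; node $i$ invokes UPDATE$(v)$ to write $v$ into segment $i$ (only $i$ writes segment $i$); SCAN returns a vector $Snap$ with one value per segment. It is atomic if for each execution there is a sequence $\sigma$ of all SCAN and UPDATE operations such that: (Real-time order) if $Op_1$ completes before $Op_2$ starts, $Op_1$ precedes $Op_2$ in $\sigma$; (Sequential specification) if a SCAN returns $Snap$, then for each $i$, $Snap[i]$ is the value written by the latest UPDATE of node $i$ preceding the SCAN in $\sigma$, or the initial value if there is none. *)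

theory Defs
  imports "HOL-Library.Landau_Symbols"
begin

type_synonym node = nat

datatype 'v operation = Update 'v | Scan

text \<open>In \<open>Snap s\<close>, only the entries \<open>s i\<close> with \<open>i \<in> {1..n}\<close> are meaningful.\<close>

datatype 'v response = Ack | Snap "node \<Rightarrow> 'v"

datatype ('v, 'm) input = Invocation "'v operation" | Message node 'm

text \<open>
  Finite nested data over segment values and natural numbers. It serves as the type of local
  states and of messages, since HOL cannot quantify existentially over types.
\<close>

datatype 'v data = Val 'v | Num nat | Tuple "'v data list"

text \<open>
  A node reacts to an input (an invocation by its client, or a message together with its sender)
  by changing its local state, sending a list of addressed messages in the order of the list, and
  then possibly giving a response to its client.
\<close>

record ('v, 's, 'm) protocol =
  start :: "node \<Rightarrow> 's"
  react :: "node \<Rightarrow> 's \<Rightarrow> ('v, 'm) input \<Rightarrow> 's \<times> (node \<times> 'm) list \<times> 'v response option"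

text \<open>
  \<open>chan c i j\<close> is the FIFO queue of messages in transit from \<open>i\<close> to \<open>j\<close>, oldest first. Each message
  carries the time of its sending, which the nodes cannot see and which only serves to measure
  delays.
\<close>

record ('v, 's, 'm) config =
  store :: "node \<Rightarrow> 's"
  chan :: "node \<Rightarrow> node \<Rightarrow> ('m \<times> real) list"
  pending :: "node \<Rightarrow> 'v operation option"
  crashed :: "node set"

definition initial_config :: "('v, 's, 'm) protocol \<Rightarrow> ('v, 's, 'm) config" where
  "initial_config P =
     \<lparr>store = start P, chan = (\<lambda>_ _. []), pending = (\<lambda>_. None), crashed = {}\<rparr>"

text \<open>
  The optional number in \<open>Invoke\<close> and \<open>Deliver\<close> is a crash point: with \<open>Some k\<close>, the reacting node
  crashes during its reaction, after having completed only the first \<open>k\<close> of its sends and without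
  giving a response; with \<open>None\<close> the reaction is carried out entirely. \<open>Deliver i j\<close> delivers the
  oldest message in transit from \<open>i\<close> to \<open>j\<close>. \<open>Idle\<close> allows finite executions to be represented as
  infinite ones.
\<close>

datatype 'v event =
    Idle
  | Crash node
  | Invoke node "'v operation" "nat option"
  | Deliver node node "nat option"

text \<open>\<open>perform P t i x cp c\<close>: node \<open>i\<close> reacts at time \<open>t\<close> to input \<open>x\<close>, with crash point \<open>cp\<close>.\<close>

definition perform ::
  "('v, 's, 'm) protocol \<Rightarrow> real \<Rightarrow> node \<Rightarrow> ('v, 'm) input \<Rightarrow> nat option \<Rightarrow> ('v, 's, 'm) config
     \<Rightarrow> ('v, 's, 'm) config \<times> (node \<times> 'v response) option" where
  "perform P t i x cp c =
     (case react P i (store c i) x of (s, out, r) \<Rightarrow>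
        (case cp of
           None \<Rightarrow>
             (c\<lparr>store := (store c)(i := s),
                chan := (chan c)(i :=
                  \<lambda>j. chan c i j @ [(m, t). (j', m) \<leftarrow> out, j' = j]),
                pending := (if r = None then pending c else (pending c)(i := None))\<rparr>,
              map_option (Pair i) r)
         | Some k \<Rightarrow>
             (c\<lparr>store := (store c)(i := s),
                chan := (chan c)(i :=
                  \<lambda>j. chan c i j @ [(m, t). (j', m) \<leftarrow> take k out, j' = j]),
                crashed := insert i (crashed c)\<rparr>,
              None)))"

text \<open>
  \<open>step P n t c e r c'\<close>: event \<open>e\<close> at time \<open>t\<close> leads from \<open>c\<close> to \<open>c'\<close>; \<open>r\<close> is the response given
  to a client in this step, if any. A node may be invoked only if it has no pending operation.
\<close>

inductive step ::
  "('v, 's, 'm) protocol \<Rightarrow> nat \<Rightarrow> real \<Rightarrow> ('v, 's, 'm) config \<Rightarrow> 'v event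
     \<Rightarrow> (node \<times> 'v response) option \<Rightarrow> ('v, 's, 'm) config \<Rightarrow> bool"
  for P n t where
  idle: "step P n t c Idle None c"
| crash: "\<lbrakk>i \<in> {1..n}; i \<notin> crashed c\<rbrakk>
    \<Longrightarrow> step P n t c (Crash i) None (c\<lparr>crashed := insert i (crashed c)\<rparr>)"
| invoke: "\<lbrakk>i \<in> {1..n}; i \<notin> crashed c; pending c i = None;
      perform P t i (Invocation op) cp (c\<lparr>pending := (pending c)(i := Some op)\<rparr>) = (c', r)\<rbrakk>
    \<Longrightarrow> step P n t c (Invoke i op cp) r c'"
| deliver: "\<lbrakk>i \<in> {1..n}; j \<in> {1..n}; j \<notin> crashed c; chan c i j = (m, t') # q;
      perform P t j (Message i m) cp
        (c\<lparr>chan := (chan c)(i := (chan c i)(j := q))\<rparr>) = (c', r)\<rbrakk>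
    \<Longrightarrow> step P n t c (Deliver i j cp) r c'"

text \<open>Step \<open>k\<close> leads from \<open>conf E k\<close> to \<open>conf E (Suc k)\<close>.\<close>

record ('v, 's, 'm) execution =
  event :: "nat \<Rightarrow> 'v event"
  at_time :: "nat \<Rightarrow> real"
  reply :: "nat \<Rightarrow> (node \<times> 'v response) option"
  conf :: "nat \<Rightarrow> ('v, 's, 'm) config"

definition faulty :: "('v, 's, 'm) execution \<Rightarrow> node set" where
  "faulty E = (\<Union>k. crashed (conf E k))"

text \<open>
  As channels are FIFO queues, a message is eventually delivered if and only if its channel is
  served whenever it is nonempty. Messages sent by a node that crashes later are covered, too.
\<close>

definition reliable :: "nat \<Rightarrow> ('v, 's, 'm) execution \<Rightarrow> bool" where
  "reliable n E \<longleftrightarrow>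
     (\<forall>k. \<forall>i\<in>{1..n}. \<forall>j\<in>{1..n}. chan (conf E k) i j \<noteq> [] \<and> j \<notin> faulty E
        \<longrightarrow> (\<exists>l\<ge>k. \<exists>cp. event E l = Deliver i j cp))"

definition execution_of ::
  "('v, 's, 'm) protocol \<Rightarrow> nat \<Rightarrow> nat \<Rightarrow> ('v, 's, 'm) execution \<Rightarrow> bool" where
  "execution_of P n f E \<longleftrightarrow>
     conf E 0 = initial_config P \<and>
     (\<forall>k. step P n (at_time E k) (conf E k) (event E k) (reply E k) (conf E (Suc k))) \<and>
     mono (at_time E) \<and>
     reliable n E \<and>
     card (faulty E) \<le> f"

text \<open>An operation of an execution is identified by the index of the step that invokes it.\<close>

definition invoked :: "('v, 's, 'm) execution \<Rightarrow> nat \<Rightarrow> node \<Rightarrow> 'v operation \<Rightarrow> bool" where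
  "invoked E a i op \<longleftrightarrow> (\<exists>cp. event E a = Invoke i op cp)"

definition operations :: "('v, 's, 'm) execution \<Rightarrow> nat set" where
  "operations E = {a. \<exists>i op. invoked E a i op}"

text \<open>\<open>completes E a k r\<close>: operation \<open>a\<close> completes in step \<open>k\<close> with response \<open>r\<close>.\<close>

definition completes :: "('v, 's, 'm) execution \<Rightarrow> nat \<Rightarrow> nat \<Rightarrow> 'v response \<Rightarrow> bool" where
  "completes E a k r \<longleftrightarrow>
     (\<exists>i op. invoked E a i op \<and> a \<le> k \<and> reply E k = Some (i, r) \<and>
        (\<forall>l r'. a \<le> l \<and> l < k \<longrightarrow> reply E l \<noteq> Some (i, r')))"

definition completed :: "('v, 's, 'm) execution \<Rightarrow> nat \<Rightarrow> bool" where
  "completed E a \<longleftrightarrow> (\<exists>k r. completes E a k r)"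

definition proper_replies :: "('v, 's, 'm) execution \<Rightarrow> bool" where
  "proper_replies E \<longleftrightarrow>
     (\<forall>k i r. reply E k = Some (i, r) \<longrightarrow>
        (\<exists>a op. invoked E a i op \<and> completes E a k r \<and>
           (case op of Update _ \<Rightarrow> r = Ack | Scan \<Rightarrow> \<exists>s. r = Snap s)))"

text \<open>
  A linearization is a sequence of operations, given by the set \<open>L\<close> of its members and their
  positions \<open>pos\<close> (gaps between positions are irrelevant). It comprises all completed operations,
  whereas operations that never complete may be left out: if a node crashes before the value of its
  \<open>Update\<close> has reached anybody, and infinitely many scans follow, then that \<open>Update\<close> has no place in
  any sequence.
\<close>

definition linearization ::
  "nat \<Rightarrow> (node \<Rightarrow> 'v) \<Rightarrow> ('v, 's, 'm) execution \<Rightarrow> nat set \<Rightarrow> (nat \<Rightarrow> nat) \<Rightarrow> bool" where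
  "linearization n v0 E L pos \<longleftrightarrow>
     L \<subseteq> operations E \<and> {a \<in> operations E. completed E a} \<subseteq> L \<and> inj_on pos L \<and>
     (\<forall>a\<in>L. \<forall>b\<in>L. \<forall>k r. completes E a k r \<and> k < b \<longrightarrow> pos a < pos b) \<and>
     (\<forall>a\<in>L. \<forall>k s. completes E a k (Snap s) \<longrightarrow>
        (\<forall>i\<in>{1..n}.
           (let U = {b \<in> L. (\<exists>v. invoked E b i (Update v)) \<and> pos b < pos a} in
              (U = {} \<and> s i = v0 i) \<or>
              (\<exists>b\<in>U. (\<forall>b'\<in>U. pos b' \<le> pos b) \<and> invoked E b i (Update (s i))))))"

definition atomic :: "nat \<Rightarrow> (node \<Rightarrow> 'v) \<Rightarrow> ('v, 's, 'm) execution \<Rightarrow> bool" where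
  "atomic n v0 E \<longleftrightarrow> (\<exists>L pos. linearization n v0 E L pos)"

definition terminating :: "('v, 's, 'm) execution \<Rightarrow> bool" where
  "terminating E \<longleftrightarrow> (\<forall>a i op. invoked E a i op \<and> i \<notin> faulty E \<longrightarrow> completed E a)"

definition implements_atomic_snapshot ::
  "nat \<Rightarrow> nat \<Rightarrow> (node \<Rightarrow> 'v) \<Rightarrow> ('v, 's, 'm) protocol \<Rightarrow> bool" where
  "implements_atomic_snapshot n f v0 P \<longleftrightarrow>
     (\<forall>E. execution_of P n f E \<longrightarrow> proper_replies E \<and> atomic n v0 E \<and> terminating E)"

text \<open>The delays of the messages between nonfaulty nodes.\<close>

definition message_delays :: "('v, 's, 'm) execution \<Rightarrow> real set" where
  "message_delays E =
     {at_time E k - t | k t. \<exists>i j cp m q. event E k = Deliver i j cp \<and>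
        chan (conf E k) i j = (m, t) # q \<and> i \<notin> faulty E \<and> j \<notin> faulty E}"

text \<open>
  \<open>D\<close> ranges over the upper bounds of the delays because an infinite execution need not attain a
  maximum delay; if it does, the condition is equivalent to the one for the maximum. Operations of
  faulty nodes are exempt, as the delays of their messages are not constrained by \<open>D\<close>.
\<close>

definition takes_message_delays ::
  "nat \<Rightarrow> nat \<Rightarrow> ('v, 's, 'm) protocol \<Rightarrow> real \<Rightarrow> bool" where
  "takes_message_delays n f P c \<longleftrightarrow>
     (\<forall>E D. execution_of P n f E \<and> D \<ge> 0 \<and> (\<forall>d\<in>message_delays E. d \<le> D) \<longrightarrow>
        (\<forall>a i op. invoked E a i op \<and> i \<notin> faulty E \<longrightarrow>
           (\<exists>k r. completes E a k r \<and> at_time E k - at_time E a \<le> c * D)))"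

end

theory Submission
  imports Defs
begin

text \<open>
  Every node keeps a growing set of items. In a phase, a node first sends its items to all nodes and
  awaits the answers of a majority, and then does so once more, collecting the items of the answering
  nodes. As majorities intersect, the instants between the two rounds order all phases such that
  each phase collects what the earlier ones have stored.

  An operation writes its update, if any, and then takes part in an instance of lattice agreement,
  to which each node contributes all updates that it knows. Within an instance, the nodes perform a
  binary search on the number of contributions they have seen: a node that sees more than the
  threshold adopts all it sees and moves up, and any other node keeps its set and moves down. Thus
  the sets of different groups are ordered, and after \<open>log n\<close> levels the sets within a group coincide.
  A node may commit the resulting view if it has not yet heard of a later instance. A new instance is
  opened only by a node that has committed the preceding one; hence an operation that fails twice
  finds a committed view that is recent enough to be borrowed.
\<close>

section \<open>Linearization from views\<close>

text \<open>Comparable views alone do not suffice: a view must also contain whatever was published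
  before the operation began. The instant of reference is the middle of the operation's writing
  phase, which scans pass through as well. The own contribution to an instance is gathered after it,
  and a borrowed view qualifies because its instance was still unknown at the end of that phase, so
  that all contributions to it are gathered later. Lattice agreement orders the views of one
  instance only. Different instances are ordered by the commit test: if a committing node knows of
  no later instance, then every contribution to a later instance is gathered after the middle of the
  committing phase and includes the committed view. A move up takes two phases, since the enlarged
  set has to be published in the old group before reading again; otherwise a node that counts too
  few sets and moves down could be missed. Thus an attempt takes at most two phases per level, an
  operation makes at most two attempts, and a phase lasts at most four delays, which gives the
  factor 16 in front of the number of levels.\<close>

lemma completes_unique:
  assumes "completes E a k r" "completes E a k' r'"
  shows "k = k' \<and> r = r'"
proof -
  obtain i op where 1: "invoked E a i op" "a \<le> k" "reply E k = Some (i, r)"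
     "\<And>l r'. a \<le> l \<Longrightarrow> l < k \<Longrightarrow> reply E l \<noteq> Some (i, r')"
    using assms(1) unfolding completes_def by blast
  obtain i' op' where 2: "invoked E a i' op'" "a \<le> k'" "reply E k' = Some (i', r')"
     "\<And>l r'. a \<le> l \<Longrightarrow> l < k' \<Longrightarrow> reply E l \<noteq> Some (i', r')"
    using assms(2) unfolding completes_def by blast
  have "i' = i" using 1(1) 2(1) by (auto simp: invoked_def)
  then have "k = k'" using 1 2 by (metis nat_neq_iff)
  then show ?thesis using 1 2 by auto
qed

lemma invoked_unique:
  "invoked E a i op \<Longrightarrow> invoked E a j op' \<Longrightarrow> i = j \<and> op = op'"
  by (auto simp: invoked_def)

definition updates :: "('v, 's, 'm) execution \<Rightarrow> nat set" where
  "updates E = {a. \<exists>i v. invoked E a i (Update v)}"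

text \<open>
  \<open>V a\<close> is the set of the updates that operation \<open>a\<close> has seen. An update is placed at the
  smallest view that contains it, before the scans that return this view; ties are broken by the
  invocation index, which extends the real-time order.
\<close>

lemma atomic_from_views:
  fixes E :: "('v, 's, 'm) execution" and V :: "nat \<Rightarrow> nat set"
  assumes sequential: "\<And>a b i op op'. invoked E a i op \<Longrightarrow> invoked E b i op' \<Longrightarrow> a < b \<Longrightarrow>
      \<exists>k r. completes E a k r \<and> k < b"
    and V_updates: "\<And>a. completed E a \<Longrightarrow> V a \<subseteq> updates E"
    and V_self: "\<And>a. completed E a \<Longrightarrow> a \<in> updates E \<Longrightarrow> a \<in> V a"
    and V_chain: "\<And>a b. completed E a \<Longrightarrow> completed E b \<Longrightarrow> V a \<subseteq> V b \<or> V b \<subseteq> V a"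
    and V_mono: "\<And>a b k r. completes E a k r \<Longrightarrow> k < b \<Longrightarrow> completed E b \<Longrightarrow> V a \<subseteq> V b"
    and V_past: "\<And>a b k r. completes E a k r \<Longrightarrow> b \<in> V a \<Longrightarrow> b \<le> k"
    and V_snap: "\<And>a k s i. completes E a k (Snap s) \<Longrightarrow> i \<in> {1..n} \<Longrightarrow>
      (\<forall>b\<in>V a. \<forall>v. \<not> invoked E b i (Update v)) \<and> s i = v0 i \<or>
      (\<exists>b\<in>V a. invoked E b i (Update (s i)) \<and>
        (\<forall>b'\<in>V a. \<forall>v. invoked E b' i (Update v) \<longrightarrow> b' \<le> b))"
    and scan_snap: "\<And>a k s. completes E a k (Snap s) \<Longrightarrow> a \<notin> updates E"
  shows "atomic n v0 E"
proof -
  \<comment> \<open>An update that never completes belongs to the sequence exactly if a completed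
    operation has seen it.\<close>
  define L where "L = {a \<in> operations E. completed E a} \<union> (\<Union>a\<in>{a. completed E a}. V a)"
  \<comment> \<open>The views of completed operations form a chain of finite sets, so cardinality
    alone encodes inclusion. In \<open>h\<close>, doubling puts updates on even heights and scans on
    odd ones.\<close>
  define w where "w a = (if a \<in> updates E then LEAST m. \<exists>c. completed E c \<and> a \<in> V c \<and> m = card (V c)
    else card (V a))" for a
  define h where "h a = 2 * w a + (if a \<in> updates E then 0 else 1)" for a
  define before where "before a b \<longleftrightarrow> h a < h b \<or> h a = h b \<and> a < b" for a b
  define pos where "pos a = card {b \<in> L. before b a}" for a
  have trans: "before a c" if "before a b" "before b c" for a b c
    using that by (auto simp: before_def)
  have irrefl: "\<not> before a a" for a by (simp add: before_def)
  have total: "before a b \<or> before b a" if "a \<noteq> b" for a b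
    using that by (auto simp: before_def)
  have finV: "finite (V a)" if "completed E a" for a
  proof -
    obtain k r where "completes E a k r" using \<open>completed E a\<close> by (auto simp: completed_def)
    then have "V a \<subseteq> {..k}" using V_past by auto
    then show ?thesis using finite_subset by blast
  qed
  have sub_card: "V a \<subseteq> V b \<longleftrightarrow> card (V a) \<le> card (V b)" if "completed E a" "completed E b" for a b
    using V_chain[OF that] finV[OF that(1)] finV[OF that(2)] by (metis card_mono card_seteq subset_refl)
  have L_op: "a \<in> operations E" if "a \<in> L" for a
    using that V_updates by (fastforce simp: L_def operations_def updates_def)
  have w_le: "w a \<le> card (V c)" if "a \<in> updates E" "completed E c" "a \<in> V c" for a c
    using that by (auto simp: w_def intro!: Least_le)
  have w_ex: "\<exists>c. completed E c \<and> a \<in> V c \<and> w a = card (V c)" if "a \<in> updates E" "a \<in> L" for a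
  proof -
    have "\<exists>m c. completed E c \<and> a \<in> V c \<and> m = card (V c)"
      using that V_self by (auto simp: L_def)
    then have "\<exists>c. completed E c \<and> a \<in> V c \<and>
        (LEAST m. \<exists>c. completed E c \<and> a \<in> V c \<and> m = card (V c)) = card (V c)"
      by (rule LeastI_ex)
    then show ?thesis using that by (auto simp: w_def)
  qed
  have scanL: "completed E a" if "a \<in> L" "a \<notin> updates E" for a
    using that V_updates by (auto simp: L_def)
  \<comment> \<open>The weight of \<open>a\<close> is compared with a completed operation
    \<open>c\<close>, not necessarily \<open>a\<close> itself. With \<open>c = a\<close> this is the
    real-time condition; for an update that never completes it shows that only operations invoked up
    to the completion of \<open>c\<close> can precede \<open>a\<close>.\<close>
  have later: "before a b"
    if c: "completes E c k r" "w a \<le> card (V c)" "a \<in> updates E \<or> a = c"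
      and b: "b \<in> L" "k < b" for a b c k r
  proof -
    have cc: "completed E c" using c by (auto simp: completed_def)
    have ck: "c \<le> k" using c(1) by (auto simp: completes_def)
    show ?thesis
    proof (cases "b \<in> updates E")
      case True
      then obtain d where d: "completed E d" "b \<in> V d" "w b = card (V d)" using w_ex b by blast
      have "b \<notin> V c" using V_past[OF c(1)] b by fastforce
      then have "\<not> V d \<subseteq> V c" using d by blast
      then have "card (V c) < card (V d)" using sub_card[OF d(1) cc] by simp
      then show ?thesis using c d by (auto simp: before_def h_def)
    next
      case False
      then have "completed E b" using scanL b by blast
      then have "V c \<subseteq> V b" using V_mono c b by blast
      then have "card (V c) \<le> card (V b)" using sub_card cc \<open>completed E b\<close> by blast
      moreover have "w b = card (V b)" using False by (simp add: w_def)
      ultimately show ?thesis using c False b ck by (auto simp: before_def h_def)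
    qed
  qed
  \<comment> \<open>Finiteness lets the number of predecessors serve as a position, although the
    sequence may be infinite.\<close>
  have fin: "finite {b \<in> L. before b a}" if "a \<in> L" for a
  proof -
    have "\<exists>c k r. completes E c k r \<and> w a \<le> card (V c) \<and> (a \<in> updates E \<or> a = c)"
    proof (cases "a \<in> updates E")
      case True
      then show ?thesis using w_ex[OF True that] unfolding completed_def by force
    next
      case False
      then have "completed E a" using scanL that by blast
      then show ?thesis using False unfolding completed_def w_def by force
    qed
    then obtain c k r where "completes E c k r" "w a \<le> card (V c)" "a \<in> updates E \<or> a = c" by blast
    then have "b \<le> k" if "b \<in> L" "before b a" for b
      using later[of c k r a b] that trans irrefl by (meson not_le)
    then have "{b \<in> L. before b a} \<subseteq> {..k}" by auto
    then show ?thesis using finite_subset by blast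
  qed
  have pos: "before a b \<Longrightarrow> pos a < pos b" if "a \<in> L" "b \<in> L" for a b
  proof -
    assume ab: "before a b"
    then have "{c \<in> L. before c a} \<subseteq> {c \<in> L. before c b}" using trans by blast
    moreover have "a \<in> {c \<in> L. before c b}" "a \<notin> {c \<in> L. before c a}" using ab irrefl that by auto
    ultimately have "{c \<in> L. before c a} \<subset> {c \<in> L. before c b}" by blast
    then show "pos a < pos b" unfolding pos_def by (rule psubset_card_mono[OF fin[OF that(2)]])
  qed
  have pos_iff: "pos a < pos b \<longleftrightarrow> before a b" if "a \<in> L" "b \<in> L" for a b
    using pos that total irrefl by (metis less_asym less_irrefl)
  have rt: "before a b" if "a \<in> L" "b \<in> L" "completes E a k r" "k < b" for a b k r
  proof -
    have ca: "completed E a" using that by (auto simp: completed_def)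
    have "w a \<le> card (V a)" using w_le V_self ca by (cases "a \<in> updates E") (auto simp: w_def)
    then show ?thesis using later[OF that(3)] that by auto
  qed
  have "linearization n v0 E L pos"
    unfolding linearization_def
  proof (intro conjI ballI allI impI)
    show "L \<subseteq> operations E" using L_op by blast
    show "{a \<in> operations E. completed E a} \<subseteq> L" by (auto simp: L_def)
    show "inj_on pos L"
      by (rule inj_onI) (metis pos total less_irrefl)
    fix a b assume ab: "a \<in> L" "b \<in> L"
    show "pos a < pos b" if "completes E a k r \<and> k < b" for k r
      using rt ab that pos by blast
  next
    fix a k s i
    assume a: "a \<in> L" and k: "completes E a k (Snap s)" and i: "i \<in> {1..n}"
    have au: "a \<notin> updates E" using k scan_snap by blast
    have ca: "completed E a" using k by (auto simp: completed_def)
    have wa: "w a = card (V a)" using au by (simp add: w_def)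
    have in_iff: "b \<in> L \<and> pos b < pos a \<longleftrightarrow> b \<in> V a" if b: "b \<in> updates E" for b
    proof
      assume "b \<in> V a"
      then have "b \<in> L" using ca by (auto simp: L_def)
      moreover have "w b \<le> w a" using w_le b ca \<open>b \<in> V a\<close> wa by simp
      then have "before b a" using b au by (auto simp: before_def h_def)
      ultimately show "b \<in> L \<and> pos b < pos a" using pos a by blast
    next
      assume *: "b \<in> L \<and> pos b < pos a"
      then have "before b a" using pos_iff a by blast
      then have "w b \<le> w a" using b au by (auto simp: before_def h_def)
      moreover obtain c where "completed E c" "b \<in> V c" "w b = card (V c)" using w_ex b * by blast
      ultimately show "b \<in> V a" using sub_card[of c a] ca wa by auto
    qed
    define U where "U = {b \<in> L. (\<exists>v. invoked E b i (Update v)) \<and> pos b < pos a}"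
    have U: "U = {b \<in> V a. \<exists>v. invoked E b i (Update v)}"
      unfolding U_def using in_iff by (auto simp: updates_def)
    have UL: "U \<subseteq> L" by (auto simp: U_def)
    consider "(\<forall>b\<in>V a. \<forall>v. \<not> invoked E b i (Update v)) \<and> s i = v0 i" |
      b where "b \<in> V a" "invoked E b i (Update (s i))"
        "\<forall>b'\<in>V a. \<forall>v. invoked E b' i (Update v) \<longrightarrow> b' \<le> b"
      using V_snap[OF k i] by blast
    then have "U = {} \<and> s i = v0 i \<or> (\<exists>b\<in>U. (\<forall>b'\<in>U. pos b' \<le> pos b) \<and> invoked E b i (Update (s i)))"
    proof cases
      case 1
      then show ?thesis using U by auto
    next
      case (2 b)
      have bU: "b \<in> U" using 2 U by auto
      \<comment> \<open>The updates of one node are sequential, so their order of invocation is a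
        real-time order.\<close>
      moreover have "pos b' \<le> pos b" if b': "b' \<in> U" for b'
      proof (cases "b' = b")
        case False
        then have "b' < b" using b' U 2 by force
        moreover obtain v where "invoked E b' i (Update v)" using b' U by auto
        ultimately obtain k r where "completes E b' k r" "k < b" using sequential 2(2) by blast
        then have "before b' b" using rt UL b' bU by blast
        then show ?thesis using pos UL b' bU by (meson less_imp_le subsetD)
      qed simp
      ultimately show ?thesis using 2 by blast
    qed
    then show "let U = {b \<in> L. (\<exists>v. invoked E b i (Update v)) \<and> pos b < pos a} in
          U = {} \<and> s i = v0 i \<or> (\<exists>b\<in>U. (\<forall>b'\<in>U. pos b' \<le> pos b) \<and> invoked E b i (Update (s i)))"
      unfolding U_def by simp
  qed
  then show ?thesis by (auto simp: atomic_def)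
qed

section \<open>Encoding of states and messages\<close>

text \<open>Reactions decode, act and encode again. As only \<open>ds (es s) = s\<close> and its
  analogue for messages are assumed below, data outside the image of the encoding may decode to
  anything.\<close>

definition encode_protocol ::
  "('s \<Rightarrow> 't) \<Rightarrow> ('t \<Rightarrow> 's) \<Rightarrow> ('m \<Rightarrow> 'l) \<Rightarrow> ('l \<Rightarrow> 'm) \<Rightarrow> ('v, 's, 'm) protocol \<Rightarrow> ('v, 't, 'l) protocol"
  where
  "encode_protocol es ds em dm P =
     \<lparr>start = (\<lambda>i. es (start P i)),
      react = (\<lambda>i s x. case react P i (ds s) (map_input id dm x) of
         (s', out, r) \<Rightarrow> (es s', map (map_prod id em) out, r))\<rparr>"

definition decode_config :: "('t \<Rightarrow> 's) \<Rightarrow> ('l \<Rightarrow> 'm) \<Rightarrow> ('v, 't, 'l) config \<Rightarrow> ('v, 's, 'm) config" where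
  "decode_config ds dm c =
     \<lparr>store = (\<lambda>i. ds (store c i)), chan = (\<lambda>i j. map (map_prod dm id) (chan c i j)),
      pending = pending c, crashed = crashed c\<rparr>"

definition decode_execution ::
  "('t \<Rightarrow> 's) \<Rightarrow> ('l \<Rightarrow> 'm) \<Rightarrow> ('v, 't, 'l) execution \<Rightarrow> ('v, 's, 'm) execution" where
  "decode_execution ds dm E =
     \<lparr>event = event E, at_time = at_time E, reply = reply E,
      conf = (\<lambda>k. decode_config ds dm (conf E k))\<rparr>"

context
  fixes es :: "'s \<Rightarrow> 't" and ds em and dm :: "'l \<Rightarrow> 'm" and P :: "('v, 's, 'm) protocol"
  assumes ds: "\<And>s. ds (es s) = s" and dm: "\<And>m. dm (em m) = m"
begin

abbreviation "P' \<equiv> encode_protocol es ds em dm P"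
abbreviation "dc \<equiv> decode_config ds dm"
abbreviation "de \<equiv> decode_execution ds dm"

lemma decode_outgoing:
  "map (map_prod dm id) [(m, t). (j', m) \<leftarrow> map (map_prod id em) out, j' = j] =
   [(m, t). (j', m) \<leftarrow> out, j' = j]"
  by (induction out) (auto simp: dm)

lemma decode_perform:
  assumes "perform P' t i x cp c = (c', r)"
  shows "perform P t i (map_input id dm x) cp (dc c) = (dc c', r)"
proof -
  obtain s out q where "react P i (ds (store c i)) (map_input id dm x) = (s, out, q)"
    by (cases "react P i (ds (store c i)) (map_input id dm x)")
  then show ?thesis using assms
    by (cases cp) (auto simp: perform_def encode_protocol_def decode_config_def ds fun_eq_iff
        take_map decode_outgoing simp del: map_map)
qed

text \<open>Decoding is a step-by-step simulation that leaves events, times, replies and crashes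
  alone, so all required properties of an encoded execution are those of its decoded
  counterpart.\<close>

lemma decode_step:
  assumes "step P' n t c e r c'"
  shows "step P n t (dc c) e r (dc c')"
  using assms
proof cases
  case idle
  then show ?thesis by (auto intro: step.idle)
next
  case (crash i)
  have "dc c' = (dc c)\<lparr>crashed := insert i (crashed (dc c))\<rparr>"
    using crash by (auto simp: decode_config_def)
  moreover have "step P n t (dc c) (Crash i) None ((dc c)\<lparr>crashed := insert i (crashed (dc c))\<rparr>)"
    using crash by (intro step.crash) (auto simp: decode_config_def)
  ultimately show ?thesis using crash by simp
next
  case (invoke i op cp)
  have "perform P t i (Invocation op) cp ((dc c)\<lparr>pending := (pending (dc c))(i := Some op)\<rparr>) = (dc c', r)"
    using decode_perform[OF invoke(5)] by (simp add: decode_config_def operation.map_id)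
  then show ?thesis using invoke by (auto simp: decode_config_def intro!: step.invoke)
next
  case (deliver i j m t' q cp)
  have eq: "dc (c\<lparr>chan := (chan c)(i := (chan c i)(j := q))\<rparr>) =
      (dc c)\<lparr>chan := (chan (dc c))(i := (chan (dc c) i)(j := map (map_prod dm id) q))\<rparr>"
    by (auto simp: decode_config_def fun_eq_iff)
  have "chan (dc c) i j = (dm m, t') # map (map_prod dm id) q"
    using deliver by (auto simp: decode_config_def)
  moreover have "perform P t j (Message i (dm m)) cp
      ((dc c)\<lparr>chan := (chan (dc c))(i := (chan (dc c) i)(j := map (map_prod dm id) q))\<rparr>) = (dc c', r)"
    using decode_perform[OF deliver(6)] unfolding eq by simp
  moreover have "j \<notin> crashed (dc c)" using deliver by (simp add: decode_config_def)
  ultimately show ?thesis unfolding deliver(1) using deliver(2,3) by (intro step.deliver)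
qed

lemma decode_simps [simp]:
  "event (de E) = event E" "at_time (de E) = at_time E" "reply (de E) = reply E"
  "conf (de E) k = dc (conf E k)"
  by (auto simp: decode_execution_def)

lemma decode_faulty [simp]: "faulty (de E) = faulty E"
  by (auto simp: faulty_def decode_config_def)

lemma decode_invoked [simp]: "invoked (de E) = invoked E"
  by (auto simp: invoked_def fun_eq_iff)

lemma decode_completes [simp]: "completes (de E) = completes E"
  by (auto simp: completes_def fun_eq_iff)

lemma decode_completed [simp]: "completed (de E) = completed E"
  by (auto simp: completed_def fun_eq_iff)

lemma decode_execution_of:
  assumes "execution_of P' n f E"
  shows "execution_of P n f (de E)"
proof -
  have "reliable n (de E)" using assms
    by (auto simp: execution_of_def reliable_def decode_config_def)
  moreover have "dc (initial_config P') = initial_config P"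
    by (auto simp: initial_config_def decode_config_def encode_protocol_def ds)
  ultimately show ?thesis using assms decode_step by (auto simp: execution_of_def)
qed

lemma decode_message_delays:
  fixes E :: "('w, 't, 'l) execution"
  shows "message_delays (de E) = message_delays E"
proof -
  have "(\<exists>m q. chan (dc c) i j = (m, t) # q) \<longleftrightarrow> (\<exists>m q. chan c i j = (m, t) # q)"
    for c :: "('w, 't, 'l) config" and i j t
    by (cases "chan c i j") (auto simp: decode_config_def)
  then have "{at_time E k - t | k t. \<exists>i j cp. event E k = Deliver i j cp \<and>
        (\<exists>m q. chan (dc (conf E k)) i j = (m, t) # q) \<and> i \<notin> faulty E \<and> j \<notin> faulty E} =
      {at_time E k - t | k t. \<exists>i j cp. event E k = Deliver i j cp \<and>
        (\<exists>m q. chan (conf E k) i j = (m, t) # q) \<and> i \<notin> faulty E \<and> j \<notin> faulty E}"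
    by (simp only:)
  then show ?thesis unfolding message_delays_def by simp
qed

lemma encode_implements:
  assumes "implements_atomic_snapshot n f v0 P"
  shows "implements_atomic_snapshot n f v0 P'"
  unfolding implements_atomic_snapshot_def
proof (intro allI impI)
  fix E assume "execution_of P' n f E"
  then have "proper_replies (de E) \<and> atomic n v0 (de E) \<and> terminating (de E)"
    using assms decode_execution_of unfolding implements_atomic_snapshot_def by blast
  then show "proper_replies E \<and> atomic n v0 E \<and> terminating E"
    by (simp add: proper_replies_def atomic_def linearization_def operations_def terminating_def)
qed

lemma encode_delays:
  assumes "takes_message_delays n f P c"
  shows "takes_message_delays n f P' c"
  unfolding takes_message_delays_def
proof (intro allI impI, elim conjE)
  fix E D a i op
  assume "execution_of P' n f E" "D \<ge> 0" "\<forall>d\<in>message_delays E. d \<le> D" "invoked E a i op" "i \<notin> faulty E"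
  then show "\<exists>k r. completes E a k r \<and> at_time E k - at_time E a \<le> c * D"
    using assms[unfolded takes_message_delays_def, rule_format, of "de E" D a i op] decode_execution_of
    by (auto simp: decode_message_delays)
qed

end

section \<open>Rounds and phases\<close>

record ('c, 'x) node_state =
  known :: "'x list"
  base :: "'x list"
  rnd :: nat
  acks :: "node list"
  busy :: bool
  pc :: 'c

datatype 'x msg = Request nat "'x list" | Answer nat "'x list"

locale runner =
  fixes n f :: nat
    and pc0 :: "node \<Rightarrow> 'c"
    and begin_op :: "node \<Rightarrow> 'c \<Rightarrow> nat \<Rightarrow> 'v operation \<Rightarrow> 'c \<times> 'x list"
    and advance :: "node \<Rightarrow> 'c \<Rightarrow> 'x list \<Rightarrow> 'c \<times> 'x list \<times> 'v response option"
  assumes minority: "2 * f < n"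
begin

definition broadcast :: "'x msg \<Rightarrow> (node \<times> 'x msg) list" where
  "broadcast m = map (\<lambda>j. (j, m)) [1..<Suc n]"

text \<open>An invocation jumps to a fresh even round number, so every broadcast of a node has a
  number of its own, and answers to older requests are stored but not counted.\<close>

fun handle :: "node \<Rightarrow> ('c, 'x) node_state \<Rightarrow> ('v, 'x msg) input \<Rightarrow>
    ('c, 'x) node_state \<times> (node \<times> 'x msg) list \<times> 'v response option" where
  "handle i s (Invocation op) =
     (let k = 2 * (rnd s div 2) + 2; (c, new) = begin_op i (pc s) k op; B = new @ base s @ known s in
        (s\<lparr>base := B, rnd := k, acks := [], busy := True, pc := c\<rparr>, broadcast (Request k B), None))"
| "handle i s (Message j (Request k K)) =
     (s\<lparr>known := K @ known s\<rparr>, [(j, Answer k (K @ known s))], None)"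
| "handle i s (Message j (Answer k K)) =
     (let K' = K @ known s; A = j # acks s in
        if \<not> busy s \<or> k \<noteq> rnd s then (s\<lparr>known := K'\<rparr>, [], None)
        else if 2 * card (set A) \<le> n then (s\<lparr>known := K', acks := A\<rparr>, [], None)
        else if even k then
          (s\<lparr>known := K', rnd := k + 1, acks := []\<rparr>, broadcast (Request (k + 1) (base s)), None)
        else (let (c, new, r) = advance i (pc s) K'; B = new @ base s @ K' in
          (s\<lparr>known := K', base := B, rnd := k + 1, acks := [], busy := (r = None), pc := c\<rparr>,
           if r = None then broadcast (Request (k + 1) B) else [], r)))"

definition protocol :: "('v, ('c, 'x) node_state, 'x msg) protocol" where
  "protocol =
     \<lparr>start = (\<lambda>i. \<lparr>known = [], base = [], rnd = 0, acks = [], busy = False, pc = pc0 i\<rparr>),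
      react = handle\<rparr>"

text \<open>The reaction split by outcome, which spares later proofs the nested
  conditionals.\<close>

inductive transition :: "node \<Rightarrow> ('c, 'x) node_state \<Rightarrow> ('v, 'x msg) input \<Rightarrow>
    ('c, 'x) node_state \<Rightarrow> (node \<times> 'x msg) list \<Rightarrow> 'v response option \<Rightarrow> bool" for i s where
  invocation: "\<lbrakk>k = 2 * (rnd s div 2) + 2; begin_op i (pc s) k op = (c, new); B = new @ base s @ known s\<rbrakk>
    \<Longrightarrow> transition i s (Invocation op)
      (s\<lparr>base := B, rnd := k, acks := [], busy := True, pc := c\<rparr>) (broadcast (Request k B)) None"
| request: "transition i s (Message j (Request k K))
      (s\<lparr>known := K @ known s\<rparr>) [(j, Answer k (K @ known s))] None"
| late: "\<not> busy s \<or> k \<noteq> rnd s \<Longrightarrow> transition i s (Message j (Answer k K)) (s\<lparr>known := K @ known s\<rparr>) [] None"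
| count: "\<lbrakk>busy s; k = rnd s; 2 * card (insert j (set (acks s))) \<le> n\<rbrakk>
    \<Longrightarrow> transition i s (Message j (Answer k K)) (s\<lparr>known := K @ known s, acks := j # acks s\<rparr>) [] None"
| half: "\<lbrakk>busy s; k = rnd s; n < 2 * card (insert j (set (acks s))); even k\<rbrakk>
    \<Longrightarrow> transition i s (Message j (Answer k K))
      (s\<lparr>known := K @ known s, rnd := k + 1, acks := []\<rparr>) (broadcast (Request (k + 1) (base s))) None"
| finish: "\<lbrakk>busy s; k = rnd s; n < 2 * card (insert j (set (acks s))); odd k;
      advance i (pc s) (K @ known s) = (c, new, r); B = new @ base s @ K @ known s\<rbrakk>
    \<Longrightarrow> transition i s (Message j (Answer k K))
      (s\<lparr>known := K @ known s, base := B, rnd := k + 1, acks := [], busy := (r = None), pc := c\<rparr>)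
      (if r = None then broadcast (Request (k + 1) B) else []) r"

lemma handle_transition: "handle i s x = (s', out, r) \<Longrightarrow> transition i s x s' out r"
proof (induction i s x rule: handle.induct)
  case (1 i s op)
  then show ?case by (auto simp: Let_def split: prod.splits intro!: transition.invocation)
next
  case (2 i s j k K)
  then show ?case by (auto intro: transition.request)
next
  case (3 i s j k K)
  consider "\<not> busy s \<or> k \<noteq> rnd s" | "busy s" "k = rnd s" "2 * card (insert j (set (acks s))) \<le> n"
    | "busy s" "k = rnd s" "n < 2 * card (insert j (set (acks s)))" "even k"
    | "busy s" "k = rnd s" "n < 2 * card (insert j (set (acks s)))" "odd k" by linarith
  then show ?case
  proof cases
    case 1
    then show ?thesis using 3 transition.late[OF 1] by auto
  next
    case 2
    then show ?thesis using 3 transition.count[OF 2] by auto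
  next
    case c: 3
    then show ?thesis using 3 transition.half[OF c] by auto
  next
    case 4
    then show ?thesis using 3 transition.finish[OF 4]
      by (auto simp: Let_def split: prod.splits)
  qed
qed

lemma set_broadcast [simp]: "(j, m) \<in> set (broadcast m') \<longleftrightarrow> j \<in> {1..n} \<and> m = m'"
  by (auto simp: broadcast_def)

end

locale runner_execution = runner n f pc0 begin_op advance
  for n f and pc0 :: "node \<Rightarrow> 'c"
    and begin_op :: "node \<Rightarrow> 'c \<Rightarrow> nat \<Rightarrow> 'v operation \<Rightarrow> 'c \<times> 'x list"
    and advance :: "node \<Rightarrow> 'c \<Rightarrow> 'x list \<Rightarrow> 'c \<times> 'x list \<times> 'v response option" +
  fixes E :: "('v, ('c, 'x) node_state, 'x msg) execution"
  assumes exec: "execution_of protocol n f E"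
begin

abbreviation st :: "nat \<Rightarrow> node \<Rightarrow> ('c, 'x) node_state" where "st t i \<equiv> store (conf E t) i"
abbreviation ch :: "nat \<Rightarrow> node \<Rightarrow> node \<Rightarrow> ('x msg \<times> real) list" where "ch t i j \<equiv> chan (conf E t) i j"

lemma step_E: "step protocol n (at_time E t) (conf E t) (event E t) (reply E t) (conf E (Suc t))"
  using exec by (auto simp: execution_of_def)

lemma conf_0: "conf E 0 = initial_config protocol"
  using exec by (auto simp: execution_of_def)

lemma st_0: "st 0 i = \<lparr>known = [], base = [], rnd = 0, acks = [], busy = False, pc = pc0 i\<rparr>"
  by (simp add: conf_0 initial_config_def protocol_def)

lemma ch_0: "ch 0 i j = []"
  by (simp add: conf_0 initial_config_def)

lemma time_mono: "s \<le> t \<Longrightarrow> at_time E s \<le> at_time E t"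
  using exec by (auto simp: execution_of_def mono_def)

lemma crashed_faulty: "i \<notin> faulty E \<Longrightarrow> i \<notin> crashed (conf E t)"
  by (auto simp: faulty_def)

lemma perform_E:
  assumes "perform protocol t i x cp c = (c', r)"
  obtains s out q where "handle i (store c i) x = (s, out, q)"
    "store c' = (store c)(i := s)"
    "cp = None \<Longrightarrow> chan c' = (chan c)(i := \<lambda>j. chan c i j @ [(m, t). (j', m) \<leftarrow> out, j' = j])"
    "\<And>a b. set (chan c' a b) \<subseteq> set (chan c a b) \<union> {(m, t) | m. a = i \<and> (b, m) \<in> set out}"
    "\<And>a b. \<exists>ys. chan c' a b = chan c a b @ ys"
    "cp = None \<and> r = map_option (Pair i) q \<and> crashed c' = crashed c \<and>
       pending c' = (if q = None then pending c else (pending c)(i := None)) \<or>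
     cp \<noteq> None \<and> r = None \<and> crashed c' = insert i (crashed c) \<and> pending c' = pending c"
proof -
  obtain s out q where h: "handle i (store c i) x = (s, out, q)"
    by (cases "handle i (store c i) x")
  have h': "react protocol i (store c i) x = (s, out, q)" using h by (simp add: protocol_def)
  show thesis
  proof (cases cp)
    case None
    show thesis
      by (rule that[OF h]) (use assms None in \<open>auto simp: perform_def h' split: if_splits\<close>)
  next
    case (Some k)
    show thesis
      by (rule that[OF h]) (use assms Some in \<open>auto simp: perform_def h' split: if_splits dest: in_set_takeD\<close>)
  qed
qed

text \<open>Crash points are absorbed here: the channels are only bounded from above, which covers
  reactions cut short. The safety invariants concern messages that are present, so this bound serves
  them.\<close>

lemma step_cases:
  obtains (quiet) "store (conf E (Suc t)) = store (conf E t)" "chan (conf E (Suc t)) = chan (conf E t)"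
      "pending (conf E (Suc t)) = pending (conf E t)" "crashed (conf E t) \<subseteq> crashed (conf E (Suc t))"
      "reply E t = None" "\<And>i op. \<not> invoked E t i op"
  | (act) i x s out r where "i \<in> {1..n}" "i \<notin> crashed (conf E t)" "transition i (st t i) x s out r"
      "store (conf E (Suc t)) = (store (conf E t))(i := s)"
      "\<And>a b. set (ch (Suc t) a b) \<subseteq> set (ch t a b) \<union> {(m, at_time E t) | m. a = i \<and> (b, m) \<in> set out}"
      "(\<exists>op. x = Invocation op \<and> invoked E t i op \<and> pending (conf E t) i = None) \<or>
       (\<exists>j m t'. x = Message j m \<and> j \<in> {1..n} \<and> (m, t') \<in> set (ch t j i) \<and> (\<forall>i op. \<not> invoked E t i op))"
      "reply E t = map_option (Pair i) r \<and> crashed (conf E (Suc t)) = crashed (conf E t) \<and>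
         pending (conf E (Suc t)) = (pending (conf E t))
           (i := if r \<noteq> None then None else case x of Invocation op \<Rightarrow> Some op | _ \<Rightarrow> pending (conf E t) i) \<or>
       reply E t = None \<and> crashed (conf E (Suc t)) = insert i (crashed (conf E t)) \<and>
         (\<forall>j. j \<noteq> i \<longrightarrow> pending (conf E (Suc t)) j = pending (conf E t) j)"
  using step_E[of t]
proof cases
  case idle
  then show thesis by (intro quiet) (auto simp: invoked_def)
next
  case (crash i)
  then show thesis by (intro quiet) (auto simp: invoked_def)
next
  case (invoke i op cp)
  from invoke(5) show thesis
  proof (rule perform_E)
    fix s out q
    assume *: "handle i (store ((conf E t)\<lparr>pending := (pending (conf E t))(i \<mapsto> op)\<rparr>) i) (Invocation op) = (s, out, q)"
    show thesis if "store (conf E (Suc t)) =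
          (store ((conf E t)\<lparr>pending := (pending (conf E t))(i \<mapsto> op)\<rparr>))(i := s)"
        "\<And>a b. set (chan (conf E (Suc t)) a b) \<subseteq> set (chan ((conf E t)\<lparr>pending := (pending (conf E t))(i \<mapsto> op)\<rparr>) a b)
           \<union> {(m, at_time E t) | m. a = i \<and> (b, m) \<in> set out}"
        "cp = None \<and> reply E t = map_option (Pair i) q \<and>
           crashed (conf E (Suc t)) = crashed ((conf E t)\<lparr>pending := (pending (conf E t))(i \<mapsto> op)\<rparr>) \<and>
           pending (conf E (Suc t)) = (if q = None then pending ((conf E t)\<lparr>pending := (pending (conf E t))(i \<mapsto> op)\<rparr>)
             else (pending ((conf E t)\<lparr>pending := (pending (conf E t))(i \<mapsto> op)\<rparr>))(i := None)) \<or>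
         cp \<noteq> None \<and> reply E t = None \<and>
           crashed (conf E (Suc t)) = insert i (crashed ((conf E t)\<lparr>pending := (pending (conf E t))(i \<mapsto> op)\<rparr>)) \<and>
           pending (conf E (Suc t)) = pending ((conf E t)\<lparr>pending := (pending (conf E t))(i \<mapsto> op)\<rparr>)"
      by (rule act[OF invoke(2,3) handle_transition, of "Invocation op" s out q])
        (use * that invoke in \<open>auto simp: invoked_def\<close>)
  qed
next
  case (deliver i j m t' q cp)
  define c where "c = (conf E t)\<lparr>chan := (chan (conf E t))(i := (chan (conf E t) i)(j := q))\<rparr>"
  have c: "store c = store (conf E t)" "pending c = pending (conf E t)" "crashed c = crashed (conf E t)"
    "set (chan c a b) \<subseteq> set (ch t a b)" for a b
    using deliver by (auto simp: c_def)
  from deliver(6)[folded c_def] show thesis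
  proof (rule perform_E)
    fix s out r
    assume *: "handle j (store c j) (Message i m) = (s, out, r)"
    show thesis if "store (conf E (Suc t)) = (store c)(j := s)"
        "\<And>a b. set (chan (conf E (Suc t)) a b) \<subseteq> set (chan c a b) \<union> {(m, at_time E t) | m. a = j \<and> (b, m) \<in> set out}"
        "cp = None \<and> reply E t = map_option (Pair j) r \<and> crashed (conf E (Suc t)) = crashed c \<and>
           pending (conf E (Suc t)) = (if r = None then pending c else (pending c)(j := None)) \<or>
         cp \<noteq> None \<and> reply E t = None \<and> crashed (conf E (Suc t)) = insert j (crashed c) \<and>
           pending (conf E (Suc t)) = pending c"
    proof (rule act[OF deliver(3,4) handle_transition, of "Message i m" s out r])
      show "set (ch (Suc t) a b) \<subseteq> set (ch t a b) \<union> {(m, at_time E t) | m. a = j \<and> (b, m) \<in> set out}" for a b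
        using that(2)[of a b] c(4)[of a b] by blast
    qed (use * that(1,3) deliver c in \<open>auto simp: invoked_def\<close>)
  qed
qed

text \<open>A node that crashes while answering its client clears \<open>busy\<close> but not
  \<open>pending\<close>, hence the restriction to nodes that are alive.\<close>

lemma pending_busy: "i \<notin> crashed (conf E t) \<Longrightarrow> pending (conf E t) i = None \<longleftrightarrow> \<not> busy (st t i)"
proof (induction t arbitrary: i)
  case 0
  then show ?case by (simp add: st_0) (simp add: conf_0 initial_config_def)
next
  case (Suc t)
  show ?case
  proof (cases t rule: step_cases)
    case quiet
    then show ?thesis using Suc by auto
  next
    case (act a x s out r)
    then show ?thesis using Suc
      by (cases "i = a") (auto elim!: transition.cases)
  qed
qed

section \<open>Steps as seen by a single node\<close>

definition begins :: "nat \<Rightarrow> node \<Rightarrow> bool" where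
  "begins t i \<longleftrightarrow> i \<in> {1..n} \<and> \<not> busy (st t i) \<and> busy (st (Suc t) i) \<and>
     rnd (st (Suc t) i) = 2 * (rnd (st t i) div 2) + 2 \<and> reply E t = None \<and>
     (\<exists>op new. invoked E t i op \<and>
        begin_op i (pc (st t i)) (rnd (st (Suc t) i)) op = (pc (st (Suc t) i), new) \<and>
        base (st (Suc t) i) = new @ base (st t i) @ known (st t i) \<and> known (st (Suc t) i) = known (st t i))"

definition halves :: "nat \<Rightarrow> node \<Rightarrow> bool" where
  "halves t i \<longleftrightarrow> i \<in> {1..n} \<and> busy (st t i) \<and> busy (st (Suc t) i) \<and>
     even (rnd (st t i)) \<and> rnd (st (Suc t) i) = Suc (rnd (st t i)) \<and> reply E t = None \<and>
     base (st (Suc t) i) = base (st t i) \<and> pc (st (Suc t) i) = pc (st t i) \<and>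
     (\<forall>op. \<not> invoked E t i op)"

text \<open>The last disjunct covers a crash within this reaction: the local state has advanced but
  the response is lost.\<close>

definition ends :: "nat \<Rightarrow> node \<Rightarrow> bool" where
  "ends t i \<longleftrightarrow> i \<in> {1..n} \<and> busy (st t i) \<and>
     odd (rnd (st t i)) \<and> rnd (st (Suc t) i) = Suc (rnd (st t i)) \<and>
     (\<forall>op. \<not> invoked E t i op) \<and>
     (\<exists>new r. advance i (pc (st t i)) (known (st (Suc t) i)) = (pc (st (Suc t) i), new, r) \<and>
        base (st (Suc t) i) = new @ base (st t i) @ known (st (Suc t) i) \<and>
        busy (st (Suc t) i) = (r = None) \<and>
        (reply E t = map_option (Pair i) r \<or> reply E t = None \<and> i \<in> crashed (conf E (Suc t))))"

definition stays :: "nat \<Rightarrow> node \<Rightarrow> bool" where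
  "stays t i \<longleftrightarrow> rnd (st (Suc t) i) = rnd (st t i) \<and> base (st (Suc t) i) = base (st t i) \<and>
     pc (st (Suc t) i) = pc (st t i) \<and> busy (st (Suc t) i) = busy (st t i) \<and>
     set (acks (st t i)) \<subseteq> set (acks (st (Suc t) i)) \<and> (\<forall>r. reply E t \<noteq> Some (i, r)) \<and>
     (\<forall>op. \<not> invoked E t i op)"

text \<open>The majority includes the answer being delivered in step \<open>t\<close>, which is
  still in transit in \<open>conf E t\<close> and not yet among the acks; hence the second
  disjunct.\<close>

definition quorum :: "nat \<Rightarrow> node \<Rightarrow> node set \<Rightarrow> bool" where
  "quorum t i Q \<longleftrightarrow> Q \<subseteq> {1..n} \<and> n < 2 * card Q \<and>
     (\<forall>q\<in>Q. q \<in> set (acks (st t i)) \<or>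
        (\<exists>K t'. (Answer (rnd (st t i)) K, t') \<in> set (ch t q i) \<and> set K \<subseteq> set (known (st (Suc t) i))))"

lemma acks_step:
  "j \<in> set (acks (st (Suc t) i)) \<Longrightarrow> rnd (st (Suc t) i) = rnd (st t i) \<and> (j \<in> set (acks (st t i)) \<or>
     j \<in> {1..n} \<and>
     (\<exists>K t'. (Answer (rnd (st t i)) K, t') \<in> set (ch t j i) \<and> set K \<subseteq> set (known (st (Suc t) i))))"
proof (cases t rule: step_cases)
  case (act a x s out r)
  assume "j \<in> set (acks (st (Suc t) i))"
  show ?thesis
  proof (cases "i = a")
    case True
    from act(3) show ?thesis
    proof cases
      case (count k l K)
      then have "set K \<subseteq> set (known (st (Suc t) i))" using act(4) True by simp
      then show ?thesis using count act(4,6) True \<open>j \<in> set (acks (st (Suc t) i))\<close> by auto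
    qed (use act(4) True \<open>j \<in> set (acks (st (Suc t) i))\<close> in auto)
  qed (use act(4) \<open>j \<in> set (acks (st (Suc t) i))\<close> in auto)
qed auto

lemma acks_nodes: "set (acks (st t i)) \<subseteq> {1..n}"
proof (induction t)
  case (Suc t)
  then show ?case using acks_step by blast
qed (simp add: st_0)

lemma known_step: "set (known (st t i)) \<subseteq> set (known (st (Suc t) i))"
proof (cases t rule: step_cases)
  case (act a x s out r)
  then show ?thesis by (cases "i = a") (auto elim!: transition.cases)
qed auto

lemma node_cases:
  obtains "begins t i" | "halves t i" "\<exists>Q. quorum t i Q" | "ends t i" "\<exists>Q. quorum t i Q" | "stays t i"
proof (cases t rule: step_cases)
  case quiet
  then have "stays t i" by (simp add: stays_def)
  then show thesis by (rule that)
next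
  case (act a x s out r)
  show thesis
  proof (cases "i = a")
    case False
    then have "stays t i" using act(4,6,7) by (cases r) (auto simp: stays_def dest: invoked_unique)
    then show thesis by (rule that)
  next
    case True
    have s: "st (Suc t) i = s" using act True by simp
    have Q: "quorum t i (insert j (set (acks (st t i))))"
      if "x = Message j (Answer k K)" "k = rnd (st t i)" "n < 2 * card (insert j (set (acks (st t i))))"
        "known s = K @ known (st t i)" for j k K
      unfolding quorum_def using that act(6) acks_nodes[of t i] True s by auto
    from act(3) show thesis
    proof cases
      case (invocation k op c new B)
      then have "begins t i"
        unfolding begins_def s using act(1,2,6,7) True pending_busy[of i t] by auto
      then show thesis by (rule that)
    next
      case (half k j K)
      then have "halves t i" unfolding halves_def s using act(1,6,7) True by auto
      moreover have "quorum t i (insert j (set (acks (st t i))))"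
        by (rule Q) (use half True in auto)
      ultimately show thesis using that(2) by blast
    next
      case (finish k j K c new B)
      then have "ends t i" unfolding ends_def s using act(1,6,7) True by auto
      moreover have "quorum t i (insert j (set (acks (st t i))))"
        by (rule Q) (use finish True in auto)
      ultimately show thesis using that(3) by blast
    next
      case request
      then have "stays t i" unfolding stays_def s using act(6,7) True by auto
      then show thesis by (rule that)
    next
      case late
      then have "stays t i" unfolding stays_def s using act(6,7) True by auto
      then show thesis by (rule that)
    next
      case count
      then have "stays t i" unfolding stays_def s using act(6,7) True by auto
      then show thesis by (rule that)
    qed
  qed
qed

lemma single_node: "st (Suc t) i \<noteq> st t i \<Longrightarrow> st (Suc t) j \<noteq> st t j \<Longrightarrow> i = j"
  by (cases t rule: step_cases) (auto split: if_splits)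

text \<open>New messages carry the sender's items after the step, so claims about messages reduce to
  claims about states.\<close>

lemma message_step:
  assumes "(m, t') \<in> set (ch (Suc t) i j)"
  obtains "(m, t') \<in> set (ch t i j)"
  | "m = Request (rnd (st (Suc t) i)) (base (st (Suc t) i))" "rnd (st (Suc t) i) \<noteq> rnd (st t i)"
  | k K s where "m = Answer k (known (st (Suc t) i))" "(Request k K, s) \<in> set (ch t j i)"
      "set K \<subseteq> set (known (st (Suc t) i))" "rnd (st (Suc t) i) = rnd (st t i)"
proof (cases t rule: step_cases)
  case quiet
  then show thesis using that(1) assms by simp
next
  case (act a x s out r)
  show thesis
  proof (cases "(m, t') \<in> set (ch t i j)")
    case True
    then show thesis by (rule that)
  next
    case False
    then have o: "(j, m) \<in> set out" "i = a" using act(5)[of i j] assms by auto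
    from act(3) o(1) show thesis
    proof cases
      case (invocation k op c new B)
      then show thesis using that(2) act(4) o by auto
    next
      case (request l k K)
      then show thesis using that(3)[of k K] act(4,6) o by auto
    next
      case half
      then show thesis using that(2) act(4) o by auto
    next
      case finish
      then show thesis using that(2) act(4) o by (auto split: if_splits)
    qed (use o in auto)
  qed
qed

section \<open>What majorities store and collect\<close>

lemma base_step: "set (base (st t i)) \<subseteq> set (base (st (Suc t) i))"
  by (cases t i rule: node_cases) (auto simp: begins_def halves_def ends_def stays_def)

lemma rnd_step: "rnd (st t i) \<le> rnd (st (Suc t) i)"
  by (cases t i rule: node_cases) (auto simp: begins_def halves_def ends_def stays_def)

lemma known_mono: "t \<le> u \<Longrightarrow> set (known (st t i)) \<subseteq> set (known (st u i))"
  by (rule lift_Suc_mono_le[of "\<lambda>t. set (known (st t i))"]) (rule known_step)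

lemma base_mono: "t \<le> u \<Longrightarrow> set (base (st t i)) \<subseteq> set (base (st u i))"
  by (rule lift_Suc_mono_le[of "\<lambda>t. set (base (st t i))"]) (rule base_step)

lemma rnd_mono: "t \<le> u \<Longrightarrow> rnd (st t i) \<le> rnd (st u i)"
  by (rule lift_Suc_mono_le[of "\<lambda>t. rnd (st t i)"]) (rule rnd_step)

text \<open>Round numbers in transit are never ahead of the requesting node. Hence a message with
  the number of a round that has just begun cannot be a leftover.\<close>

lemma message_rnd:
  "((Request k K, t') \<in> set (ch t i j) \<longrightarrow> k \<le> rnd (st t i)) \<and>
   ((Answer k K, t') \<in> set (ch t j i) \<longrightarrow> k \<le> rnd (st t i))"
proof (induction t arbitrary: i j k K t')
  case 0
  then show ?case by (simp add: ch_0)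
next
  case (Suc t)
  have R: "k \<le> rnd (st (Suc t) i)" if "(Request k K, t') \<in> set (ch (Suc t) i j)"
    using that by (rule message_step) (use Suc rnd_step[of t i] in \<open>force+\<close>)
  have A: "k \<le> rnd (st (Suc t) i)" if "(Answer k K, t') \<in> set (ch (Suc t) j i)"
    using that by (rule message_step) (use Suc rnd_step[of t i] in \<open>force+\<close>)
  show ?case using R A by blast
qed

lemma base_change: "rnd (st (Suc t) i) = rnd (st t i) \<Longrightarrow> base (st (Suc t) i) = base (st t i)"
  by (cases t i rule: node_cases) (auto simp: begins_def halves_def ends_def stays_def)

text \<open>A node stores a request before answering it and never forgets, so an ack of the current
  round certifies that its sender holds the requester's base; the answer also carries it back to the
  requester.\<close>

lemma current_base:
  "((Request (rnd (st t i)) K, t') \<in> set (ch t i j) \<longrightarrow> set (base (st t i)) \<subseteq> set K) \<and>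
   ((Answer (rnd (st t i)) K, t') \<in> set (ch t j i) \<longrightarrow>
      set (base (st t i)) \<subseteq> set K \<and> set (base (st t i)) \<subseteq> set (known (st t j))) \<and>
   (j \<in> set (acks (st t i)) \<longrightarrow>
      set (base (st t i)) \<subseteq> set (known (st t i)) \<and> set (base (st t i)) \<subseteq> set (known (st t j)))"
proof (induction t arbitrary: i j K t')
  case 0
  then show ?case by (simp add: ch_0 st_0)
next
  case (Suc t)
  note IH = Suc.IH
  show ?case
  proof (intro conjI impI)
    assume "(Request (rnd (st (Suc t) i)) K, t') \<in> set (ch (Suc t) i j)"
    then show "set (base (st (Suc t) i)) \<subseteq> set K"
    proof (rule message_step)
      assume *: "(Request (rnd (st (Suc t) i)) K, t') \<in> set (ch t i j)"
      \<comment> \<open>The message was in transit before the step, so its number is at most the old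
        round number.\<close>
      then have "rnd (st (Suc t) i) = rnd (st t i)" using message_rnd rnd_step by (meson le_antisym)
      then show ?thesis using IH * base_change by metis
    qed auto
  next
    assume "(Answer (rnd (st (Suc t) i)) K, t') \<in> set (ch (Suc t) j i)"
    then have "set (base (st (Suc t) i)) \<subseteq> set K \<and> set (base (st (Suc t) i)) \<subseteq> set (known (st (Suc t) j))"
    proof (rule message_step)
      assume *: "(Answer (rnd (st (Suc t) i)) K, t') \<in> set (ch t j i)"
      then have "rnd (st (Suc t) i) = rnd (st t i)" using message_rnd rnd_step by (meson le_antisym)
      then show ?thesis using IH[of i K t' j] * base_change[of t i] known_step[of t j] by auto
    next
      fix k K' s
      assume *: "Answer (rnd (st (Suc t) i)) K = Answer k (known (st (Suc t) j))"
        "(Request k K', s) \<in> set (ch t i j)" "set K' \<subseteq> set (known (st (Suc t) j))"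
      then have "rnd (st (Suc t) i) = rnd (st t i)" using message_rnd rnd_step
        by (metis le_antisym msg.inject(2))
      then show ?thesis using IH[of i K' s j] * base_change[of t i] by auto
    qed auto
    then show "set (base (st (Suc t) i)) \<subseteq> set K" "set (base (st (Suc t) i)) \<subseteq> set (known (st (Suc t) j))"
      by auto
  next
    assume "j \<in> set (acks (st (Suc t) i))"
    note a = acks_step[OF this]
    have b: "base (st (Suc t) i) = base (st t i)" by (rule base_change) (use a in simp)
    consider "j \<in> set (acks (st t i))" |
      K t' where "(Answer (rnd (st t i)) K, t') \<in> set (ch t j i)" "set K \<subseteq> set (known (st (Suc t) i))"
      using a by blast
    then have "set (base (st (Suc t) i)) \<subseteq> set (known (st (Suc t) i)) \<and>
        set (base (st (Suc t) i)) \<subseteq> set (known (st (Suc t) j))"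
    proof cases
      case 1
      \<comment> \<open>The list and the time are dummies; only the conjunct on acks is
        used.\<close>
      then show ?thesis using IH[of i "[]" 0 j] b known_step[of t j] known_step[of t i] by auto
    next
      case (2 K t')
      then show ?thesis using IH[of i K t' j] b known_step[of t j] by auto
    qed
    then show "set (base (st (Suc t) i)) \<subseteq> set (known (st (Suc t) i))"
      "set (base (st (Suc t) i)) \<subseteq> set (known (st (Suc t) j))" by auto
  qed
qed

text \<open>Round \<open>k\<close> of node \<open>i\<close> begins after \<open>u\<close>, so any
  answer in this round is produced after \<open>u\<close> and contains all that \<open>j\<close>
  knew at \<open>u\<close>.\<close>

lemma answers_fresh:
  "u \<le> t \<Longrightarrow> rnd (st u i) < k \<Longrightarrow>
   ((Answer k K, t') \<in> set (ch t j i) \<longrightarrow> set (known (st u j)) \<subseteq> set K) \<and>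
   (j \<in> set (acks (st t i)) \<and> rnd (st t i) = k \<longrightarrow> set (known (st u j)) \<subseteq> set (known (st t i)))"
proof (induction t arbitrary: K t' rule: dec_induct)
  case base
  then show ?case using message_rnd[of k K t' u i j] by auto
next
  case (step t)
  have answer: "set (known (st u j)) \<subseteq> set L" if "(Answer k L, s) \<in> set (ch t j i)" for L s
    using step.IH[of L s] step.prems that by blast
  have ack: "set (known (st u j)) \<subseteq> set (known (st t i))" if "j \<in> set (acks (st t i))" "rnd (st t i) = k"
    using step.IH[of "[]" 0] step.prems that by blast
  show ?case
  proof (intro conjI impI; (elim conjE)?)
    assume "(Answer k K, t') \<in> set (ch (Suc t) j i)"
    then show "set (known (st u j)) \<subseteq> set K"
    proof (cases rule: message_step)
      case 1
      then show ?thesis by (rule answer)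
    next
      case 3
      then show ?thesis using known_mono[of u "Suc t" j] step.hyps by simp
    qed simp
  next
    assume *: "j \<in> set (acks (st (Suc t) i))" "rnd (st (Suc t) i) = k"
    have "rnd (st t i) = k" using acks_step[OF *(1)] *(2) by simp
    then have "j \<in> set (acks (st t i)) \<or> (\<exists>L s. (Answer k L, s) \<in> set (ch t j i) \<and>
        set L \<subseteq> set (known (st (Suc t) i)))"
      using acks_step[OF *(1)] by blast
    then show "set (known (st u j)) \<subseteq> set (known (st (Suc t) i))"
      using ack answer \<open>rnd (st t i) = k\<close> known_step[of t i] by (meson order_trans)
  qed
qed

lemma quorum_stores:
  assumes "quorum t i Q" "q \<in> Q"
  shows "set (base (st t i)) \<subseteq> set (known (st t q))" "set (base (st t i)) \<subseteq> set (known (st (Suc t) i))"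
proof -
  consider "q \<in> set (acks (st t i))" | K t' where "(Answer (rnd (st t i)) K, t') \<in> set (ch t q i)"
    "set K \<subseteq> set (known (st (Suc t) i))"
    using assms unfolding quorum_def by blast
  then have "set (base (st t i)) \<subseteq> set (known (st t q)) \<and> set (base (st t i)) \<subseteq> set (known (st (Suc t) i))"
  proof cases
    case 1
    then show ?thesis using current_base[of t i "[]" 0 q] known_step[of t i] by auto
  next
    case (2 K t')
    then show ?thesis using current_base[of t i K t' q] by auto
  qed
  then show "set (base (st t i)) \<subseteq> set (known (st t q))" "set (base (st t i)) \<subseteq> set (known (st (Suc t) i))"
    by auto
qed

lemma quorum_collects:
  assumes "quorum t i Q" "q \<in> Q" "u \<le> t" "rnd (st u i) < rnd (st t i)"
  shows "set (known (st u q)) \<subseteq> set (known (st (Suc t) i))"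
proof -
  consider "q \<in> set (acks (st t i))" | K t' where "(Answer (rnd (st t i)) K, t') \<in> set (ch t q i)"
    "set K \<subseteq> set (known (st (Suc t) i))"
    using assms unfolding quorum_def by blast
  then show ?thesis
  proof cases
    case 1
    then show ?thesis using answers_fresh[OF assms(3,4), of "[]" 0 q] known_step[of t i] by auto
  next
    case (2 K t')
    then show ?thesis using answers_fresh[OF assms(3,4), of K t' q] by auto
  qed
qed

lemma quorums_meet:
  assumes "quorum t i Q" "quorum u j R"
  shows "Q \<inter> R \<noteq> {}"
proof
  assume "Q \<inter> R = {}"
  have f: "finite Q" "finite R" using assms by (auto simp: quorum_def intro: finite_subset)
  then have "card Q + card R = card (Q \<union> R)" using \<open>Q \<inter> R = {}\<close> by (simp add: card_Un_disjoint)
  also have "\<dots> \<le> n" using assms card_mono[of "{1..n}" "Q \<union> R"] by (auto simp: quorum_def)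
  finally show False using assms by (auto simp: quorum_def)
qed

text \<open>\<open>t\<close> is the switch from the storing to the collecting round,
  \<open>u\<close> the step that ends the phase.\<close>

definition phase :: "node \<Rightarrow> nat \<Rightarrow> nat \<Rightarrow> bool" where
  "phase i t u \<longleftrightarrow> halves t i \<and> ends u i \<and> rnd (st u i) = rnd (st (Suc t) i)"

text \<open>Beginning an operation or ending a phase always changes \<open>rnd div 2\<close>, and no
  other step touches these fields.\<close>

lemma same_phase:
  assumes "t \<le> u" "rnd (st u i) div 2 = rnd (st t i) div 2"
  shows "base (st u i) = base (st t i)" "pc (st u i) = pc (st t i)" "busy (st u i) = busy (st t i)"
proof -
  have "rnd (st u i) div 2 = rnd (st t i) div 2 \<longrightarrow>
      base (st u i) = base (st t i) \<and> pc (st u i) = pc (st t i) \<and> busy (st u i) = busy (st t i)"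
    using assms(1)
  proof (induction u rule: dec_induct)
    case (step u)
    show ?case
    proof
      assume *: "rnd (st (Suc u) i) div 2 = rnd (st t i) div 2"
      have "rnd (st t i) div 2 \<le> rnd (st u i) div 2" "rnd (st u i) div 2 \<le> rnd (st (Suc u) i) div 2"
        using rnd_mono[of t u i] step(1) rnd_step[of u i] by (simp_all add: div_le_mono)
      then have "rnd (st u i) div 2 = rnd (st t i) div 2" "rnd (st (Suc u) i) div 2 = rnd (st u i) div 2"
        using * by auto
      then show "base (st (Suc u) i) = base (st t i) \<and> pc (st (Suc u) i) = pc (st t i) \<and>
          busy (st (Suc u) i) = busy (st t i)"
        using step.IH by (cases u i rule: node_cases)
          (auto simp: begins_def halves_def ends_def stays_def elim!: oddE)
    qed
  qed simp
  then show "base (st u i) = base (st t i)" "pc (st u i) = pc (st t i)" "busy (st u i) = busy (st t i)"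
    using assms(2) by auto
qed

lemma phase_less: "phase i t u \<Longrightarrow> t < u"
  using rnd_mono[of u t i] by (force simp: phase_def halves_def intro: ccontr)

lemma phase_div: "phase i t u \<Longrightarrow> rnd (st u i) div 2 = rnd (st t i) div 2"
  by (auto simp: phase_def halves_def)

lemma halves_quorum: "halves t i \<Longrightarrow> \<exists>Q. quorum t i Q"
  by (cases t i rule: node_cases) (auto simp: begins_def halves_def ends_def stays_def)

lemma ends_quorum: "ends t i \<Longrightarrow> \<exists>Q. quorum t i Q"
  by (cases t i rule: node_cases) (auto simp: begins_def halves_def ends_def stays_def)

lemma phase_self: "phase i t u \<Longrightarrow> set (base (st t i)) \<subseteq> set (known (st (Suc u) i))"
proof -
  assume p: "phase i t u"
  then obtain Q where Q: "quorum u i Q" using ends_quorum by (auto simp: phase_def)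
  then obtain q where "q \<in> Q" by (fastforce simp: quorum_def)
  then have "set (base (st u i)) \<subseteq> set (known (st (Suc u) i))" using quorum_stores Q by blast
  then show ?thesis using same_phase(1)[of t u i] phase_less[OF p] phase_div[OF p] by simp
qed

text \<open>The middles of the phases act as linearization points.\<close>

lemma phase_sees:
  assumes p: "phase i t u" and q: "phase j t' u'" and le: "t \<le> t'"
  shows "set (base (st t i)) \<subseteq> set (known (st (Suc u') j))"
proof (cases "t = t'")
  case True
  \<comment> \<open>A step changes one node only, so phases with the same middle belong to the same
    node.\<close>
  have "st (Suc t) i \<noteq> st t i" "st (Suc t) j \<noteq> st t j"
    using p q True by (auto simp: phase_def halves_def)
  then have "i = j" by (rule single_node)
  then show ?thesis using phase_self[OF q] True by simp
next
  case False
  obtain Q where Q: "quorum t i Q" using p halves_quorum by (auto simp: phase_def)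
  obtain R where R: "quorum u' j R" using q ends_quorum by (auto simp: phase_def)
  \<comment> \<open>A node in both majorities has stored the items of \<open>i\<close> by
    \<open>t\<close> and answers the collecting request of \<open>j\<close> after
    \<open>t'\<close>.\<close>
  obtain l where l: "l \<in> Q" "l \<in> R" using quorums_meet[OF Q R] by blast
  have "t' < u'" using phase_less q by blast
  have "set (base (st t i)) \<subseteq> set (known (st t l))" using quorum_stores Q l by blast
  also have "\<dots> \<subseteq> set (known (st t' l))" using le by (rule known_mono)
  also have "\<dots> \<subseteq> set (known (st (Suc u') j))"
    by (rule quorum_collects[OF R l(2)]) (use q \<open>t' < u'\<close> in \<open>auto simp: phase_def halves_def\<close>)
  finally show ?thesis .
qed

lemma ends_phase: "ends u i \<Longrightarrow> \<exists>t. phase i t u"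
proof -
  have "odd (rnd (st u i)) \<longrightarrow> (\<exists>t. halves t i \<and> rnd (st (Suc t) i) = rnd (st u i))"
  proof (induction u)
    case (Suc u)
    then show ?case
      by (cases u i rule: node_cases) (auto simp: begins_def halves_def ends_def stays_def)
  qed (simp add: st_0)
  then show "ends u i \<Longrightarrow> \<exists>t. phase i t u" by (auto simp: ends_def phase_def)
qed

lemma entered:
  obtains (never) "rnd (st t i) = 0" "pc (st t i) = pc0 i" "base (st t i) = []" "\<not> busy (st t i)"
  | (entry) u where "u < t" "begins u i \<or> ends u i" "pc (st (Suc u) i) = pc (st t i)"
      "base (st (Suc u) i) = base (st t i)" "busy (st (Suc u) i) = busy (st t i)"
      "rnd (st (Suc u) i) div 2 = rnd (st t i) div 2"
proof -
  have "rnd (st t i) = 0 \<and> pc (st t i) = pc0 i \<and> base (st t i) = [] \<and> \<not> busy (st t i) \<or>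
     (\<exists>u<t. (begins u i \<or> ends u i) \<and> pc (st (Suc u) i) = pc (st t i) \<and>
      base (st (Suc u) i) = base (st t i) \<and> busy (st (Suc u) i) = busy (st t i) \<and>
      rnd (st (Suc u) i) div 2 = rnd (st t i) div 2)"
  proof (induction t)
    case 0
    then show ?case by (simp add: st_0)
  next
    case (Suc t)
    show ?case
    proof (cases t i rule: node_cases)
      case 2
      then show ?thesis using Suc by (auto simp: halves_def less_Suc_eq elim!: evenE)
    next
      case 4
      then show ?thesis using Suc by (auto simp: stays_def less_Suc_eq)
    qed auto
  qed
  then show thesis using never entry by blast
qed

section \<open>Induction over all items in circulation\<close>

fun payload :: "'x msg \<Rightarrow> 'x set" where
  "payload (Request k K) = set K"
| "payload (Answer k K) = set K"

lemma known_step_cases: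
  obtains "known (st (Suc t) i) = known (st t i)"
  | m t' j where "(m, t') \<in> set (ch t j i)" "set (known (st (Suc t) i)) = payload m \<union> set (known (st t i))"
proof (cases t rule: step_cases)
  case quiet
  then show thesis using that(1) by simp
next
  case (act a x s out r)
  show thesis
  proof (cases "i = a")
    case True
    from act(3) show thesis
    proof cases
      case (request j k K)
      then obtain t' where "(Request k K, t') \<in> set (ch t j i)" using act(6) True by auto
      then show thesis by (rule that(2)) (use request act(4) True in auto)
    next
      case (late k j K)
      then obtain t' where "(Answer k K, t') \<in> set (ch t j i)" using act(6) True by auto
      then show thesis by (rule that(2)) (use late act(4) True in auto)
    next
      case (count k j K)
      then obtain t' where "(Answer k K, t') \<in> set (ch t j i)" using act(6) True by auto
      then show thesis by (rule that(2)) (use count act(4) True in auto)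
    next
      case (half k j K)
      then obtain t' where "(Answer k K, t') \<in> set (ch t j i)" using act(6) True by auto
      then show thesis by (rule that(2)) (use half act(4) True in auto)
    next
      case (finish k j K)
      then obtain t' where "(Answer k K, t') \<in> set (ch t j i)" using act(6) True by auto
      then show thesis by (rule that(2)) (use finish act(4) True in auto)
    qed (use that(1) act(4) True in auto)
  qed (use that(1) act(4) in auto)
qed

text \<open>Some invariants concern whole sets rather than single items, such as that each opened
  instance comes with a commit of its predecessor. They spread because sets in stores and messages
  arise from others by union, apart from the items added when a phase begins.\<close>

lemma item_sets_induct:
  assumes empty: "S 0 {}"
    and mono: "\<And>t X. S t X \<Longrightarrow> S (Suc t) X"
    and union: "\<And>t X Y. S t X \<Longrightarrow> S t Y \<Longrightarrow> S t (X \<union> Y)"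
    and begins: "\<And>t i. begins t i \<Longrightarrow> S t (set (base (st t i))) \<Longrightarrow> S t (set (known (st t i))) \<Longrightarrow>
      S (Suc t) (set (base (st (Suc t) i)))"
    and ends: "\<And>t i. ends t i \<Longrightarrow> S t (set (base (st t i))) \<Longrightarrow> S t (set (known (st (Suc t) i))) \<Longrightarrow>
      S (Suc t) (set (base (st (Suc t) i)))"
  shows "S t (set (known (st t i)))" "S t (set (base (st t i)))"
proof -
  have "(\<forall>i. S t (set (known (st t i))) \<and> S t (set (base (st t i)))) \<and>
      (\<forall>i j m t'. (m, t') \<in> set (ch t i j) \<longrightarrow> S t (payload m))"
  proof (induction t)
    case 0
    then show ?case using empty by (simp add: st_0 ch_0)
  next
    case (Suc t)
    have k: "S t (set (known (st (Suc t) i)))" for i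
    proof (cases t i rule: known_step_cases)
      case (2 m t' j)
      then have "S t (payload m)" "S t (set (known (st t i)))" using Suc by blast+
      then show ?thesis using union 2(2) by simp
    qed (use Suc in simp)
    have b: "S (Suc t) (set (base (st (Suc t) i)))" for i
    proof (cases t i rule: node_cases)
      case 1
      then show ?thesis using begins Suc by blast
    next
      case 3
      then show ?thesis using ends Suc k by blast
    qed (use Suc mono in \<open>auto simp: halves_def stays_def\<close>)
    have "S (Suc t) (payload m)" if "(m, t') \<in> set (ch (Suc t) i j)" for m t' i j
      using that
    proof (cases rule: message_step)
      case 1
      then show ?thesis using Suc mono by blast
    qed (use b k mono in auto)
    then show ?case using b k mono by blast
  qed
  then show "S t (set (known (st t i)))" "S t (set (base (st t i)))" by auto
qed

lemma items_induct:
  assumes mono: "\<And>t x. G t x \<Longrightarrow> G (Suc t) x"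
    and begins: "\<And>t i op c new x. begins t i \<Longrightarrow> invoked E t i op \<Longrightarrow>
      begin_op i (pc (st t i)) (rnd (st (Suc t) i)) op = (c, new) \<Longrightarrow> x \<in> set new \<Longrightarrow> G (Suc t) x"
    and ends: "\<And>t i c new r x. ends t i \<Longrightarrow>
      advance i (pc (st t i)) (known (st (Suc t) i)) = (c, new, r) \<Longrightarrow> c = pc (st (Suc t) i) \<Longrightarrow>
      \<forall>y\<in>set (known (st (Suc t) i)). G t y \<Longrightarrow> x \<in> set new \<Longrightarrow> G (Suc t) x"
  shows "\<forall>x\<in>set (known (st t i)) \<union> set (base (st t i)). G t x"
proof -
  have "\<forall>x\<in>set (known (st t i)). G t x" "\<forall>x\<in>set (base (st t i)). G t x"
  proof (induction rule: item_sets_induct[where S = "\<lambda>t X. \<forall>x\<in>X. G t x"])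
    case (4 t i)
    then show ?case using mono begins[of t i] by (fastforce simp: begins_def)
  next
    case (5 t i)
    then obtain new r where "advance i (pc (st t i)) (known (st (Suc t) i)) = (pc (st (Suc t) i), new, r)"
      "base (st (Suc t) i) = new @ base (st t i) @ known (st (Suc t) i)" by (auto simp: ends_def)
    then show ?case using 5 mono ends[of t i] by auto
  qed (use mono in auto)
  then show ?thesis by blast
qed

section \<open>Operations and their completion\<close>

lemma invoked_begins: "invoked E t i op \<Longrightarrow> begins t i"
  by (cases t i rule: node_cases) (auto simp: halves_def ends_def stays_def)

lemma crashed_step: "crashed (conf E t) \<subseteq> crashed (conf E (Suc t))"
  by (cases t rule: step_cases) auto

lemma crashed_mono: "t \<le> u \<Longrightarrow> crashed (conf E t) \<subseteq> crashed (conf E u)"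
  by (rule lift_Suc_mono_le) (rule crashed_step)

lemma invoked_alive: "invoked E t i op \<Longrightarrow> i \<notin> crashed (conf E t)"
  by (cases t rule: step_cases) (auto dest: invoked_unique)

lemma reply_alive: "reply E t = Some (i, r) \<Longrightarrow> i \<notin> crashed (conf E t)"
proof (cases t rule: step_cases)
  case (act a x s out q)
  then show "reply E t = Some (i, r) \<Longrightarrow> i \<notin> crashed (conf E t)" by (cases q) auto
qed simp

lemma reply_ends:
  assumes "reply E t = Some (i, r)"
  shows "ends t i" "\<not> busy (st (Suc t) i)"
    "\<exists>new. advance i (pc (st t i)) (known (st (Suc t) i)) = (pc (st (Suc t) i), new, Some r)"
  using assms
  by (cases t i rule: node_cases; auto simp: begins_def halves_def ends_def stays_def)+

lemma ends_reply:
  assumes "ends t i" "\<not> busy (st (Suc t) i)" "i \<notin> crashed (conf E (Suc t))"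
  shows "\<exists>r. reply E t = Some (i, r)"
  using assms by (auto simp: ends_def)

lemma busy_change:
  "busy (st t i) \<Longrightarrow> \<not> busy (st (Suc t) i) \<Longrightarrow> ends t i"
  by (cases t i rule: node_cases) (auto simp: begins_def halves_def ends_def stays_def)

text \<open>Operation \<open>a\<close> in progress, expressed by the local flag \<open>busy\<close>,
  which suits induction over time better than the absence of replies.\<close>

definition running :: "nat \<Rightarrow> nat \<Rightarrow> node \<Rightarrow> bool" where
  "running a t i \<longleftrightarrow> begins a i \<and> a < t \<and> (\<forall>l. a < l \<and> l \<le> t \<longrightarrow> busy (st l i))"

lemma busy_running: "busy (st t i) \<Longrightarrow> \<exists>a. running a t i"
proof (induction t)
  case (Suc t)
  show ?case
  proof (cases "busy (st t i)")
    case True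
    then show ?thesis using Suc by (auto simp: running_def le_Suc_eq)
  next
    case False
    then have "begins t i" using Suc.prems
      by (cases t i rule: node_cases) (auto simp: halves_def ends_def stays_def)
    then show ?thesis using Suc.prems by (auto simp: running_def le_Suc_eq)
  qed
qed (simp add: st_0)

lemma running_completes:
  assumes "running a k i" "reply E k = Some (i, r)"
  shows "completes E a k r"
proof -
  have "reply E l \<noteq> Some (i, r')" if "a \<le> l" "l < k" for l r'
    using assms(1) reply_ends(2)[of l i r'] that by (auto simp: running_def)
  then show ?thesis using assms by (force simp: running_def begins_def completes_def)
qed

lemma completes_running:
  assumes "completes E a k r"
  shows "\<exists>i. running a k i \<and> reply E k = Some (i, r)"
proof -
  obtain i op where i: "invoked E a i op" "a \<le> k" "reply E k = Some (i, r)"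
     "\<And>l r'. a \<le> l \<Longrightarrow> l < k \<Longrightarrow> reply E l \<noteq> Some (i, r')"
    using assms unfolding completes_def by blast
  have b: "begins a i" by (rule invoked_begins) fact
  have "a \<noteq> k" using b i by (auto simp: begins_def)
  have "a < l \<and> l \<le> k \<longrightarrow> busy (st l i)" for l
  proof (induction l)
    case (Suc l)
    show ?case
    proof
      assume *: "a < Suc l \<and> Suc l \<le> k"
      show "busy (st (Suc l) i)"
      proof (cases "a = l")
        case True
        then show ?thesis using b by (auto simp: begins_def)
      next
        case False
        then have "busy (st l i)" using Suc * by auto
        \<comment> \<open>The node is alive at \<open>k\<close>, so becoming idle earlier would have
          produced a reply before \<open>k\<close>.\<close>
        then show ?thesis
          using busy_change[of l i] ends_reply[of l i] i(4)[of l] * reply_alive[OF i(3)] crashed_mono[of "Suc l" k]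
          by fastforce
      qed
    qed
  qed simp
  then show ?thesis using b i \<open>a \<noteq> k\<close> by (auto simp: running_def)
qed

lemma running_invoked: "running a t i \<Longrightarrow> invoked E a j op \<Longrightarrow> j = i"
  by (auto simp: running_def begins_def dest: invoked_unique)

text \<open>At the second invocation the node is idle and alive, so the reaction that made it idle
  was carried out entirely and gave a response.\<close>

lemma sequential:
  assumes "invoked E a i op" "invoked E b i op'" "a < b"
  shows "\<exists>k r. completes E a k r \<and> k < b"
proof -
  have a: "begins a i" and b: "begins b i" using assms invoked_begins by auto
  define k where "k = (LEAST l. a < l \<and> \<not> busy (st l i))"
  have k: "a < k" "\<not> busy (st k i)" "k \<le> b"
    using LeastI[of "\<lambda>l. a < l \<and> \<not> busy (st l i)" b] Least_le[of "\<lambda>l. a < l \<and> \<not> busy (st l i)" b] b assms(3)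
    by (auto simp: k_def begins_def)
  have busy: "busy (st l i)" if "a < l" "l < k" for l
    using not_less_Least[of l "\<lambda>l. a < l \<and> \<not> busy (st l i)"] that by (auto simp: k_def)
  obtain m where m: "k = Suc m" using k by (cases k) auto
  have "a \<noteq> m" using a k m by (auto simp: begins_def)
  then have r: "running a m i" using a busy m k by (auto simp: running_def)
  then have "busy (st m i)" by (auto simp: running_def)
  moreover have "i \<notin> crashed (conf E k)" using invoked_alive[OF assms(2)] crashed_mono[OF k(3)] by blast
  ultimately obtain q where "reply E m = Some (i, q)" using busy_change ends_reply k m by blast
  then show ?thesis using running_completes r k m by (metis Suc_le_lessD)
qed

lemma reply_completes:
  assumes "reply E k = Some (i, r)"
  shows "\<exists>a op. invoked E a i op \<and> completes E a k r \<and> running a k i"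
proof -
  have "busy (st k i)" using reply_ends(1)[OF assms] by (auto simp: ends_def)
  then obtain a where a: "running a k i" using busy_running by blast
  then obtain op where "invoked E a i op" by (auto simp: running_def begins_def)
  then show ?thesis using running_completes[OF a assms] a by blast
qed

subsection \<open>Liveness\<close>

lemma perform_live:
  assumes p: "perform protocol t i x cp c = (c', r)" and i: "i \<notin> crashed c'"
  shows "\<exists>out q. handle i (store c i) x = (store c' i, out, q) \<and>
    (\<forall>b m. (b, m) \<in> set out \<longrightarrow> (m, t) \<in> set (chan c' i b)) \<and> r = map_option (Pair i) q"
  using p
proof (rule perform_E)
  fix s out q
  assume h: "handle i (store c i) x = (s, out, q)" "store c' = (store c)(i := s)"
    and c: "cp = None \<Longrightarrow> chan c' = (chan c)(i := \<lambda>j. chan c i j @ [(m, t). (j', m) \<leftarrow> out, j' = j])"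
    and "cp = None \<and> r = map_option (Pair i) q \<and> crashed c' = crashed c \<and>
       pending c' = (if q = None then pending c else (pending c)(i := None)) \<or>
     cp \<noteq> None \<and> r = None \<and> crashed c' = insert i (crashed c) \<and> pending c' = pending c"
  then have "cp = None" "r = map_option (Pair i) q" using i by blast+
  moreover have "(m, t) \<in> set (chan c' i b)" if "(b, m) \<in> set out" for b m
    using that c[OF \<open>cp = None\<close>] by force
  ultimately show ?thesis using h by simp
qed

lemma invoke_live:
  assumes "event E t = Invoke i op cp" "i \<notin> faulty E"
  shows "\<exists>out r. handle i (st t i) (Invocation op) = (st (Suc t) i, out, r) \<and>
    (\<forall>b m. (b, m) \<in> set out \<longrightarrow> (m, at_time E t) \<in> set (ch (Suc t) i b))"
  using step_E[of t]
proof cases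
  case (invoke j op' cp')
  then show ?thesis using perform_live[OF invoke(5)] assms crashed_faulty[OF assms(2), of "Suc t"] by auto
qed (use assms in auto)

lemma deliver_live:
  assumes "event E t = Deliver j i cp" "i \<notin> faulty E"
  shows "\<exists>m t' q out r. ch t j i = (m, t') # q \<and> handle i (st t i) (Message j m) = (st (Suc t) i, out, r) \<and>
    (\<forall>b m. (b, m) \<in> set out \<longrightarrow> (m, at_time E t) \<in> set (ch (Suc t) i b))"
  using step_E[of t]
proof cases
  case (deliver j' i' m t' q cp')
  then show ?thesis using perform_live[OF deliver(6)] assms crashed_faulty[OF assms(2), of "Suc t"] by auto
qed (use assms in auto)

lemma deliver_handled:
  assumes "event E t = Deliver j i cp" "i \<notin> faulty E" "ch t j i = (m, t') # q"
  shows "\<exists>out r. handle i (st t i) (Message j m) = (st (Suc t) i, out, r)"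
proof -
  obtain m' t'' q' out r where *: "ch t j i = (m', t'') # q'"
    "handle i (st t i) (Message j m') = (st (Suc t) i, out, r)"
    using deliver_live[OF assms(1,2)] by blast
  moreover have "m' = m" using * assms(3) by simp
  ultimately show ?thesis by blast
qed

lemma answer_counted:
  assumes "transition i s (Message q (Answer (rnd s) K)) s' out r" "busy s" "rnd s' = rnd s"
  shows "q \<in> set (acks s')"
  using assms(1) by cases (use assms(2,3) in simp_all)

lemma perform_crashed:
  assumes "perform protocol t i x cp c = (c', r)"
  shows "crashed c' \<subseteq> insert i (crashed c)"
  using assms by (rule perform_E) auto

lemma crashed_nodes: "crashed (conf E t) \<subseteq> {1..n}"
proof (induction t)
  case 0
  then show ?case by (simp add: conf_0 initial_config_def)
next
  case (Suc t)
  have "crashed (conf E (Suc t)) \<subseteq> crashed (conf E t) \<union> {1..n}"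
    using step_E[of t]
  proof cases
    case (invoke a op cp)
    from perform_crashed[OF invoke(5)] invoke(2) show ?thesis by auto
  next
    case (deliver a b m t' q cp)
    from perform_crashed[OF deliver(6)] deliver(3) show ?thesis by auto
  qed auto
  then show ?case using Suc by blast
qed

lemma perform_append:
  assumes "perform protocol t a x cp c = (c', r)"
  shows "\<exists>ys. chan c' i j = chan c i j @ ys"
  using assms by (rule perform_E) blast

lemma channel_step:
  "\<exists>ys. ch (Suc t) i j = (if \<exists>cp. event E t = Deliver i j cp then tl (ch t i j) else ch t i j) @ ys"
  using step_E[of t]
proof cases
  case (invoke a op cp)
  then show ?thesis using perform_append[OF invoke(5), of i j] by simp
next
  case (deliver a b m t' q cp)
  then show ?thesis using perform_append[OF deliver(6), of i j] by auto
qed auto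

lemma perform_store:
  assumes "perform protocol t i x cp c = (c', r)" "j \<noteq> i"
  shows "store c' j = store c j"
  using assms(1) by (rule perform_E) (use assms(2) in simp)

lemma state_event:
  "st (Suc t) i \<noteq> st t i \<Longrightarrow> (\<exists>op cp. event E t = Invoke i op cp) \<or> (\<exists>j cp. event E t = Deliver j i cp)"
  using step_E[of t]
proof cases
  case (invoke a op cp)
  assume "st (Suc t) i \<noteq> st t i"
  then show ?thesis using perform_store[OF invoke(5), of i] invoke(1) by auto
next
  case (deliver a b m t' q cp)
  assume "st (Suc t) i \<noteq> st t i"
  then show ?thesis using perform_store[OF deliver(6), of i] deliver(1) by auto
qed auto

lemma requests_sent:
  assumes "rnd (st (Suc t) i) \<noteq> rnd (st t i)" "busy (st (Suc t) i)" "i \<notin> faulty E" "j \<in> {1..n}"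
  shows "(Request (rnd (st (Suc t) i)) (base (st (Suc t) i)), at_time E t) \<in> set (ch (Suc t) i j)"
proof -
  have "st (Suc t) i \<noteq> st t i" using assms(1) by auto
  from state_event[OF this] obtain x out r where
    "handle i (st t i) x = (st (Suc t) i, out, r)"
    and sent: "\<forall>b m. (b, m) \<in> set out \<longrightarrow> (m, at_time E t) \<in> set (ch (Suc t) i b)"
    using invoke_live[OF _ assms(3)] deliver_live[OF _ assms(3)] by metis
  from handle_transition[OF this(1)]
  have "(j, Request (rnd (st (Suc t) i)) (base (st (Suc t) i))) \<in> set out"
    using assms(1,2,4) by cases (auto split: if_splits)
  then show ?thesis using sent by blast
qed

text \<open>Reliability only promises that a nonempty channel is served. Induction on the number of
  older messages brings the given one to the front.\<close>

lemma delivered: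
  assumes "(m, t') \<in> set (ch t i j)" "i \<in> {1..n}" "j \<in> {1..n}" "j \<notin> faulty E"
  shows "\<exists>l\<ge>t. \<exists>cp q. event E l = Deliver i j cp \<and> ch l i j = (m, t') # q"
proof -
  have next_delivery: "\<exists>l\<ge>t. \<exists>ys cp. event E l = Deliver i j cp \<and> ch l i j = ch t i j @ ys"
    if "ch t i j \<noteq> []" for t
  proof -
    define P where "P l \<longleftrightarrow> t \<le> l \<and> (\<exists>cp. event E l = Deliver i j cp)" for l
    have "\<exists>l. P l" using exec assms that unfolding execution_of_def reliable_def P_def by blast
    define l where "l = (LEAST l. P l)"
    have l: "P l" using \<open>\<exists>l. P l\<close> unfolding l_def by (rule LeastI_ex)
    have "\<exists>ys. ch u i j = ch t i j @ ys" if "t \<le> u" "u \<le> l" for u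
      using that
    proof (induction u rule: dec_induct)
      case (step u)
      then have "\<not> P u" using not_less_Least[of u P] unfolding l_def by simp
      then have "\<nexists>cp. event E u = Deliver i j cp" using step by (simp add: P_def)
      then show ?case using channel_step[of u i j] step by auto
    qed simp
    then show ?thesis using l by (auto simp: P_def)
  qed
  obtain xs ys where "ch t i j = xs @ (m, t') # ys" using assms(1) by (meson split_list)
  then show ?thesis
  proof (induction xs arbitrary: t ys)
    case (Nil t)
    then obtain l zs cp where "l \<ge> t" "event E l = Deliver i j cp" "ch l i j = (m, t') # ys @ zs"
      using next_delivery[of t] by auto
    then show ?case by blast
  next
    case (Cons x xs t)
    then obtain l zs cp where l: "l \<ge> t" "event E l = Deliver i j cp" "ch l i j = (x # xs @ (m, t') # ys) @ zs"
      using next_delivery[of t] by auto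
    then have "\<exists>ws. ch (Suc l) i j = xs @ (m, t') # ws" using channel_step[of l i j] by auto
    then obtain l' cp q where "l' \<ge> Suc l" "event E l' = Deliver i j cp" "ch l' i j = (m, t') # q"
      using Cons.IH[of "Suc l"] by blast
    then show ?case using l(1) by (meson Suc_leD le_trans)
  qed
qed

definition delay_bound :: "real \<Rightarrow> bool" where
  "delay_bound D \<longleftrightarrow> D \<ge> 0 \<and> (\<forall>d\<in>message_delays E. d \<le> D)"

text \<open>The quantifier over \<open>D\<close> is inside, so the same delivery step serves
  termination and the time bound at once.\<close>

lemma delivered_in_time:
  assumes "(m, t') \<in> set (ch t i j)" "i \<in> {1..n}" "j \<in> {1..n}" "i \<notin> faulty E" "j \<notin> faulty E"
  shows "\<exists>l\<ge>t. \<exists>cp q. event E l = Deliver i j cp \<and> ch l i j = (m, t') # q \<and>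
    (\<forall>D. delay_bound D \<longrightarrow> at_time E l \<le> t' + D)"
proof -
  obtain l cp q where l: "l \<ge> t" "event E l = Deliver i j cp" "ch l i j = (m, t') # q"
    using delivered assms by blast
  then have "at_time E l - t' \<in> message_delays E" using assms(4,5) by (force simp: message_delays_def)
  then have "at_time E l \<le> t' + D" if "delay_bound D" for D
    using that by (force simp: delay_bound_def)
  then show ?thesis using l by blast
qed

text \<open>The answer that would complete a majority ends the round in the same reaction, and the
  acks are discarded.\<close>

lemma acks_minority:
  "busy (st t i) \<Longrightarrow> 2 * card (set (acks (st t i))) \<le> n"
proof (induction t)
  case 0
  then show ?case by (simp add: st_0)
next
  case (Suc t)
  show ?case
  proof (cases t rule: step_cases)
    case quiet
    then show ?thesis using Suc by simp
  next
    case (act a x s out r)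
    show ?thesis
    proof (cases "i = a")
      case True
      from act(3) show ?thesis by cases (use True Suc act(4) in auto)
    qed (use act(4) Suc in auto)
  qed
qed

lemma acks_persist:
  assumes "t \<le> u" "rnd (st u i) = rnd (st t i)"
  shows "set (acks (st t i)) \<subseteq> set (acks (st u i))"
proof -
  have "rnd (st u i) = rnd (st t i) \<longrightarrow> set (acks (st t i)) \<subseteq> set (acks (st u i))"
    using assms(1)
  proof (induction u rule: dec_induct)
    case (step u)
    show ?case
    proof
      assume *: "rnd (st (Suc u) i) = rnd (st t i)"
      then have "rnd (st u i) = rnd (st t i)" "rnd (st (Suc u) i) = rnd (st u i)"
        using rnd_mono[of t u i] rnd_step[of u i] step(1) by auto
      then show "set (acks (st t i)) \<subseteq> set (acks (st (Suc u) i))"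
        using step.IH by (cases u i rule: node_cases)
          (auto simp: begins_def halves_def ends_def stays_def)
    qed
  qed simp
  then show ?thesis using assms(2) by blast
qed

text \<open>A round consists of a request and an answer, and the correct nodes form a majority.\<close>

lemma round_advances:
  assumes new: "rnd (st (Suc u) i) \<noteq> rnd (st u i)" and busy: "busy (st (Suc u) i)"
    and i: "i \<in> {1..n}" "i \<notin> faulty E"
  shows "\<exists>v>u. rnd (st v i) = rnd (st (Suc u) i) \<and> rnd (st (Suc v) i) \<noteq> rnd (st v i) \<and>
    (\<forall>D. delay_bound D \<longrightarrow> at_time E v \<le> at_time E u + 2 * D)"
proof -
  define k where "k = rnd (st (Suc u) i)"
  define C where "C = {1..n} - faulty E"
  have still_busy: "busy (st t i)" if "Suc u \<le> t" "rnd (st t i) = k" for t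
    using same_phase(3)[OF that(1)] that(2) busy by (simp add: k_def)
  \<comment> \<open>Within two delays the request reaches \<open>q\<close> and its answer comes
    back; the answer is counted unless the round is already over.\<close>
  have "\<exists>l>u. (rnd (st (Suc l) i) = k \<longrightarrow> q \<in> set (acks (st (Suc l) i))) \<and>
      (\<forall>D. delay_bound D \<longrightarrow> at_time E l \<le> at_time E u + 2 * D)" if q: "q \<in> C" for q
  proof -
    have q': "q \<in> {1..n}" "q \<notin> faulty E" using q by (auto simp: C_def)
    obtain l cp p where l: "l \<ge> Suc u" "event E l = Deliver i q cp"
      "ch l i q = (Request k (base (st (Suc u) i)), at_time E u) # p"
      "\<And>D. delay_bound D \<Longrightarrow> at_time E l \<le> at_time E u + D"
      using delivered_in_time[OF requests_sent[OF new busy i(2) q'(1)] i(1) q'(1) i(2) q'(2)]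
      unfolding k_def by blast
    obtain K where K: "(Answer k K, at_time E l) \<in> set (ch (Suc l) q i)"
      using deliver_live[OF l(2) q'(2)] l(3) by auto
    obtain l' cp' p' where l': "l' \<ge> Suc l" "event E l' = Deliver q i cp'"
      "ch l' q i = (Answer k K, at_time E l) # p'"
      "\<And>D. delay_bound D \<Longrightarrow> at_time E l' \<le> at_time E l + D"
      using delivered_in_time[OF K q'(1) i(1) q'(2) i(2)] by blast
    have "q \<in> set (acks (st (Suc l') i))" if r: "rnd (st (Suc l') i) = k"
    proof -
      have "k \<le> rnd (st l' i)" using rnd_mono[of "Suc u" l' i] l l' by (simp add: k_def)
      then have r': "rnd (st l' i) = k" using r rnd_step[of l' i] by simp
      then have b: "busy (st l' i)" using still_busy l l' by simp
      obtain out p where "handle i (st l' i) (Message q (Answer (rnd (st l' i)) K)) = (st (Suc l') i, out, p)"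
        using deliver_handled[OF l'(2) i(2) l'(3)] r' by blast
      from answer_counted[OF handle_transition[OF this] b] show ?thesis using r r' by simp
    qed
    moreover have "at_time E l' \<le> at_time E u + 2 * D" if "delay_bound D" for D
      using l(4)[OF that] l'(4)[OF that] by simp
    moreover have "l' > u" using l(1) l'(1) by simp
    ultimately show ?thesis by blast
  qed
  then obtain L where L: "\<And>q. q \<in> C \<Longrightarrow> L q > u"
    "\<And>q. q \<in> C \<Longrightarrow> rnd (st (Suc (L q)) i) = k \<Longrightarrow> q \<in> set (acks (st (Suc (L q)) i))"
    "\<And>q D. q \<in> C \<Longrightarrow> delay_bound D \<Longrightarrow> at_time E (L q) \<le> at_time E u + 2 * D"
    by metis
  have finC: "finite C" "i \<in> C" using i by (auto simp: C_def)
  have "card (faulty E) \<le> f" using exec by (simp add: execution_of_def)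
  have fin: "finite (faulty E)"
  proof -
    have "faulty E \<subseteq> {1..n}" using crashed_nodes by (auto simp: faulty_def)
    then show ?thesis using finite_subset by blast
  qed
  have "n - card (faulty E) \<le> card C" unfolding C_def using diff_card_le_card_Diff[OF fin, of "{1..n}"] by simp
  then have maj: "n < 2 * card C" using minority \<open>card (faulty E) \<le> f\<close> by linarith
  define w where "w = Max (L ` C)"
  have w: "L q \<le> w" if "q \<in> C" for q using that finC by (simp add: w_def)
  have "w \<in> L ` C" unfolding w_def using finC by (intro Max_in) auto
  then obtain q where q: "q \<in> C" "w = L q" by auto
  then have wu: "u < w" using L(1) by simp
  \<comment> \<open>Otherwise all correct nodes would have been counted by then, but the acks of a
    busy node never form a majority.\<close>
  have "rnd (st (Suc w) i) \<noteq> k"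
  proof
    assume r: "rnd (st (Suc w) i) = k"
    have "q \<in> set (acks (st (Suc w) i))" if q: "q \<in> C" for q
    proof -
      have "k \<le> rnd (st (Suc (L q)) i)" using rnd_mono[of "Suc u" "Suc (L q)" i] L(1)[OF q] by (simp add: k_def)
      moreover have "rnd (st (Suc (L q)) i) \<le> k" using rnd_mono[of "Suc (L q)" "Suc w" i] w[OF q] r by simp
      ultimately have "rnd (st (Suc (L q)) i) = k" by simp
      then show ?thesis using L(2)[OF q] acks_persist[of "Suc (L q)" "Suc w" i] w[OF q] r by auto
    qed
    then have "card C \<le> card (set (acks (st (Suc w) i)))" by (intro card_mono) auto
    then show False using acks_minority[of "Suc w" i] still_busy[of "Suc w"] r wu maj by simp
  qed
  \<comment> \<open>The first change of round after \<open>u\<close> comes no later than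
    \<open>w\<close>, when the last correct node has answered.\<close>
  define v where "v = (LEAST v. u < v \<and> rnd (st (Suc v) i) \<noteq> k)"
  have v: "u < v" "rnd (st (Suc v) i) \<noteq> k" "v \<le> w"
    using LeastI[of "\<lambda>v. u < v \<and> rnd (st (Suc v) i) \<noteq> k" w] Least_le[of "\<lambda>v. u < v \<and> rnd (st (Suc v) i) \<noteq> k" w]
      wu \<open>rnd (st (Suc w) i) \<noteq> k\<close> by (auto simp: v_def)
  obtain v' where v': "v = Suc v'" using v by (cases v) auto
  have "rnd (st v i) = k"
  proof (cases "v' = u")
    case False
    then show ?thesis using not_less_Least[of v' "\<lambda>v. u < v \<and> rnd (st (Suc v) i) \<noteq> k"] v v'
      unfolding v_def[symmetric] by auto
  qed (simp add: v' k_def)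
  moreover have "at_time E v \<le> at_time E u + 2 * D" if "delay_bound D" for D
    using time_mono[OF v(3)] L(3)[OF q(1) that] q(2) by simp
  ultimately show ?thesis using v(1,2) unfolding k_def by auto
qed

lemma phase_advances:
  assumes new: "begins u i \<or> ends u i" "busy (st (Suc u) i)" and i: "i \<notin> faulty E"
  shows "\<exists>v>u. ends v i \<and> pc (st v i) = pc (st (Suc u) i) \<and> (\<forall>l. u < l \<and> l \<le> v \<longrightarrow> busy (st l i)) \<and>
    (\<forall>D. delay_bound D \<longrightarrow> at_time E v \<le> at_time E u + 4 * D)"
proof -
  have r: "rnd (st (Suc u) i) \<noteq> rnd (st u i)" "even (rnd (st (Suc u) i))" "i \<in> {1..n}"
    using new by (auto simp: begins_def ends_def)
  then obtain v where v: "v > u" "rnd (st v i) = rnd (st (Suc u) i)" "rnd (st (Suc v) i) \<noteq> rnd (st v i)"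
    "\<And>D. delay_bound D \<Longrightarrow> at_time E v \<le> at_time E u + 2 * D"
    using round_advances[OF r(1) new(2) r(3) i] by blast
  have bv: "busy (st v i)" using same_phase(3)[of "Suc u" v i] v new by simp
  then have h: "halves v i" using v r
    by (cases v i rule: node_cases) (auto simp: begins_def ends_def stays_def)
  then have "busy (st (Suc v) i)" by (auto simp: halves_def)
  from round_advances[OF v(3) this r(3) i] obtain w where w: "w > v"
    "rnd (st w i) = rnd (st (Suc v) i)" "rnd (st (Suc w) i) \<noteq> rnd (st w i)"
    "\<And>D. delay_bound D \<Longrightarrow> at_time E w \<le> at_time E v + 2 * D" by blast
  have d: "rnd (st w i) div 2 = rnd (st (Suc u) i) div 2" using w(2) v(2) h by (auto simp: halves_def)
  have sp: "pc (st w i) = pc (st (Suc u) i)" "busy (st w i)"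
    using same_phase(2,3)[of "Suc u" w i, OF _ d] v(1) w(1) new(2) by auto
  have "busy (st l i)" if "u < l" "l \<le> w" for l
  proof -
    have "rnd (st l i) div 2 = rnd (st (Suc u) i) div 2"
      using div_le_mono[OF rnd_mono[of "Suc u" l i], of 2] div_le_mono[OF rnd_mono[of l w i], of 2] that d
      by simp
    then show ?thesis using same_phase(3)[of "Suc u" l i] that new(2) by simp
  qed
  moreover have "ends w i" using sp w h
    by (cases w i rule: node_cases) (auto simp: begins_def halves_def stays_def)
  moreover have "at_time E w \<le> at_time E u + 4 * D" if "delay_bound D" for D
    using v(4)[OF that] w(4)[OF that] by simp
  moreover have "u < w" using v(1) w(1) by simp
  ultimately show ?thesis using sp(1) by blast
qed

text \<open>\<open>rank\<close> bounds the number of phases that follow the current one, and each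
  phase consists of two rounds of at most two delays.\<close>

lemma operation_completes:
  fixes rank :: "'c \<Rightarrow> nat"
  assumes rank: "\<And>u. ends u i \<Longrightarrow> busy (st (Suc u) i) \<Longrightarrow> rank (pc (st (Suc u) i)) < rank (pc (st u i))"
    and inv: "invoked E a i op" and i: "i \<notin> faulty E"
  shows "\<exists>k r. completes E a k r \<and>
    (\<forall>D. delay_bound D \<longrightarrow> at_time E k - at_time E a \<le> 4 * (real (rank (pc (st (Suc a) i))) + 1) * D)"
proof -
  have "\<exists>k r. completes E a k r \<and>
      (\<forall>D. delay_bound D \<longrightarrow> at_time E k \<le> at_time E u + 4 * (real (rank (pc (st (Suc u) i))) + 1) * D)"
    if "begins u i \<or> ends u i" "busy (st (Suc u) i)" "running a (Suc u) i" for u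
    using that
  proof (induction "rank (pc (st (Suc u) i))" arbitrary: u rule: less_induct)
    case less
    obtain v where v: "v > u" "ends v i" "pc (st v i) = pc (st (Suc u) i)"
      "\<And>l. u < l \<Longrightarrow> l \<le> v \<Longrightarrow> busy (st l i)"
      "\<And>D. delay_bound D \<Longrightarrow> at_time E v \<le> at_time E u + 4 * D"
      using phase_advances[OF less.prems(1,2) i] by blast
    have "busy (st l i)" if "a < l" "l \<le> v" for l
      using less.prems(3) v(4) that by (cases "l \<le> Suc u") (auto simp: running_def)
    then have run: "running a v i" using less.prems(3) v(1) by (auto simp: running_def)
    show ?case
    proof (cases "busy (st (Suc v) i)")
      case True
      then have "rank (pc (st (Suc v) i)) < rank (pc (st (Suc u) i))" using rank v by metis
      moreover have "running a (Suc v) i" using run True by (auto simp: running_def le_Suc_eq)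
      ultimately obtain k r where k: "completes E a k r"
        "\<And>D. delay_bound D \<Longrightarrow> at_time E k \<le> at_time E v + 4 * (real (rank (pc (st (Suc v) i))) + 1) * D"
        using less.hyps[of v] v(2) True by blast
      have "at_time E k \<le> at_time E u + 4 * (real (rank (pc (st (Suc u) i))) + 1) * D" if D: "delay_bound D" for D
      proof -
        have "(real (rank (pc (st (Suc v) i))) + 1) * D \<le> real (rank (pc (st (Suc u) i))) * D"
          using \<open>rank (pc (st (Suc v) i)) < rank (pc (st (Suc u) i))\<close> D
          by (intro mult_right_mono) (auto simp: delay_bound_def)
        then show ?thesis using k(2)[OF D] v(5)[OF D] by (simp add: algebra_simps)
      qed
      then show ?thesis using k(1) by blast
    next
      case False
      then obtain r where "reply E v = Some (i, r)" using ends_reply[OF v(2)] crashed_faulty[OF i] by blast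
      then have "completes E a v r" using running_completes run by blast
      moreover have "at_time E v \<le> at_time E u + 4 * (real (rank (pc (st (Suc u) i))) + 1) * D"
        if D: "delay_bound D" for D
      proof -
        have "0 \<le> real (rank (pc (st (Suc u) i))) * D" using D by (auto simp: delay_bound_def)
        then show ?thesis using v(5)[OF D] by (simp add: algebra_simps)
      qed
      ultimately show ?thesis by blast
    qed
  qed
  moreover have b: "begins a i" using invoked_begins inv by blast
  moreover have "running a (Suc a) i" "busy (st (Suc a) i)" using b by (auto simp: running_def begins_def le_Suc_eq)
  ultimately show ?thesis by (simp add: diff_le_eq add.commute)
qed

end

section \<open>The snapshot protocol\<close>

text \<open>A triple consists of the writer, the sequence number of its write and the value.\<close>

type_synonym 'v view = "(node \<times> nat \<times> 'v) list"

text \<open>\<open>Proposed r m k A\<close> announces \<open>A\<close> to group \<open>k\<close> of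
  instance \<open>r\<close> with \<open>m\<close> levels left. The contributions in \<open>A\<close>
  are tagged with their nodes, each of which contributes at most once to an instance.\<close>

datatype 'v item =
    Written node nat 'v
  | Joined nat
  | Proposed nat nat nat "(node \<times> 'v view) list"
  | Committed nat "'v view"

text \<open>
  In \<open>Splitting r0 r m k A\<close>, \<open>r\<close> is the instance, \<open>m\<close> the number of remaining levels, \<open>k\<close> the group
  (its binary digits record the moves made so far), and \<open>A\<close> the set of contributions seen; \<open>r0\<close> is the
  first instance joined by the operation, so that commits of instances after \<open>r0\<close> may be borrowed.
  \<open>Merging\<close> is the second half of a move up. \<open>Resting l W\<close> remembers the last instance joined and the
  view returned; instance \<open>0\<close> stands for the initial situation.
\<close>

datatype 'v stage =
    Resting nat "'v view"
  | Writing nat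
  | Joining nat nat
  | Splitting nat nat nat nat "(node \<times> 'v view) list"
  | Merging nat nat nat nat "(node \<times> 'v view) list"

fun inst :: "'v stage \<Rightarrow> nat" where
  "inst (Resting l W) = l"
| "inst (Writing l) = l"
| "inst (Joining r0 r) = r"
| "inst (Splitting r0 r m k A) = r"
| "inst (Merging r0 r m k A) = r"

definition flatten :: "(node \<times> 'v view) list \<Rightarrow> 'v view" where
  "flatten A = concat (map snd A)"

fun written :: "'v item \<Rightarrow> 'v view" where
  "written (Written i s v) = [(i, s, v)]"
| "written (Joined r) = []"
| "written (Proposed r m k A) = flatten A"
| "written (Committed r W) = W"

definition collect :: "'v item list \<Rightarrow> 'v view" where
  "collect K = concat (map written K)"

definition latest :: "'v item list \<Rightarrow> nat" where
  "latest K = Max (insert 0 {r. Joined r \<in> set K})"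

definition proposals :: "nat \<Rightarrow> nat \<Rightarrow> nat \<Rightarrow> 'v item list \<Rightarrow> (node \<times> 'v view) list" where
  "proposals r m k K =
     concat (map (\<lambda>x. case x of Proposed r' m' k' A \<Rightarrow> if (r', m', k') = (r, m, k) then A else [] | _ \<Rightarrow> []) K)"

definition borrowable :: "nat \<Rightarrow> 'v item list \<Rightarrow> 'v view list" where
  "borrowable r0 K =
     concat (map (\<lambda>x. case x of Committed s W \<Rightarrow> if r0 < s then [W] else [] | _ \<Rightarrow> []) K)"

definition snapshot :: "(node \<Rightarrow> 'v) \<Rightarrow> 'v view \<Rightarrow> node \<Rightarrow> 'v" where
  "snapshot v0 W i =
     (if \<exists>s v. (i, s, v) \<in> set W
      then SOME v. \<exists>s. (i, s, v) \<in> set W \<and> (\<forall>s' v'. (i, s', v') \<in> set W \<longrightarrow> s' \<le> s)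
      else v0 i)"

definition respond :: "(node \<Rightarrow> 'v) \<Rightarrow> bool \<Rightarrow> 'v view \<Rightarrow> 'v response" where
  "respond v0 scan W = (if scan then Snap (snapshot v0 W) else Ack)"

text \<open>The fresh round number \<open>s\<close> doubles as the sequence number of the write. The
  flag remembers which kind of response the client expects.\<close>

fun begin_op :: "node \<Rightarrow> bool \<times> 'v stage \<Rightarrow> nat \<Rightarrow> 'v operation \<Rightarrow> (bool \<times> 'v stage) \<times> 'v item list" where
  "begin_op i (b, p) s op =
     ((op = Scan, Writing (inst p)), case op of Update v \<Rightarrow> [Written i s v] | Scan \<Rightarrow> [])"

text \<open>With \<open>Suc m\<close> levels left, a set in group \<open>k\<close> has more than
  \<open>k * 2 ^ Suc m\<close> elements and the whole group has at most
  \<open>(k + 1) * 2 ^ Suc m\<close>; the threshold \<open>(2 * k + 1) * 2 ^ m\<close> is the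
  midpoint of this range. After writing, a node joins the latest instance it knows, and opens a new
  one only if that is the one it joined last.\<close>

fun advance :: "(node \<Rightarrow> 'v) \<Rightarrow> nat \<Rightarrow> node \<Rightarrow> bool \<times> 'v stage \<Rightarrow> 'v item list \<Rightarrow>
    (bool \<times> 'v stage) \<times> 'v item list \<times> 'v response option" where
  "advance v0 L i (b, Resting l W) K = ((b, Resting l W), [], None)"
| "advance v0 L i (b, Writing l) K =
     (let r = (if l = latest K then Suc l else latest K) in ((b, Joining r r), [Joined r], None))"
| "advance v0 L i (b, Joining r0 r) K =
     (let A = [(i, collect K)] in ((b, Splitting r0 r L 0 A), [Proposed r L 0 A], None))"
| "advance v0 L i (b, Splitting r0 r (Suc m) k A) K =
     (let W = proposals r (Suc m) k K in
        if card (set W) \<le> (2 * k + 1) * 2 ^ m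
        then ((b, Splitting r0 r m (2 * k) A), [Proposed r m (2 * k) A], None)
        else ((b, Merging r0 r m k W), [Proposed r (Suc m) k W], None))"
| "advance v0 L i (b, Merging r0 r m k W) K =
     (let A = proposals r (Suc m) k K in
        ((b, Splitting r0 r m (2 * k + 1) A), [Proposed r m (2 * k + 1) A], None))"
| "advance v0 L i (b, Splitting r0 r 0 k A) K =
     (let W = flatten A in
        if latest K \<le> r then ((b, Resting r W), [Committed r W], Some (respond v0 b W))
        else case borrowable r0 K of
            W' # _ \<Rightarrow> ((b, Resting r W'), [], Some (respond v0 b W'))
          | [] \<Rightarrow> ((b, Joining r0 (latest K)), [Joined (latest K)], None))"

lemma set_collect: "set (collect K) = (\<Union>x\<in>set K. set (written x))"
  by (simp add: collect_def)

lemma set_flatten: "set (flatten A) = (\<Union>(i, X)\<in>set A. set X)"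
  by (force simp: flatten_def)

lemma finite_joined: "finite {r. Joined r \<in> set K}"
  by (rule finite_subset[of _ "(\<lambda>x. case x of Joined r \<Rightarrow> r | _ \<Rightarrow> 0) ` set K"]) (force simp: image_iff)+

lemma latest_ge: "Joined r \<in> set K \<Longrightarrow> r \<le> latest K"
  by (simp add: latest_def finite_joined)

lemma latest_joined: "r < latest K \<Longrightarrow> Joined (latest K) \<in> set K"
  using Max_in[of "insert 0 {r. Joined r \<in> set K}"] finite_joined[of K] by (auto simp: latest_def)

lemma set_proposals: "set (proposals r m k K) = (\<Union>A\<in>{A. Proposed r m k A \<in> set K}. set A)"
  by (fastforce simp: proposals_def split: item.splits if_splits)

lemma set_borrowable: "W \<in> set (borrowable r0 K) \<longleftrightarrow> (\<exists>s>r0. Committed s W \<in> set K)"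
  by (fastforce simp: borrowable_def split: item.splits if_splits)

locale snapshot_execution =
  runner_execution n f "\<lambda>_. (False, Resting 0 [])" begin_op "advance v0 L" E
  for n f :: nat and v0 :: "node \<Rightarrow> 'v" and L :: nat
    and E :: "('v, (bool \<times> 'v stage, 'v item) node_state, 'v item msg) execution" +
  assumes levels: "n \<le> 2 ^ L"
begin

abbreviation stage :: "nat \<Rightarrow> node \<Rightarrow> 'v stage" where "stage t i \<equiv> snd (pc (st t i))"
abbreviation Base :: "nat \<Rightarrow> node \<Rightarrow> 'v item set" where "Base t i \<equiv> set (base (st t i))"
abbreviation Known :: "nat \<Rightarrow> node \<Rightarrow> 'v item list" where "Known t i \<equiv> known (st t i)"

section \<open>Evolution of the stages\<close>

lemma stage_0: "stage 0 i = Resting 0 []"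
  by (simp add: st_0)

lemma begins_stage:
  assumes "begins t i"
  shows "stage (Suc t) i = Writing (inst (stage t i))" "Base t i \<subseteq> Base (Suc t) i"
    "\<And>op. invoked E t i op \<Longrightarrow> fst (pc (st (Suc t) i)) = (op = Scan)"
    "\<And>v. invoked E t i (Update v) \<Longrightarrow> Written i (rnd (st (Suc t) i)) v \<in> Base (Suc t) i"
proof -
  obtain b p where p: "pc (st t i) = (b, p)" by fastforce
  obtain op new where op: "invoked E t i op" "begin_op i (b, p) (rnd (st (Suc t) i)) op = (pc (st (Suc t) i), new)"
    "base (st (Suc t) i) = new @ base (st t i) @ Known t i"
    using assms p by (auto simp: begins_def)
  have pc: "pc (st (Suc t) i) = (op = Scan, Writing (inst p))" using op(2) by simp
  show "stage (Suc t) i = Writing (inst (stage t i))" "Base t i \<subseteq> Base (Suc t) i" using pc p op(3) by auto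
  show "fst (pc (st (Suc t) i)) = (op' = Scan)" if "invoked E t i op'" for op'
    using that op(1) pc by (auto dest: invoked_unique)
  show "Written i (rnd (st (Suc t) i)) v \<in> Base (Suc t) i" if "invoked E t i (Update v)" for v
    using invoked_unique[OF that op(1)] op(2,3) by auto
qed

lemma busy_stage: "busy (st t i) \<Longrightarrow> stage t i \<noteq> Resting l W"
proof (induction t arbitrary: l W)
  case (Suc t)
  show ?case
  proof (cases t i rule: node_cases)
    case 3
    then obtain b p b' p' new r where "pc (st t i) = (b, p)" "busy (st t i)" "pc (st (Suc t) i) = (b', p')"
      "advance v0 L i (b, p) (Known (Suc t) i) = ((b', p'), new, r)" "busy (st (Suc t) i) = (r = None)"
      by (cases "pc (st t i)"; cases "pc (st (Suc t) i)") (auto simp: ends_def)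
    moreover have "p \<noteq> Resting l' W'" for l' W' using Suc.IH calculation by auto
    ultimately show ?thesis using Suc.prems
      by (cases "(v0, L, i, (b, p), Known (Suc t) i)" rule: advance.cases)
        (auto simp: Let_def split: if_splits list.splits)
  qed (use Suc begins_stage[of t i] in \<open>auto simp: halves_def stays_def\<close>)
qed (simp add: st_0)

lemma ends_base: "ends u i \<Longrightarrow> Base u i \<subseteq> set (Known (Suc u) i)"
proof -
  assume "ends u i"
  then obtain t where "phase i t u" using ends_phase by blast
  then show ?thesis using phase_self same_phase(1)[of t u i] phase_less phase_div by (metis less_imp_le)
qed

text \<open>The old base does not show up in the new one because a phase collects its own base, by
  \<open>ends_base\<close>.\<close>

lemma ends_cases:
  assumes "ends u i"
  obtains (choose) l r where "stage u i = Writing l" "r = (if l = latest (Known (Suc u) i) then Suc l else latest (Known (Suc u) i))"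
      "stage (Suc u) i = Joining r r" "Base (Suc u) i = {Joined r} \<union> set (Known (Suc u) i)" "busy (st (Suc u) i)"
  | (join) r0 r where "stage u i = Joining r0 r"
      "stage (Suc u) i = Splitting r0 r L 0 [(i, collect (Known (Suc u) i))]"
      "Base (Suc u) i = {Proposed r L 0 [(i, collect (Known (Suc u) i))]} \<union> set (Known (Suc u) i)" "busy (st (Suc u) i)"
  | (slave) r0 r m k A where "stage u i = Splitting r0 r (Suc m) k A"
      "card (set (proposals r (Suc m) k (Known (Suc u) i))) \<le> (2 * k + 1) * 2 ^ m"
      "stage (Suc u) i = Splitting r0 r m (2 * k) A"
      "Base (Suc u) i = {Proposed r m (2 * k) A} \<union> set (Known (Suc u) i)" "busy (st (Suc u) i)"
  | (master) r0 r m k A W where "stage u i = Splitting r0 r (Suc m) k A"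
      "W = proposals r (Suc m) k (Known (Suc u) i)" "(2 * k + 1) * 2 ^ m < card (set W)"
      "stage (Suc u) i = Merging r0 r m k W"
      "Base (Suc u) i = {Proposed r (Suc m) k W} \<union> set (Known (Suc u) i)" "busy (st (Suc u) i)"
  | (merge) r0 r m k W A where "stage u i = Merging r0 r m k W"
      "A = proposals r (Suc m) k (Known (Suc u) i)" "stage (Suc u) i = Splitting r0 r m (2 * k + 1) A"
      "Base (Suc u) i = {Proposed r m (2 * k + 1) A} \<union> set (Known (Suc u) i)" "busy (st (Suc u) i)"
  | (commit) r0 r k A where "stage u i = Splitting r0 r 0 k A" "latest (Known (Suc u) i) \<le> r"
      "stage (Suc u) i = Resting r (flatten A)"
      "Base (Suc u) i = {Committed r (flatten A)} \<union> set (Known (Suc u) i)" "\<not> busy (st (Suc u) i)"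
  | (borrow) r0 r k A s W where "stage u i = Splitting r0 r 0 k A" "r < latest (Known (Suc u) i)"
      "Committed s W \<in> set (Known (Suc u) i)" "r0 < s" "stage (Suc u) i = Resting r W"
      "Base (Suc u) i = set (Known (Suc u) i)" "\<not> busy (st (Suc u) i)"
  | (retry) r0 r k A where "stage u i = Splitting r0 r 0 k A" "r < latest (Known (Suc u) i)"
      "borrowable r0 (Known (Suc u) i) = []" "stage (Suc u) i = Joining r0 (latest (Known (Suc u) i))"
      "Base (Suc u) i = {Joined (latest (Known (Suc u) i))} \<union> set (Known (Suc u) i)" "busy (st (Suc u) i)"
proof -
  obtain b p b' p' new r where pc: "pc (st u i) = (b, p)" "busy (st u i)"
    "advance v0 L i (b, p) (Known (Suc u) i) = ((b', p'), new, r)"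
    "base (st (Suc u) i) = new @ base (st u i) @ Known (Suc u) i" "busy (st (Suc u) i) = (r = None)"
    "pc (st (Suc u) i) = (b', p')"
    using assms by (cases "pc (st u i)"; cases "pc (st (Suc u) i)") (auto simp: ends_def)
  have B: "Base (Suc u) i = set new \<union> set (Known (Suc u) i)" using ends_base[OF assms] pc(4) by auto
  show thesis
  proof (cases p)
    case (Resting l W)
    then show ?thesis using busy_stage[OF pc(2), of l W] pc(1) by simp
  next
    case (Writing l)
    then show ?thesis using choose[of l] pc B by (auto simp: Let_def)
  next
    case (Joining r0 q)
    then show ?thesis using join[of r0 q] pc B by (auto simp: Let_def)
  next
    case (Merging r0 q m k W)
    then show ?thesis using merge[of r0 q m k W] pc B by (auto simp: Let_def)
  next
    case (Splitting r0 q m k A)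
    show ?thesis
    proof (cases m)
      case (Suc m')
      show ?thesis
      proof (cases "card (set (proposals q m k (Known (Suc u) i))) \<le> (2 * k + 1) * 2 ^ m'")
        case True
        then show ?thesis using slave[of r0 q m' k A] pc B Splitting Suc by (auto simp: Let_def)
      next
        case False
        then show ?thesis using master[of r0 q m' k A] pc B Splitting Suc by (auto simp: Let_def)
      qed
    next
      case 0
      show ?thesis
      proof (cases "latest (Known (Suc u) i) \<le> q")
        case True
        then show ?thesis using commit[of r0 q k A] pc B Splitting 0 by (auto simp: Let_def)
      next
        case False
        show ?thesis
        proof (cases "borrowable r0 (Known (Suc u) i)")
          case Nil
          then show ?thesis using False retry[of r0 q k A] pc B Splitting 0 by (auto simp: Let_def)
        next
          case (Cons W ws)
          then obtain s where "s > r0" "Committed s W \<in> set (Known (Suc u) i)"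
            using set_borrowable[of W r0] by (metis list.set_intros(1))
          then show ?thesis using Cons False borrow[of r0 q k A s W] pc B Splitting 0 by (auto simp: Let_def)
        qed
      qed
    qed
  qed
qed

lemma ends_reply_view:
  assumes "reply E u = Some (i, x)"
  shows "\<exists>l W. stage (Suc u) i = Resting l W \<and> x = respond v0 (fst (pc (st u i))) W"
proof -
  obtain b p where p: "pc (st u i) = (b, p)" by fastforce
  from reply_ends(3)[OF assms] obtain new b' p'
    where "advance v0 L i (b, p) (Known (Suc u) i) = ((b', p'), new, Some x)" "pc (st (Suc u) i) = (b', p')"
    using p by (metis surj_pair)
  then show ?thesis using p
    by (cases "(v0, L, i, (b, p), Known (Suc u) i)" rule: advance.cases)
      (auto simp: Let_def split: if_splits list.splits)
qed

lemma ends_flag: "ends u i \<Longrightarrow> fst (pc (st (Suc u) i)) = fst (pc (st u i))"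
proof -
  assume "ends u i"
  then obtain b p b' p' new r where "pc (st u i) = (b, p)" "pc (st (Suc u) i) = (b', p')"
    "advance v0 L i (b, p) (Known (Suc u) i) = ((b', p'), new, r)"
    by (cases "pc (st u i)"; cases "pc (st (Suc u) i)") (auto simp: ends_def)
  then show ?thesis
    by (cases "(v0, L, i, (b, p), Known (Suc u) i)" rule: advance.cases)
      (auto simp: Let_def split: if_splits list.splits)
qed

lemma running_flag:
  "running a t i \<Longrightarrow> invoked E a i op \<Longrightarrow> fst (pc (st t i)) = (op = Scan)"
proof (induction t)
  case (Suc t)
  show ?case
  proof (cases "a = t")
    case True
    then show ?thesis using Suc.prems begins_stage(3) by (auto simp: running_def)
  next
    case False
    then have "running a t i" using Suc.prems by (auto simp: running_def)
    moreover then have "busy (st t i)" by (auto simp: running_def)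
    ultimately show ?thesis using Suc ends_flag[of t i]
      by (cases t i rule: node_cases) (auto simp: begins_def halves_def stays_def)
  qed
qed (simp add: running_def)

text \<open>Tailored to facts that tie the stage of a node to items in its base; monotonicity in the
  items takes care of growing bases.\<close>

lemma stage_induct:
  assumes start: "Q (Resting 0 []) {}"
    and base: "\<And>p X Y. Q p X \<Longrightarrow> X \<subseteq> Y \<Longrightarrow> Q p Y"
    and begins: "\<And>t i. begins t i \<Longrightarrow> Q (stage t i) (Base (Suc t) i) \<Longrightarrow>
      Q (Writing (inst (stage t i))) (Base (Suc t) i)"
    and ends: "\<And>t i. ends t i \<Longrightarrow> Q (stage t i) (Base t i) \<Longrightarrow> Q (stage (Suc t) i) (Base (Suc t) i)"
  shows "Q (stage t i) (Base t i)"
proof (induction t)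
  case 0
  then show ?case using start by (simp add: st_0)
next
  case (Suc t)
  show ?case
  proof (cases t i rule: node_cases)
    case 1
    have "Q (stage t i) (Base (Suc t) i)" using base[OF Suc] begins_stage(2)[OF 1] by blast
    then show ?thesis using begins[OF 1] begins_stage(1)[OF 1] by simp
  next
    case 3
    then show ?thesis using ends Suc by blast
  qed (use Suc in \<open>auto simp: halves_def stays_def\<close>)
qed

lemma inst_joined: "inst (stage t i) = 0 \<or> Joined (inst (stage t i)) \<in> Base t i"
proof (rule stage_induct[where Q = "\<lambda>p X. inst p = 0 \<or> Joined (inst p) \<in> X"])
  show "inst (stage (Suc t) i) = 0 \<or> Joined (inst (stage (Suc t) i)) \<in> Base (Suc t) i"
    if "ends t i" "inst (stage t i) = 0 \<or> Joined (inst (stage t i)) \<in> Base t i" for t i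
    using that(2) ends_base[OF that(1)] by (rule_tac ends_cases[OF that(1)]) auto
qed auto

lemma inst_latest: "ends u i \<Longrightarrow> inst (stage u i) \<le> latest (Known (Suc u) i)"
  using inst_joined[of u i] ends_base[of u i] latest_ge[of "inst (stage u i)" "Known (Suc u) i"] by auto

text \<open>The latest known instance is never below the last one joined, and a node moves past the
  latter in either case. Hence no node joins an instance twice, which makes contributions
  unique.\<close>

lemma join_increases:
  assumes "ends u i" "stage (Suc u) i = Joining r0 r"
  shows "inst (stage u i) < r"
  using assms(1)
proof (cases rule: ends_cases)
  case (choose l r)
  then show ?thesis using assms inst_latest[OF assms(1)] by (auto split: if_splits)
qed (use assms in auto)

lemma inst_mono: "t \<le> u \<Longrightarrow> inst (stage t i) \<le> inst (stage u i)"
proof (rule lift_Suc_mono_le[of "\<lambda>t. inst (stage t i)"])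
  fix t
  show "inst (stage t i) \<le> inst (stage (Suc t) i)"
  proof (cases t i rule: node_cases)
    case 1
    then show ?thesis using begins_stage by simp
  next
    case 3
    show ?thesis using 3(1)
      by (rule ends_cases) (use join_increases[OF 3(1)] in \<open>auto intro: less_imp_le\<close>)
  qed (auto simp: halves_def stays_def)
qed

text \<open>Knowledge of an opened instance comes with a commit of the preceding one. Instance 1 is
  exempt, as only the initial situation precedes it.\<close>

definition closed :: "'v item set \<Rightarrow> bool" where
  "closed X \<longleftrightarrow> (\<forall>r\<ge>1. Joined (Suc r) \<in> X \<longrightarrow> (\<exists>W. Committed r W \<in> X))"

text \<open>An operation ends by committing its instance or by borrowing, and a borrower knows a
  later instance. So a node that knows of no later instance than its own holds a commit of
  it.\<close>

lemma resting_superseded: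
  assumes "stage t i = Resting l W \<or> stage t i = Writing l"
  shows "l = 0 \<or> (\<exists>W. Committed l W \<in> Base t i) \<or> (\<exists>r>l. Joined r \<in> Base t i)"
proof -
  define Q :: "'v stage \<Rightarrow> 'v item set \<Rightarrow> bool" where
    "Q p X \<longleftrightarrow> (\<forall>l. ((\<exists>W. p = Resting l W) \<or> p = Writing l) \<longrightarrow>
      l = 0 \<or> (\<exists>W. Committed l W \<in> X) \<or> (\<exists>r>l. Joined r \<in> X))" for p X
  have "Q (stage t i) (Base t i)"
  proof (rule stage_induct)
    show "Q p X \<Longrightarrow> X \<subseteq> Y \<Longrightarrow> Q p Y" for p X Y unfolding Q_def by blast
  next
    fix t i assume b: "begins t i" and q: "Q (stage t i) (Base (Suc t) i)"
    have "\<exists>l W. stage t i = Resting l W"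
    proof -
      have "\<not> busy (st t i)" using b by (simp add: begins_def)
      then show ?thesis
      proof (induction t)
        case (Suc t)
        show ?case
        proof (cases t i rule: node_cases)
          case 3
          show ?thesis using 3(1) by (rule ends_cases) (use Suc in auto)
        qed (use Suc in \<open>auto simp: begins_def halves_def stays_def\<close>)
      qed (simp add: stage_0)
    qed
    then show "Q (Writing (inst (stage t i))) (Base (Suc t) i)" using q unfolding Q_def by auto
  next
    fix t i assume e: "ends t i"
    show "Q (stage (Suc t) i) (Base (Suc t) i)" using e
    proof (cases rule: ends_cases)
      case (borrow r0 r k A s W)
      then have "Joined (latest (Known (Suc t) i)) \<in> Base (Suc t) i" using latest_joined[of r] by simp
      then show ?thesis using borrow unfolding Q_def by auto
    qed (auto simp: Q_def)
  qed (simp add: Q_def)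
  then show ?thesis using assms by (auto simp: Q_def)
qed

lemma closed_insert_old: "closed X \<Longrightarrow> Joined r \<in> X \<Longrightarrow> closed (insert (Joined r) X)"
  by (auto simp: closed_def)

lemma known_base_closed: "closed (set (Known t i))" "closed (Base t i)"
proof (induction rule: item_sets_induct[where S = "\<lambda>_. closed"])
  case (3 t X Y)
  then show ?case unfolding closed_def by blast
next
  case (4 t i)
  obtain op new where *: "base (st (Suc t) i) = new @ base (st t i) @ Known t i"
    "begin_op i (pc (st t i)) (rnd (st (Suc t) i)) op = (pc (st (Suc t) i), new)"
    using 4(1) by (auto simp: begins_def)
  have "Joined r \<notin> set new" for r using *(2) by (cases "pc (st t i)") (auto split: operation.splits)
  then show ?case using 4 *(1) unfolding closed_def by auto
next
  case (5 t i)
  have K: "closed (set (Known (Suc t) i))" by fact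
  show ?case using 5(1)
  proof (cases rule: ends_cases)
    case (choose l r)
    show ?thesis
    proof (cases "l = latest (Known (Suc t) i)")
      case True
      \<comment> \<open>Here \<open>Suc l\<close> is opened. With \<open>l\<close> as the latest
        known instance, \<open>resting_superseded\<close> leaves only a commit of \<open>l\<close>
        or \<open>l = 0\<close>.\<close>
      have "\<not> (\<exists>r>l. Joined r \<in> Base t i)"
        using latest_ge[of _ "Known (Suc t) i"] ends_base[OF 5(1)] True by fastforce
      then have "l = 0 \<or> (\<exists>W. Committed l W \<in> set (Known (Suc t) i))"
        using resting_superseded[of t i l] choose(1) ends_base[OF 5(1)] by blast
      then show ?thesis using K choose True by (auto simp: closed_def)
    next
      case False
      then have "l < latest (Known (Suc t) i)" using inst_latest[OF 5(1)] choose(1) by simp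
      then have "Joined r \<in> set (Known (Suc t) i)" using choose(2) False latest_joined[of l] by simp
      then show ?thesis using K choose closed_insert_old by simp
    qed
  next
    case (retry r0 r k A)
    \<comment> \<open>A retry repeats a known join and opens nothing.\<close>
    then have "Joined (latest (Known (Suc t) i)) \<in> set (Known (Suc t) i)" using latest_joined[of r] by simp
    then show ?thesis using K retry closed_insert_old by simp
  qed (use K in \<open>auto simp: closed_def\<close>)
qed (auto simp: closed_def)

text \<open>The default 1 makes positivity hold in every stage.\<close>

fun first_inst :: "'v stage \<Rightarrow> nat" where
  "first_inst (Joining r0 r) = r0"
| "first_inst (Splitting r0 r m k A) = r0"
| "first_inst (Merging r0 r m k A) = r0"
| "first_inst p = 1"

lemma first_inst_bounds:
  "1 \<le> first_inst (stage t i) \<and> (\<forall>r0 r m k A. stage t i = Joining r0 r \<or> stage t i = Splitting r0 r m k A \<or>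
     stage t i = Merging r0 r m k A \<longrightarrow> r0 \<le> r)"
proof (rule stage_induct[where Q = "\<lambda>p X. 1 \<le> first_inst p \<and> (\<forall>r0 r m k A. p = Joining r0 r \<or>
     p = Splitting r0 r m k A \<or> p = Merging r0 r m k A \<longrightarrow> r0 \<le> r)"])
  fix t i
  assume e: "ends t i" and IH: "1 \<le> first_inst (stage t i) \<and> (\<forall>r0 r m k A. stage t i = Joining r0 r \<or>
     stage t i = Splitting r0 r m k A \<or> stage t i = Merging r0 r m k A \<longrightarrow> r0 \<le> r)"
  show "1 \<le> first_inst (stage (Suc t) i) \<and> (\<forall>r0 r m k A. stage (Suc t) i = Joining r0 r \<or>
     stage (Suc t) i = Splitting r0 r m k A \<or> stage (Suc t) i = Merging r0 r m k A \<longrightarrow> r0 \<le> r)"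
    using e
  proof (cases rule: ends_cases)
    case (choose l r)
    have "l \<le> latest (Known (Suc t) i)" using inst_latest[OF e] choose(1) by simp
    then show ?thesis using choose by (auto split: if_splits)
  next
    case (retry r0 r k A)
    then have "r0 \<le> r" "1 \<le> r0" using IH by auto
    then show ?thesis using retry by auto
  qed (use IH in auto)
qed auto

lemma levels_bound:
  "(stage t i = Splitting r0 r m k A \<longrightarrow> m \<le> L) \<and> (stage t i = Merging r0 r m k A \<longrightarrow> m < L)"
proof -
  have "\<forall>r0 r m k A. (stage t i = Splitting r0 r m k A \<longrightarrow> m \<le> L) \<and> (stage t i = Merging r0 r m k A \<longrightarrow> m < L)"
  proof (rule stage_induct[where Q = "\<lambda>p X. \<forall>r0 r m k A. (p = Splitting r0 r m k A \<longrightarrow> m \<le> L) \<and>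
      (p = Merging r0 r m k A \<longrightarrow> m < L)"])
    fix t i
    assume e: "ends t i" and IH: "\<forall>r0 r m k A. (stage t i = Splitting r0 r m k A \<longrightarrow> m \<le> L) \<and>
      (stage t i = Merging r0 r m k A \<longrightarrow> m < L)"
    show "\<forall>r0 r m k A. (stage (Suc t) i = Splitting r0 r m k A \<longrightarrow> m \<le> L) \<and>
      (stage (Suc t) i = Merging r0 r m k A \<longrightarrow> m < L)"
      using e by (cases rule: ends_cases) (use IH in \<open>auto dest: Suc_leD\<close>)
  qed auto
  then show ?thesis by blast
qed

text \<open>
  An operation that fails a second time has seen an instance that nobody could open without having
  committed the preceding one, so it finds a view to borrow.
\<close>

lemma retry_first:
  assumes e: "ends u i" and s: "stage u i = Splitting r0 r 0 k A" "r < latest (Known (Suc u) i)"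
    and b: "borrowable r0 (Known (Suc u) i) = []"
  shows "r0 = r"
proof (rule ccontr)
  assume "r0 \<noteq> r"
  then have r: "1 \<le> r0" "r0 < r" using first_inst_bounds[of u i] s(1) by auto
  \<comment> \<open>The latest instance is \<open>Suc q\<close> with \<open>q \<ge> r > r0\<close>,
    so a commit of \<open>q\<close> is late enough to be borrowed.\<close>
  then obtain q where q: "latest (Known (Suc u) i) = Suc q" "r \<le> q" using s(2) by (cases "latest (Known (Suc u) i)") auto
  then have "Joined (Suc q) \<in> set (Known (Suc u) i)" using latest_joined[OF s(2)] by simp
  then obtain W where "Committed q W \<in> set (Known (Suc u) i)"
    using known_base_closed(1)[of "Suc u" i] r q(2) unfolding closed_def by fastforce
  then have "W \<in> set (borrowable r0 (Known (Suc u) i))" using set_borrowable r q(2) by (metis less_le_trans)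
  then show False using b by simp
qed

text \<open>\<open>r0 = r\<close> characterizes the first attempt, which keeps in reserve the budget
  \<open>2 * L + 2\<close> of a second one.\<close>

definition bonus :: "nat \<Rightarrow> nat \<Rightarrow> nat" where
  "bonus r0 r = (if r0 = r then 2 * L + 2 else 0)"

text \<open>A level costs at most two phases, one for splitting and one for merging; hence the
  factor 2 of \<open>m\<close>.\<close>

fun rank :: "'v stage \<Rightarrow> nat" where
  "rank (Resting l W) = 0"
| "rank (Writing l) = 4 * L + 5"
| "rank (Joining r0 r) = 2 * L + 2 + bonus r0 r"
| "rank (Splitting r0 r m k A) = 2 * m + 1 + bonus r0 r"
| "rank (Merging r0 r m k A) = 2 * m + 2 + bonus r0 r"

lemma rank_decreases:
  assumes "ends u i" "busy (st (Suc u) i)"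
  shows "rank (stage (Suc u) i) < rank (stage u i)"
  using assms(1)
proof (cases rule: ends_cases)
  case (retry r0 r k A)
  have "r0 = r" using retry_first[OF assms(1) retry(1-3)] .
  then show ?thesis using retry by (auto simp: bonus_def)
qed (use assms(2) in \<open>auto simp: bonus_def\<close>)

lemma operations_complete:
  assumes "invoked E a i op" "i \<notin> faulty E"
  shows "\<exists>k r. completes E a k r \<and>
    (\<forall>D. delay_bound D \<longrightarrow> at_time E k - at_time E a \<le> (24 + 16 * real L) * D)"
proof -
  have "stage (Suc a) i = Writing (inst (stage a i))" by (rule begins_stage(1)[OF invoked_begins[OF assms(1)]])
  \<comment> \<open>The writing phase and at most \<open>4 * L + 5\<close> further ones, with four
    delays each.\<close>
  then have "4 * (real (rank (stage (Suc a) i)) + 1) = 24 + 16 * real L" by simp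
  then show ?thesis
    using operation_completes[where rank = "\<lambda>c. rank (snd c)", OF rank_decreases assms] by simp
qed

subsection \<open>Lattice agreement within an instance\<close>

lemma phase_after:
  assumes "begins a i \<or> ends a i" "a < u" "phase i t u"
  shows "a < t"
proof (rule ccontr)
  assume "\<not> a < t"
  then consider "t = a" | "t < a" by linarith
  then show False
  proof cases
    case 1
    then show ?thesis using assms by (auto simp: phase_def halves_def begins_def ends_def)
  next
    case 2
    have "rnd (st (Suc t) i) \<le> rnd (st a i)" "rnd (st (Suc a) i) \<le> rnd (st u i)"
      using 2 assms(2) by (auto intro: rnd_mono)
    moreover have "rnd (st a i) < rnd (st (Suc a) i)" using assms(1) by (auto simp: begins_def ends_def)
    ultimately show ?thesis using assms(3) by (auto simp: phase_def)
  qed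
qed

lemma phase_base: "phase i t u \<Longrightarrow> Base t i = Base u i"
  using same_phase(1)[of t u i] phase_less[of i t u] phase_div[of i t u] by simp

lemma phase_collects:
  assumes "phase i t u" "phase j t' u'" "t \<le> t'"
  shows "Base u i \<subseteq> set (Known (Suc u') j)"
  using phase_sees[OF assms] phase_base[OF assms(1)] by simp

lemma stage_entered:
  assumes "\<And>W. stage t i \<noteq> Resting 0 W" "\<And>l. stage t i \<noteq> Writing l"
  obtains u where "u < t" "ends u i" "stage (Suc u) i = stage t i" "Base (Suc u) i = Base t i"
proof (cases t i rule: entered)
  case never
  then show thesis using assms(1)[of "[]"] by simp
next
  case (entry u)
  have "\<not> begins u i"
  proof
    assume "begins u i"
    then have "stage (Suc u) i = Writing (inst (stage u i))" by (rule begins_stage)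
    then show False using assms(2) entry(3) by simp
  qed
  then show thesis using that entry by auto
qed

definition input :: "node \<Rightarrow> nat \<Rightarrow> nat \<Rightarrow> nat \<Rightarrow> 'v view \<Rightarrow> bool" where
  "input i r t u X \<longleftrightarrow> phase i t u \<and> (\<exists>r0. stage u i = Joining r0 r) \<and> X = collect (Known (Suc u) i)"

text \<open>Since joining strictly increases the instance, the later of two such phases would have
  been entered before the earlier one ended; but that end already moves on to a new phase
  number.\<close>

lemma input_once:
  assumes "input i r t u X" "input i r t' u' X'"
  shows "u = u'"
proof -
  have "False" if p: "phase i t u" "stage u i = Joining r0 r" and q: "phase i t' u'" "stage u' i = Joining r1 r" "u < u'"
    for t u r0 t' u' r1
  proof -
    obtain w where w: "w < u'" "ends w i" "stage (Suc w) i = stage u' i"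
      using stage_entered[of u' i] q(2) by auto
    have eu: "ends u i" using p by (simp add: phase_def)
    have lt: "inst (stage w i) < r" using join_increases[OF w(2)] w(3) q(2) by simp
    have "w < u \<or> w = u" using inst_mono[of "Suc u" w i] inst_mono[of u "Suc u" i] p(2) lt by fastforce
    then show False
    proof
      assume "w = u"
      then show False using lt p(2) by simp
    next
      assume "w < u"
      obtain v where v: "v < u'" "begins v i \<or> ends v i" "rnd (st (Suc v) i) div 2 = rnd (st u' i) div 2"
        "stage (Suc v) i = stage u' i"
      proof (cases u' i rule: entered)
        case never
        then show thesis using q(2) by simp
      next
        case (entry v)
        then show thesis using that by auto
      qed
      have "ends v i" using v(2,4) q(2) begins_stage(1)[of v i] by auto
      then have "inst (stage v i) < r" using join_increases v(4) q(2) by simp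
      then have "\<not> Suc u \<le> v" using inst_mono[of u v i] p(2) by fastforce
      moreover have "v \<noteq> u" using \<open>inst (stage v i) < r\<close> p(2) by auto
      ultimately have "Suc v \<le> u" by simp
      have "rnd (st (Suc v) i) div 2 \<le> rnd (st u i) div 2" using rnd_mono[OF \<open>Suc v \<le> u\<close>] by (rule div_le_mono)
      moreover have "rnd (st u i) div 2 < rnd (st (Suc u) i) div 2" using eu by (auto simp: ends_def elim!: oddE)
      moreover have "rnd (st (Suc u) i) div 2 \<le> rnd (st u' i) div 2"
        using q(3) by (intro div_le_mono rnd_mono) simp
      ultimately show False using v(3) by simp
    qed
  qed
  then show ?thesis using assms unfolding input_def by (meson nat_neq_iff)
qed

lemma input_unique: "input i r t u X \<Longrightarrow> input i r t' u' X' \<Longrightarrow> X = X'"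
  using input_once[of i r t u X t' u' X'] by (simp add: input_def)

lemma splitting_proposed: "stage t i = Splitting r0 r m k A \<Longrightarrow> Proposed r m k A \<in> Base t i"
proof -
  assume s: "stage t i = Splitting r0 r m k A"
  obtain u where u: "ends u i" "stage (Suc u) i = stage t i" "Base (Suc u) i = Base t i"
    using stage_entered[of t i] s by auto
  show ?thesis using u(1) by (rule ends_cases) (use u s in auto)
qed

lemma merging_parent:
  assumes "stage t i = Merging r0 r m k W"
  shows "Proposed r (Suc m) k W \<in> Base t i" "(2 * k + 1) * 2 ^ m < card (set W)"
    "\<exists>u A. u < t \<and> ends u i \<and> stage u i = Splitting r0 r (Suc m) k A \<and> set A \<subseteq> set W \<and>
      W = proposals r (Suc m) k (Known (Suc u) i)"
proof -
  obtain u where u: "u < t" "ends u i" "stage (Suc u) i = stage t i" "Base (Suc u) i = Base t i"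
    using stage_entered[of t i] assms by auto
  have *: "Proposed r (Suc m) k W \<in> Base t i \<and> (2 * k + 1) * 2 ^ m < card (set W) \<and>
    (\<exists>A. stage u i = Splitting r0 r (Suc m) k A \<and> set A \<subseteq> set W \<and>
      W = proposals r (Suc m) k (Known (Suc u) i))"
    using u(2)
  proof (cases rule: ends_cases)
    case (master r0' r' m' k' A W')
    have "Proposed r' (Suc m') k' A \<in> set (Known (Suc u) i)"
      using splitting_proposed[OF master(1)] ends_base[OF u(2)] by blast
    then have "set A \<subseteq> set W'" using master(2) by (auto simp: set_proposals)
    then show ?thesis using master u assms by auto
  qed (use u assms in auto)
  then show "Proposed r (Suc m) k W \<in> Base t i" "(2 * k + 1) * 2 ^ m < card (set W)"
    "\<exists>u A. u < t \<and> ends u i \<and> stage u i = Splitting r0 r (Suc m) k A \<and> set A \<subseteq> set W \<and>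
      W = proposals r (Suc m) k (Known (Suc u) i)"
    using u by blast+
qed

lemma splitting_cases:
  assumes "stage t i = Splitting r0 r m k A"
  obtains (first) u s where "u < t" "phase i s u" "stage u i = Joining r0 r" "m = L" "k = 0"
      "A = [(i, collect (Known (Suc u) i))]"
  | (slave) u s k' where "u < t" "phase i s u" "stage u i = Splitting r0 r (Suc m) k' A" "k = 2 * k'"
      "card (set (proposals r (Suc m) k' (Known (Suc u) i))) \<le> (2 * k' + 1) * 2 ^ m"
  | (master) u s k' W where "u < t" "phase i s u" "stage u i = Merging r0 r m k' W" "k = 2 * k' + 1"
      "A = proposals r (Suc m) k' (Known (Suc u) i)" "set W \<subseteq> set A"
proof -
  obtain u where u: "u < t" "ends u i" "stage (Suc u) i = stage t i"
    using stage_entered[of t i] assms by auto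
  obtain s where s: "phase i s u" using ends_phase u(2) by blast
  show thesis using u(2)
  proof (cases rule: ends_cases)
    case (merge r0' r' m' k' W A')
    have "Proposed r' (Suc m') k' W \<in> set (Known (Suc u) i)"
      using merging_parent(1)[OF merge(1)] ends_base[OF u(2)] by blast
    then have "set W \<subseteq> set A'" using merge(2) by (auto simp: set_proposals)
    then show thesis using master[OF u(1) s] merge u(3) assms by auto
  qed (use first[OF u(1) s] slave[OF u(1) s] u assms in auto)
qed

text \<open>A set is kept by a move down and enlarged by a move up, so the initial contribution is
  never lost.\<close>

lemma own_input:
  assumes "stage t i = Splitting r0 r m k A"
  shows "\<exists>s u X. u < t \<and> input i r s u X \<and> (i, X) \<in> set A"
  using assms
proof (induction t arbitrary: m k A rule: less_induct)
  case (less t)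
  from less.prems show ?case
  proof (cases rule: splitting_cases)
    case (first u s)
    then show ?thesis unfolding input_def by auto
  next
    case (slave u s k')
    then show ?thesis using less.IH[OF slave(1,3)] by (meson less_trans)
  next
    case (master u s k' W)
    obtain w B where "w < u" "stage w i = Splitting r0 r (Suc m) k' B" "set B \<subseteq> set W"
      using merging_parent(3)[OF master(3)] by blast
    then show ?thesis using less.IH[of w] master(1,6) by (meson less_trans subsetD)
  qed
qed

section \<open>Groups and their sizes\<close>

definition member :: "nat \<Rightarrow> nat \<Rightarrow> nat \<Rightarrow> (node \<times> 'v view) list \<Rightarrow> bool" where
  "member r m k A \<longleftrightarrow> (\<exists>t i r0. stage t i = Splitting r0 r m k A)"

text \<open>The union ranges over all nodes and the entire execution, so the size bounds hold
  independently of time.\<close>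

definition group :: "nat \<Rightarrow> nat \<Rightarrow> nat \<Rightarrow> (node \<times> 'v view) set" where
  "group r m k = (\<Union>A\<in>{A. member r m k A}. set A)"

text \<open>The enlarged sets published by merging nodes are unions of proposals of the same group
  and thus add nothing to it.\<close>

lemma proposed_group:
  assumes "Proposed r m k B \<in> set (Known t i) \<or> Proposed r m k B \<in> Base t i"
  shows "set B \<subseteq> group r m k"
proof -
  define G :: "nat \<Rightarrow> 'v item \<Rightarrow> bool" where
    "G t x \<longleftrightarrow> (\<forall>r m k B. x = Proposed r m k B \<longrightarrow> set B \<subseteq> group r m k)" for t x
  have "\<forall>x\<in>set (Known t i) \<union> Base t i. G t x"
  proof (rule items_induct[where G = G])
    fix t i op c new x
    assume "begin_op i (pc (st t i)) (rnd (st (Suc t) i)) op = (c, new)" "x \<in> set new"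
    then show "G (Suc t) x" by (cases "pc (st t i)") (auto simp: G_def split: operation.splits)
  next
    fix t i c new r x
    assume e: "ends t i" and a: "advance v0 L i (pc (st t i)) (Known (Suc t) i) = (c, new, r)" "c = pc (st (Suc t) i)"
      and K: "\<forall>y\<in>set (Known (Suc t) i). G t y" and x: "x \<in> set new"
    have "x \<in> Base (Suc t) i" using e a x by (auto simp: ends_def)
    then have x': "x \<in> Base (Suc t) i" .
    have old: "G (Suc t) x" if "x \<in> set (Known (Suc t) i)" using K that by (auto simp: G_def)
    have mem: "G (Suc t) (Proposed r m k A)" if "stage (Suc t) i = Splitting r0 r m k A" for r0 r m k A
      using that by (auto simp: G_def group_def member_def)
    from e show "G (Suc t) x"
    proof (cases rule: ends_cases)
      case (join r0 r)
      then show ?thesis using x' old mem by auto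
    next
      case (slave r0 r m k A)
      then show ?thesis using x' old mem by auto
    next
      case (master r0 r m k A W)
      have "set W \<subseteq> group r (Suc m) k" using K unfolding master(2) set_proposals G_def by blast
      then show ?thesis using x' old master by (auto simp: G_def)
    next
      case (merge r0 r m k A)
      then show ?thesis using x' old mem by auto
    qed (use x' old in \<open>auto simp: G_def\<close>)
  qed (auto simp: G_def)
  then show ?thesis using assms by (auto simp: G_def)
qed

lemma proposals_group: "set (proposals r m k (Known t i)) \<subseteq> group r m k"
  using proposed_group[of r m k _ t i] by (auto simp: set_proposals)

lemma member_parent:
  assumes "member r m k B" "m < L"
  shows "\<exists>A. member r (Suc m) (k div 2) A \<and> set A \<subseteq> set B"
proof -
  obtain t i r0 where "stage t i = Splitting r0 r m k B" using assms by (auto simp: member_def)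
  then show ?thesis
  proof (cases rule: splitting_cases)
    case first
    then show ?thesis using assms by simp
  next
    case slave
    then show ?thesis by (auto simp: member_def)
  next
    case (master u s k' W)
    obtain w A where "stage w i = Splitting r0 r (Suc m) k' A" "set A \<subseteq> set W"
      using merging_parent(3)[OF master(3)] by blast
    then show ?thesis using master by (auto simp: member_def)
  qed
qed

definition slave_phase :: "nat \<Rightarrow> nat \<Rightarrow> nat \<Rightarrow> (node \<times> 'v view) list \<Rightarrow> node \<Rightarrow> nat \<Rightarrow> nat \<Rightarrow> bool" where
  "slave_phase r m k A i s u \<longleftrightarrow> phase i s u \<and> Proposed r (Suc m) k A \<in> Base u i \<and>
     card (set (proposals r (Suc m) k (Known (Suc u) i))) \<le> (2 * k + 1) * 2 ^ m"

lemma even_member: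
  assumes "member r m (2 * k) A" "m < L"
  shows "member r (Suc m) k A \<and> (\<exists>i s u. slave_phase r m k A i s u)"
proof -
  obtain t i r0 where "stage t i = Splitting r0 r m (2 * k) A" using assms by (auto simp: member_def)
  then show ?thesis
  proof (cases rule: splitting_cases)
    case first
    then show ?thesis using assms by simp
  next
    case (slave u s k')
    then show ?thesis using splitting_proposed[OF slave(3)]
      by (auto simp: member_def slave_phase_def)
  next
    case (master u s k' W)
    then show ?thesis by presburger
  qed
qed

lemma odd_member:
  assumes "member r m (2 * k + 1) A" "m < L"
  shows "\<exists>i s u W. phase i s u \<and> Proposed r (Suc m) k W \<in> Base u i \<and> (2 * k + 1) * 2 ^ m < card (set W) \<and>
    set W \<subseteq> set A \<and> A = proposals r (Suc m) k (Known (Suc u) i)"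
proof -
  obtain t i r0 where "stage t i = Splitting r0 r m (2 * k + 1) A" using assms by (auto simp: member_def)
  then show ?thesis
  proof (cases rule: splitting_cases)
    case first
    then show ?thesis using assms by simp
  next
    case (slave u s k')
    then show ?thesis by presburger
  next
    case (master u s k' W)
    then have "k' = k" by simp
    then show ?thesis using master merging_parent(1,2)[OF master(3)] by auto
  qed
qed

lemma slaves_see:
  assumes "slave_phase r m k A i s u" "phase j s' u'" "s \<le> s'"
  shows "set A \<subseteq> set (proposals r (Suc m) k (Known (Suc u') j))"
  using phase_collects[of i s u, OF _ assms(2,3)] assms(1) unfolding slave_phase_def set_proposals by blast

text \<open>The middle of the slave's reading phase is compared with that of the master's merging
  phase. If it is not later, the master reads \<open>A\<close>; otherwise the slave reads the
  published \<open>W\<close>, whose size alone exceeds the threshold.\<close>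

lemma slave_below_master:
  assumes "member r m (2 * k) A" "member r m (2 * k + 1) B" "m < L"
  shows "set A \<subseteq> set B"
proof -
  obtain i s u where sl: "slave_phase r m k A i s u" using even_member assms by blast
  obtain j s' u' W where ma: "phase j s' u'" "Proposed r (Suc m) k W \<in> Base u' j"
    "(2 * k + 1) * 2 ^ m < card (set W)" "B = proposals r (Suc m) k (Known (Suc u') j)"
    using odd_member assms by blast
  show ?thesis
  proof (cases "s \<le> s'")
    case True
    then show ?thesis using slaves_see[OF sl ma(1)] ma(4) by simp
  next
    case False
    then have "set W \<subseteq> set (proposals r (Suc m) k (Known (Suc u) i))"
      using phase_collects[OF ma(1), of i s u] sl ma(2) unfolding slave_phase_def set_proposals by auto
    then have "card (set W) \<le> card (set (proposals r (Suc m) k (Known (Suc u) i)))"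
      by (intro card_mono) auto
    then show ?thesis using sl ma(3) by (simp add: slave_phase_def)
  qed
qed

text \<open>The slave whose reading phase has the last middle reads the sets of all slaves and still
  counts no more than the threshold.\<close>

lemma slaves_bounded:
  assumes "finite (group r (Suc m) k)" "m < L"
  shows "card (group r m (2 * k)) \<le> (2 * k + 1) * 2 ^ m"
proof (cases "group r m (2 * k) = {}")
  case False
  have "group r m (2 * k) \<subseteq> group r (Suc m) k"
    using even_member assms(2) by (fastforce simp: group_def)
  then have fin: "finite (group r m (2 * k))" using assms(1) finite_subset by blast
  have "\<forall>a\<in>group r m (2 * k). \<exists>A i s u. a \<in> set A \<and> slave_phase r m k A i s u"
    using even_member assms(2) by (fastforce simp: group_def)
  \<comment> \<open>A witnessing slave for each element of the group, so that finiteness of the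
    group yields a last one.\<close>
  then obtain A i s u where *: "\<And>a. a \<in> group r m (2 * k) \<Longrightarrow> a \<in> set (A a) \<and> slave_phase r m k (A a) (i a) (s a) (u a)"
    by metis
  have "Max (s ` group r m (2 * k)) \<in> s ` group r m (2 * k)" using fin False by (intro Max_in) auto
  then obtain b where b: "b \<in> group r m (2 * k)" "s b = Max (s ` group r m (2 * k))" by auto
  have "group r m (2 * k) \<subseteq> set (proposals r (Suc m) k (Known (Suc (u b)) (i b)))"
  proof
    fix a assume a: "a \<in> group r m (2 * k)"
    then have "s a \<le> s b" using b fin by simp
    moreover have "phase (i b) (s b) (u b)" using *[OF b(1)] by (simp add: slave_phase_def)
    ultimately show "a \<in> set (proposals r (Suc m) k (Known (Suc (u b)) (i b)))"
      using slaves_see[of r m k "A a" "i a" "s a" "u a"] *[OF a] by blast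
  qed
  then have "card (group r m (2 * k)) \<le> card (set (proposals r (Suc m) k (Known (Suc (u b)) (i b))))"
    by (intro card_mono) auto
  also have "\<dots> \<le> (2 * k + 1) * 2 ^ m" using *[OF b(1)] by (simp add: slave_phase_def)
  finally show ?thesis .
qed simp

lemma member_top:
  assumes "member r L k A"
  shows "k = 0 \<and> (\<exists>i s u X. i \<in> {1..n} \<and> input i r s u X \<and> A = [(i, X)])"
proof -
  obtain t i r0 where "stage t i = Splitting r0 r L k A" using assms by (auto simp: member_def)
  then show ?thesis
  proof (cases rule: splitting_cases)
    case (first u s)
    have "i \<in> {1..n}" using first(2) by (auto simp: phase_def ends_def)
    then show ?thesis using first unfolding input_def by blast
  next
    case slave
    then show ?thesis using levels_bound by (metis Suc_n_not_le_n)
  next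
    case master
    then show ?thesis using levels_bound by (metis less_irrefl)
  qed
qed

lemma group_top:
  assumes "a \<in> group r L k"
  shows "k = 0 \<and> fst a \<in> {1..n} \<and> (\<exists>s u. input (fst a) r s u (snd a))"
proof -
  obtain A where "member r L k A" "a \<in> set A" using assms by (auto simp: group_def)
  moreover obtain i s u X where "i \<in> {1..n}" "input i r s u X" "A = [(i, X)]" "k = 0"
    using member_top[of r k A] calculation by blast
  ultimately have "a = (i, X)" by simp
  then show ?thesis using \<open>i \<in> {1..n}\<close> \<open>input i r s u X\<close> \<open>k = 0\<close> by auto
qed

text \<open>The induction descends from the top, where every set is a singleton and the
  \<open>n \<le> 2 ^ L\<close> possible contributions form one group. The three parts support each
  other: the range of sizes is halved at each level, and the order between groups is inherited from
  different parents or comes from \<open>slave_below_master\<close>.\<close>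

lemma group_invariant:
  assumes "m \<le> L"
  shows "(\<forall>k A. member r m k A \<longrightarrow> k * 2 ^ m < card (set A)) \<and>
    (\<forall>k. finite (group r m k) \<and> card (group r m k) \<le> (k + 1) * 2 ^ m) \<and>
    (\<forall>k k' B. k < k' \<longrightarrow> member r m k' B \<longrightarrow> group r m k \<subseteq> set B)"
  using assms
proof (induction m rule: inc_induct)
  case base
  have "finite (group r L k) \<and> card (group r L k) \<le> (k + 1) * 2 ^ L" for k
  proof (cases "k = 0")
    case True
    have inj: "inj_on fst (group r L 0)"
    proof (rule inj_onI)
      fix a b assume "a \<in> group r L 0" "b \<in> group r L 0" "fst a = fst b"
      then have "snd a = snd b" using group_top[of a r 0] group_top[of b r 0] input_unique by metis
      then show "a = b" using \<open>fst a = fst b\<close> by (rule prod_eqI[rotated])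
    qed
    have sub: "fst ` group r L 0 \<subseteq> {1..n}" using group_top by blast
    have "finite (group r L 0)" using finite_imageD[OF finite_subset[OF sub] inj] by simp
    moreover have "card (group r L 0) \<le> n" using card_inj_on_le[OF inj sub] by simp
    ultimately show ?thesis using True levels by simp
  next
    case False
    then have "group r L k = {}" using group_top by blast
    then show ?thesis by simp
  qed
  moreover have "k = 0 \<and> card (set A) = 1" if "member r L k A" for k A
    using member_top[OF that] by auto
  ultimately show ?case by fastforce
next
  case (step m)
  have m: "m < L" by fact
  have lower: "k * 2 ^ m < card (set A)" if A: "member r m k A" for k A
  proof (cases "even k")
    case True
    then obtain j where j: "k = 2 * j" by blast
    then have "member r (Suc m) j A" using even_member A m by blast
    then have "j * 2 ^ Suc m < card (set A)" using step.IH by blast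
    then show ?thesis using j by (simp add: mult.assoc mult.left_commute)
  next
    case False
    then obtain j where j: "k = 2 * j + 1" using oddE by blast
    then obtain W where "set W \<subseteq> set A" "(2 * j + 1) * 2 ^ m < card (set W)" using odd_member A m by blast
    then show ?thesis using j card_mono[of "set A" "set W"] by (auto intro: less_le_trans)
  qed
  have upper: "finite (group r m k) \<and> card (group r m k) \<le> (k + 1) * 2 ^ m" for k
  proof (cases "even k")
    case True
    then obtain j where j: "k = 2 * j" by blast
    have "group r m k \<subseteq> group r (Suc m) j" using even_member m j by (fastforce simp: group_def)
    then show ?thesis using step.IH slaves_bounded[of r m j] m j by (auto intro: finite_subset)
  next
    case False
    then obtain j where j: "k = 2 * j + 1" using oddE by blast
    have "group r m k \<subseteq> group r (Suc m) j"
    proof -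
      have "set A \<subseteq> group r (Suc m) j" if "member r m k A" for A
        using odd_member[of r m j A] that m j proposals_group by blast
      then show ?thesis by (auto simp: group_def)
    qed
    \<comment> \<open>For a move up the parent's bound suffices: \<open>(j + 1) * 2 ^ Suc m\<close>
      equals \<open>(k + 1) * 2 ^ m\<close> when \<open>k = 2 * j + 1\<close>.\<close>
    moreover have "finite (group r (Suc m) j)" "card (group r (Suc m) j) \<le> (j + 1) * 2 ^ Suc m"
      using step.IH by blast+
    ultimately have "finite (group r m k)" "card (group r m k) \<le> (j + 1) * 2 ^ Suc m"
      using card_mono[of "group r (Suc m) j" "group r m k"] by (auto intro: finite_subset)
    then show ?thesis using j by simp
  qed
  have order: "group r m k \<subseteq> set B" if k: "k < k'" and B: "member r m k' B" for k k' B
  proof (cases "k div 2 < k' div 2")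
    case True
    have "group r m k \<subseteq> group r (Suc m) (k div 2)"
    proof (cases "even k")
      case True
      then show ?thesis using even_member[of r m "k div 2"] m by (fastforce simp: group_def)
    next
      case False
      then have "set A \<subseteq> group r (Suc m) (k div 2)" if "member r m k A" for A
        using odd_member[of r m "k div 2" A] that m proposals_group by force
      then show ?thesis by (auto simp: group_def)
    qed
    moreover obtain A where "member r (Suc m) (k' div 2) A" "set A \<subseteq> set B"
      using member_parent[OF B m] by blast
    ultimately show ?thesis using step.IH True by blast
  next
    case False
    \<comment> \<open>Groups with the same parent are siblings, the smaller one made by moves
      down.\<close>
    then have "k = 2 * (k div 2)" "k' = 2 * (k div 2) + 1" using k by presburger+
    then obtain j where j: "k = 2 * j" "k' = 2 * j + 1" by blast
    then show ?thesis using slave_below_master[of r m j _ B] B m by (auto simp: group_def)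
  qed
  show ?case using lower upper order by blast
qed

text \<open>Without remaining levels, a set in group \<open>k\<close> has more than \<open>k\<close>
  elements while the whole group has at most \<open>k + 1\<close>; hence all sets of a group
  coincide.\<close>

lemma agreement:
  assumes "member r 0 k A" "member r 0 k' B"
  shows "set A \<subseteq> set B \<or> set B \<subseteq> set A"
proof -
  note inv = group_invariant[of 0 r, simplified]
  have sub: "set A \<subseteq> group r 0 k" "set B \<subseteq> group r 0 k'" using assms by (auto simp: group_def)
  consider "k < k'" | "k' < k" | "k = k'" by linarith
  then show ?thesis
  proof cases
    case 3
    have "set X = group r 0 k" if "member r 0 k X" for X
    proof (rule card_seteq)
      show "finite (group r 0 k)" using inv by blast
      show "set X \<subseteq> group r 0 k" using that by (auto simp: group_def)
      have "k < card (set X)" "card (group r 0 k) \<le> Suc k" using inv that by auto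
      then show "card (group r 0 k) \<le> card (set X)" by simp
    qed
    then show ?thesis using assms 3 by blast
  qed (use inv assms sub in blast)+
qed

subsection \<open>Commits and views\<close>

definition commit :: "node \<Rightarrow> nat \<Rightarrow> nat \<Rightarrow> nat \<Rightarrow> (node \<times> 'v view) list \<Rightarrow> bool" where
  "commit c t u r A \<longleftrightarrow> phase c t u \<and> (\<exists>r0 k. stage u c = Splitting r0 r 0 k A) \<and>
     latest (Known (Suc u) c) \<le> r"

definition updates_in :: "'v item set \<Rightarrow> (node \<times> nat \<times> 'v) set" where
  "updates_in X = (\<Union>x\<in>X. set (written x))"

lemma updates_in_mono: "X \<subseteq> Y \<Longrightarrow> updates_in X \<subseteq> updates_in Y"
  by (auto simp: updates_in_def)

lemma input_sees:
  assumes "input c r s v X" "phase j t u" "t \<le> s"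
  shows "updates_in (Base u j) \<subseteq> set X"
  using updates_in_mono[OF phase_collects[OF assms(2) _ assms(3), of c v]] assms(1)
  by (simp add: input_def set_collect updates_in_def)

lemma commit_proposed: "commit c t u r A \<Longrightarrow> \<exists>k. Proposed r 0 k A \<in> Base u c"
  unfolding commit_def by (blast dest: splitting_proposed)

lemma commit_updates: "commit c t u r A \<Longrightarrow> set (flatten A) \<subseteq> updates_in (Base u c)"
proof -
  assume "commit c t u r A"
  then obtain k where "Proposed r 0 k A \<in> Base u c" using commit_proposed by blast
  then show ?thesis by (force simp: updates_in_def)
qed

lemma commit_input:
  assumes "commit c t u r A"
  shows "\<exists>s v X. input c r s v X \<and> set X \<subseteq> set (flatten A)"
proof -
  obtain s v X where X: "input c r s v X" "(c, X) \<in> set A"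
    using own_input assms unfolding commit_def by blast
  then have "set X \<subseteq> set (flatten A)" by (auto simp: set_flatten)
  then show ?thesis using X(1) by blast
qed

text \<open>A contributor publishes its join in the phase that gathers its contribution. Were the
  middle of that phase not after the middle of the committing phase, the committing node would have
  learned of instance \<open>q\<close>.\<close>

lemma commit_before_input:
  assumes c: "commit c t u r A" and i: "input d q s v X" and "r < q"
  shows "t < s"
proof (rule ccontr)
  assume "\<not> t < s"
  then have "s \<le> t" by simp
  obtain r0 where "stage v d = Joining r0 q" "phase d s v" using i by (auto simp: input_def)
  then have "Joined q \<in> Base v d" using inst_joined[of v d] \<open>r < q\<close> by auto
  then have "Joined q \<in> set (Known (Suc u) c)"
    using phase_collects[OF \<open>phase d s v\<close> _ \<open>s \<le> t\<close>, of c u] c by (auto simp: commit_def)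
  then show False using latest_ge c \<open>r < q\<close> unfolding commit_def by (meson leD le_less_trans)
qed

text \<open>The later committer's own contribution is gathered after the earlier commit and is never
  lost, so it carries the earlier view along.\<close>

lemma commits_ordered:
  assumes "commit c t u r A" "commit d t' u' q B" "r < q"
  shows "set (flatten A) \<subseteq> set (flatten B)"
proof -
  obtain s v X where X: "input d q s v X" "set X \<subseteq> set (flatten B)" using commit_input[OF assms(2)] by blast
  have "t < s" using commit_before_input[OF assms(1) X(1) assms(3)] .
  then have "updates_in (Base u c) \<subseteq> set X" using input_sees[OF X(1), of c t u] assms(1) by (simp add: commit_def)
  then show ?thesis using commit_updates[OF assms(1)] X(2) by blast
qed

lemma commits_comparable:
  assumes "commit c t u r A" "commit d t' u' q B"
  shows "set (flatten A) \<subseteq> set (flatten B) \<or> set (flatten B) \<subseteq> set (flatten A)"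
proof -
  consider "r < q" | "q < r" | "r = q" by linarith
  then show ?thesis
  proof cases
    case 3
    then have "set A \<subseteq> set B \<or> set B \<subseteq> set A"
      using agreement[of r _ A _ B] assms unfolding commit_def member_def by blast
    then show ?thesis unfolding set_flatten by blast
  qed (use commits_ordered assms in blast)+
qed

lemma committed_origin:
  assumes "Committed r W \<in> set (Known t i) \<union> Base t i"
  shows "\<exists>c s u A. u < t \<and> commit c s u r A \<and> W = flatten A"
proof -
  define G :: "nat \<Rightarrow> 'v item \<Rightarrow> bool" where
    "G t x \<longleftrightarrow> (case x of Committed r W \<Rightarrow> \<exists>c s u A. u < t \<and> commit c s u r A \<and> W = flatten A | _ \<Rightarrow> True)" for t x
  have mono: "G (Suc t) x" if "G t x" for t x
    using that unfolding G_def by (cases x) (auto, use less_SucI in blast)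
  have "\<forall>x\<in>set (Known t i) \<union> Base t i. G t x"
  proof (rule items_induct[where G = G])
    show "G (Suc t) x" if "G t x" for t x using that by (rule mono)
  next
    fix t i op c new x
    assume "begin_op i (pc (st t i)) (rnd (st (Suc t) i)) op = (c, new)" "x \<in> set new"
    then show "G (Suc t) x" by (cases "pc (st t i)") (auto simp: G_def split: operation.splits)
  next
    fix t i c new r x
    assume e: "ends t i" and a: "advance v0 L i (pc (st t i)) (Known (Suc t) i) = (c, new, r)" "c = pc (st (Suc t) i)"
      and K: "\<forall>y\<in>set (Known (Suc t) i). G t y" and x: "x \<in> set new"
    have x': "x \<in> Base (Suc t) i" using e a x by (auto simp: ends_def)
    have old: "G (Suc t) x" if "x \<in> set (Known (Suc t) i)"
      using K that mono by blast
    obtain s where s: "phase i s t" using ends_phase e by blast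
    from e show "G (Suc t) x"
    proof (cases rule: ends_cases)
      case (commit r0 r k A)
      have "commit i s t r A" using s commit by (auto simp: commit_def)
      then have "G (Suc t) (Committed r (flatten A))" unfolding G_def by auto
      then show ?thesis using x' old commit by auto
    qed (use x' old in \<open>auto simp: G_def\<close>)
  qed
  then have "G t (Committed r W)" using assms by blast
  then show ?thesis unfolding G_def by simp
qed

text \<open>Contributions, proposals and commits only copy triples from known items, so every triple
  stems from an invocation; the bound \<open>b < t\<close> keeps views within the past.\<close>

lemma written_origin:
  assumes "x \<in> set (Known t i) \<union> Base t i" "(j, s, v) \<in> set (written x)"
  shows "\<exists>b<t. invoked E b j (Update v) \<and> rnd (st (Suc b) j) = s"
proof -
  define G :: "nat \<Rightarrow> 'v item \<Rightarrow> bool" where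
    "G t x \<longleftrightarrow> (\<forall>(j, s, v)\<in>set (written x). \<exists>b<t. invoked E b j (Update v) \<and> rnd (st (Suc b) j) = s)" for t x
  have mono: "G (Suc t) x" if "G t x" for t x using that unfolding G_def by (fastforce simp: less_Suc_eq)
  have "\<forall>x\<in>set (Known t i) \<union> Base t i. G t x"
  proof (rule items_induct[where G = G])
    show "G (Suc t) x" if "G t x" for t x using that by (rule mono)
  next
    fix t i op c new x
    assume "invoked E t i op" "begin_op i (pc (st t i)) (rnd (st (Suc t) i)) op = (c, new)" "x \<in> set new"
    then show "G (Suc t) x" by (cases "pc (st t i)") (auto simp: G_def split: operation.splits)
  next
    fix t i c new r x
    assume e: "ends t i" and a: "advance v0 L i (pc (st t i)) (Known (Suc t) i) = (c, new, r)" "c = pc (st (Suc t) i)"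
      and K: "\<forall>y\<in>set (Known (Suc t) i). G t y" and x: "x \<in> set new"
    have x': "x \<in> Base (Suc t) i" using e a x by (auto simp: ends_def)
    have old: "G (Suc t) x" if "x \<in> set (Known (Suc t) i)" using K that mono by blast
    have sub: "G (Suc t) x" if "set (written x) \<subseteq> updates_in (set (Known (Suc t) i))"
    proof -
      have "\<forall>p\<in>set (written x). \<exists>y\<in>set (Known (Suc t) i). p \<in> set (written y)"
        using that by (auto simp: updates_in_def)
      then show ?thesis using K mono unfolding G_def by (meson less_SucI)
    qed
    have old_proposal: "set (flatten A) \<subseteq> updates_in (set (Known (Suc t) i))"
      if "Proposed r m k A \<in> set (Known (Suc t) i)" for r m k A
      using that by (force simp: updates_in_def)
    have proposals: "set (flatten (proposals r m k (Known (Suc t) i))) \<subseteq> updates_in (set (Known (Suc t) i))" for r m k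
    proof
      fix p assume "p \<in> set (flatten (proposals r m k (Known (Suc t) i)))"
      then obtain A where "Proposed r m k A \<in> set (Known (Suc t) i)" "p \<in> set (flatten A)"
        unfolding set_flatten set_proposals by blast
      then show "p \<in> updates_in (set (Known (Suc t) i))" using old_proposal by blast
    qed
    have own: "set (flatten A) \<subseteq> updates_in (set (Known (Suc t) i))" if "stage t i = Splitting r0 r m k A" for r0 r m k A
      using old_proposal[of r m k A] splitting_proposed[OF that] ends_base[OF e] by blast
    from e show "G (Suc t) x"
    proof (cases rule: ends_cases)
      case (choose l r)
      then have "set (written x) = {} \<or> x \<in> set (Known (Suc t) i)" using x' by auto
      then show ?thesis using old sub by auto
    next
      case (join r0 r)
      have "set (flatten [(i, collect (Known (Suc t) i))]) = updates_in (set (Known (Suc t) i))"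
        by (simp add: flatten_def set_collect updates_in_def)
      then show ?thesis using x' old sub join(3) by auto
    next
      case (slave r0 r m k A)
      then show ?thesis using x' old sub own[OF slave(1)] by auto
    next
      case (master r0 r m k A W)
      then show ?thesis using x' old sub proposals[of r "Suc m" k] by auto
    next
      case (merge r0 r m k W A)
      then show ?thesis using x' old sub proposals[of r "Suc m" k] by auto
    next
      case (commit r0 r k A)
      then show ?thesis using x' old sub own[OF commit(1)] by auto
    next
      case borrow
      then show ?thesis using x' old by auto
    next
      case (retry r0 r k A)
      then have "set (written x) = {} \<or> x \<in> set (Known (Suc t) i)" using x' by auto
      then show ?thesis using old sub by auto
    qed
  qed
  then show ?thesis using assms unfolding G_def by blast
qed

section \<open>Views of operations\<close>

definition in_agreement :: "'v stage \<Rightarrow> nat \<Rightarrow> bool" where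
  "in_agreement p r \<longleftrightarrow> (\<exists>r0 m k A. p = Splitting r0 r m k A \<or> p = Merging r0 r m k A)"

text \<open>\<open>tw\<close> is the middle of the writing phase of operation \<open>a\<close>. The
  bound on \<open>latest\<close> makes instances after the first one joined unknown at the end of
  that phase, as borrowing requires; the last conjunct puts the own contribution to the current
  instance after \<open>tw\<close>, as committing requires.\<close>

definition tracked :: "nat \<Rightarrow> nat \<Rightarrow> node \<Rightarrow> nat \<Rightarrow> bool" where
  "tracked a t i tw \<longleftrightarrow> a < tw \<and> (\<exists>uw<t. phase i tw uw \<and> latest (Known (Suc uw) i) \<le> first_inst (stage t i)) \<and>
     (\<forall>r. in_agreement (stage t i) r \<longrightarrow> (\<exists>s u r0. phase i s u \<and> tw < s \<and> stage u i = Joining r0 r))"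

lemma tracked_Suc:
  assumes "tracked a t i tw" "first_inst (stage (Suc t) i) = first_inst (stage t i)"
    and "\<And>r. in_agreement (stage (Suc t) i) r \<Longrightarrow> in_agreement (stage t i) r"
  shows "tracked a (Suc t) i tw"
proof -
  obtain uw where "uw < t" "phase i tw uw" "latest (Known (Suc uw) i) \<le> first_inst (stage t i)"
    using assms(1) unfolding tracked_def by blast
  then have "\<exists>uw<Suc t. phase i tw uw \<and> latest (Known (Suc uw) i) \<le> first_inst (stage (Suc t) i)"
    using assms(2) less_SucI by metis
  then show ?thesis using assms(1,3) unfolding tracked_def by blast
qed

lemma running_tracked:
  "running a t i \<Longrightarrow> (\<exists>l. stage t i = Writing l) \<or> (\<exists>tw. tracked a t i tw)"
proof (induction t)
  case (Suc t)
  show ?case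
  proof (cases "a = t")
    case True
    then show ?thesis using Suc.prems begins_stage(1) by (auto simp: running_def)
  next
    case False
    then have run: "running a t i" using Suc.prems by (auto simp: running_def)
    have busy: "busy (st t i)" "busy (st (Suc t) i)" using run Suc.prems by (auto simp: running_def)
    have a: "begins a i" "a < t" using run by (auto simp: running_def)
    have same: ?thesis if "stage (Suc t) i = stage t i"
      using Suc.IH[OF run] that tracked_Suc[of a t i] by auto
    show ?thesis
    proof (cases t i rule: node_cases)
      case 1
      then show ?thesis using busy by (simp add: begins_def)
    next
      case 2
      then show ?thesis using same by (simp add: halves_def)
    next
      case 4
      then show ?thesis using same by (simp add: stays_def)
    next
      case e: 3
      obtain s where s: "phase i s t" using ends_phase e(1) by blast
      have as: "a < s" using phase_after[of a i t s] a s by blast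
      from e(1) show ?thesis
      proof (cases rule: ends_cases)
        case (choose l r)
        have "latest (Known (Suc t) i) \<le> r" using choose(2) by (simp split: if_splits)
        then have "\<exists>uw<Suc t. phase i s uw \<and> latest (Known (Suc uw) i) \<le> r" using s by blast
        then have "tracked a (Suc t) i s" using s as choose(3) by (auto simp: tracked_def in_agreement_def)
        then show ?thesis by blast
      next
        case (join r0 r)
        then obtain tw uw where tw: "a < tw" "uw < t" "phase i tw uw" "latest (Known (Suc uw) i) \<le> r0"
          using Suc.IH[OF run] unfolding tracked_def by auto
        \<comment> \<open>The phase ending at \<open>t\<close> is entered after the writing phase
          has ended.\<close>
        have "uw < s" using phase_after[of uw i t s] tw s by (auto simp: phase_def)
        then have "tw < s" using phase_less[OF tw(3)] by simp
        have "\<exists>uw<Suc t. phase i tw uw \<and> latest (Known (Suc uw) i) \<le> r0"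
          using tw by (intro exI[of _ uw]) simp
        then have "tracked a (Suc t) i tw"
          using tw(1) s \<open>tw < s\<close> join(1,2) unfolding tracked_def in_agreement_def by auto
        then show ?thesis by blast
      next
        case (slave r0 r m k A)
        then obtain tw where "tracked a t i tw" using Suc.IH[OF run] by auto
        then have "tracked a (Suc t) i tw"
          by (rule tracked_Suc) (use slave in \<open>auto simp: in_agreement_def\<close>)
        then show ?thesis by blast
      next
        case (master r0 r m k A W)
        then obtain tw where "tracked a t i tw" using Suc.IH[OF run] by auto
        then have "tracked a (Suc t) i tw"
          by (rule tracked_Suc) (use master in \<open>auto simp: in_agreement_def\<close>)
        then show ?thesis by blast
      next
        case (merge r0 r m k W A)
        then obtain tw where "tracked a t i tw" using Suc.IH[OF run] by auto
        then have "tracked a (Suc t) i tw"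
          by (rule tracked_Suc) (use merge in \<open>auto simp: in_agreement_def\<close>)
        then show ?thesis by blast
      next
        case (retry r0 r k A)
        then obtain tw where "tracked a t i tw" using Suc.IH[OF run] by auto
        then have "tracked a (Suc t) i tw"
          by (rule tracked_Suc) (use retry in \<open>auto simp: in_agreement_def\<close>)
        then show ?thesis by blast
      qed (use busy in auto)
    qed
  qed
qed (simp add: running_def)

text \<open>The first part yields the own update and all views of earlier operations; the second
  yields comparability and the restriction to past updates.\<close>

definition op_view :: "nat \<Rightarrow> nat \<Rightarrow> node \<Rightarrow> 'v view \<Rightarrow> bool" where
  "op_view a k i W \<longleftrightarrow>
     (\<exists>tw uw. phase i tw uw \<and> a < tw \<and> uw \<le> k \<and>
        (\<forall>j t u. phase j t u \<and> t \<le> tw \<longrightarrow> updates_in (Base u j) \<subseteq> set W)) \<and>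
     (\<exists>c t u r A. commit c t u r A \<and> u \<le> k \<and> W = flatten A)"

lemma reply_view:
  assumes run: "running a k i" and rep: "reply E k = Some (i, x)"
  shows "\<exists>l W. stage (Suc k) i = Resting l W \<and> x = respond v0 (fst (pc (st k i))) W \<and> op_view a k i W"
proof -
  obtain l W where W: "stage (Suc k) i = Resting l W" "x = respond v0 (fst (pc (st k i))) W"
    using ends_reply_view[OF rep] by blast
  have e: "ends k i" using reply_ends(1)[OF rep] .
  obtain s where s: "phase i s k" using ends_phase e by blast
  have "op_view a k i W" using e
  proof (cases rule: ends_cases)
    case (commit r0 r m A)
    have c: "commit i s k r A" using s commit by (auto simp: commit_def)
    obtain tw uw s' u' r1 where tw: "a < tw" "uw < k" "phase i tw uw" "phase i s' u'" "tw < s'" "stage u' i = Joining r1 r"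
      using running_tracked[OF run] commit(1) unfolding tracked_def in_agreement_def by auto
    obtain s2 v X where X: "input i r s2 v X" "set X \<subseteq> set (flatten A)" using commit_input[OF c] by blast
    have u': "input i r s' u' (collect (Known (Suc u') i))" using tw by (auto simp: input_def)
    \<comment> \<open>The contribution contained in the committed set and the one tracked since
      \<open>tw\<close> coincide, as a node contributes to an instance only once.\<close>
    have "X = collect (Known (Suc u') i)" using input_unique[OF X(1) u'] .
    then have "set (collect (Known (Suc u') i)) \<subseteq> set W" using X(2) commit(3) W(1) by simp
    moreover have "updates_in (Base u j) \<subseteq> set (collect (Known (Suc u') i))" if "phase j t u" "t \<le> tw" for j t u
      using input_sees[OF u' that(1)] that(2) tw(5) by simp
    ultimately have "\<forall>j t u. phase j t u \<and> t \<le> tw \<longrightarrow> updates_in (Base u j) \<subseteq> set W" by blast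
    moreover have "W = flatten A" using commit(3) W(1) by simp
    ultimately show ?thesis
      unfolding op_view_def using tw(1,3) less_imp_le[OF tw(2)] c le_refl[of k] by blast
  next
    case (borrow r0 r m A q W')
    obtain tw uw where tw: "a < tw" "uw < k" "phase i tw uw" "latest (Known (Suc uw) i) \<le> r0"
      using running_tracked[OF run] borrow(1) unfolding tracked_def by auto
    obtain c t u B where c: "u < Suc k" "commit c t u q B" "W' = flatten B"
      using committed_origin[of q W' "Suc k" i] borrow(3) by blast
    obtain s2 v X where X: "input c q s2 v X" "set X \<subseteq> set (flatten B)" using commit_input[OF c(2)] by blast
    \<comment> \<open>Otherwise the writing phase would have collected \<open>Joined q\<close>,
      although it knew of no instance beyond \<open>r0 < q\<close>.\<close>
    have "tw < s2"
    proof (rule ccontr)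
      assume "\<not> tw < s2"
      then have "s2 \<le> tw" by simp
      obtain r1 where "stage v c = Joining r1 q" "phase c s2 v" using X by (auto simp: input_def)
      then have "Joined q \<in> Base v c" using inst_joined[of v c] \<open>r0 < q\<close> by auto
      then have "Joined q \<in> set (Known (Suc uw) i)"
        using phase_collects[OF \<open>phase c s2 v\<close> tw(3) \<open>s2 \<le> tw\<close>] by blast
      then show False using latest_ge[of q] tw(4) borrow(4) by fastforce
    qed
    then have "updates_in (Base u j) \<subseteq> set W'" if "phase j t u" "t \<le> tw" for j t u
      using input_sees[OF X(1) that(1)] that(2) X(2) c(3) by auto
    moreover have "W = W'" using borrow(5) W(1) by simp
    ultimately have "\<forall>j t u. phase j t u \<and> t \<le> tw \<longrightarrow> updates_in (Base u j) \<subseteq> set W" by blast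
    moreover have "u \<le> k" using c(1) by simp
    ultimately show ?thesis
      unfolding op_view_def using tw(1,3) less_imp_le[OF tw(2)] c(2,3) \<open>W = W'\<close> by blast
  qed (use W in auto)
  then show ?thesis using W by blast
qed

lemma op_view_updates:
  assumes "op_view a k i W" "(j, s, v) \<in> set W"
  shows "\<exists>b<k. invoked E b j (Update v) \<and> rnd (st (Suc b) j) = s"
proof -
  obtain c t u r A where c: "commit c t u r A" "u \<le> k" "W = flatten A" using assms(1) by (auto simp: op_view_def)
  then obtain x where "x \<in> Base u c" "(j, s, v) \<in> set (written x)"
    using commit_updates[OF c(1)] assms(2) unfolding updates_in_def by blast
  then obtain b where "b < u" "invoked E b j (Update v)" "rnd (st (Suc b) j) = s"
    using written_origin[of x u c j s v] by blast
  moreover have "b < k" using \<open>b < u\<close> c(2) by simp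
  ultimately show ?thesis by blast
qed

text \<open>The commit behind \<open>W\<close> belongs to a phase that ended before \<open>b\<close>
  was invoked. Its middle precedes the writing middle of \<open>b\<close>, so \<open>W'\<close>
  contains all that this phase published, in particular \<open>W\<close>.\<close>

lemma op_view_mono:
  assumes "op_view a k i W" "op_view b k' j W'" "k < b"
  shows "set W \<subseteq> set W'"
proof -
  obtain c t u r A where c: "commit c t u r A" "u \<le> k" "W = flatten A" using assms(1) by (auto simp: op_view_def)
  obtain tw where tw: "b < tw" "\<And>j t u. phase j t u \<Longrightarrow> t \<le> tw \<Longrightarrow> updates_in (Base u j) \<subseteq> set W'"
    using assms(2) by (auto simp: op_view_def)
  have p: "phase c t u" using c by (simp add: commit_def)
  then have "t \<le> tw" using phase_less[OF p] c(2) assms(3) tw(1) by simp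
  then show ?thesis using tw(2)[OF p] commit_updates[OF c(1)] c(3) by blast
qed

lemma op_view_own:
  assumes "op_view a k i W" "invoked E a i (Update v)"
  shows "(i, rnd (st (Suc a) i), v) \<in> set W"
proof -
  obtain tw uw where tw: "phase i tw uw" "a < tw" "updates_in (Base uw i) \<subseteq> set W"
    using assms(1) unfolding op_view_def by blast
  have "Suc a \<le> uw" using tw(2) phase_less[OF tw(1)] by simp
  then have "Written i (rnd (st (Suc a) i)) v \<in> Base uw i"
    using begins_stage(4)[OF invoked_begins assms(2)] assms(2) base_mono[of "Suc a" uw i] by blast
  then show ?thesis using tw(3) by (force simp: updates_in_def)
qed

lemma op_views_comparable:
  "op_view a k i W \<Longrightarrow> op_view b k' j W' \<Longrightarrow> set W \<subseteq> set W' \<or> set W' \<subseteq> set W"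
  unfolding op_view_def using commits_comparable by blast

section \<open>Views as sets of updates, and atomicity\<close>

definition view_of :: "nat \<Rightarrow> 'v view" where
  "view_of a = (SOME W. \<exists>k x i. completes E a k x \<and> running a k i \<and>
     x = respond v0 (fst (pc (st k i))) W \<and> op_view a k i W)"

lemma view_of:
  assumes "completes E a k x"
  shows "\<exists>i. running a k i \<and> x = respond v0 (fst (pc (st k i))) (view_of a) \<and> op_view a k i (view_of a)"
proof -
  obtain i where i: "running a k i" "reply E k = Some (i, x)" using completes_running[OF assms] by blast
  have "\<exists>W k x i. completes E a k x \<and> running a k i \<and>
     x = respond v0 (fst (pc (st k i))) W \<and> op_view a k i W"
    using reply_view[OF i] assms i(1) by blast
  then have "\<exists>k x i. completes E a k x \<and> running a k i \<and>
     x = respond v0 (fst (pc (st k i))) (view_of a) \<and> op_view a k i (view_of a)"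
    unfolding view_of_def by (rule someI_ex)
  then obtain k' x' i' where *: "completes E a k' x'" "running a k' i'"
     "x' = respond v0 (fst (pc (st k' i'))) (view_of a)" "op_view a k' i' (view_of a)" by blast
  have "k' = k \<and> x' = x" using completes_unique[OF *(1) assms] .
  then show ?thesis using * by blast
qed

lemma sequence_numbers:
  assumes "invoked E b j op" "invoked E b' j op'"
  shows "rnd (st (Suc b) j) \<le> rnd (st (Suc b') j) \<longleftrightarrow> b \<le> b'"
proof -
  have "rnd (st (Suc b) j) < rnd (st (Suc b') j)" if "b < b'" "invoked E b' j op" for b b' op
  proof -
    have "rnd (st b' j) < rnd (st (Suc b') j)" using invoked_begins[OF that(2)] by (simp add: begins_def)
    then show ?thesis using rnd_mono[of "Suc b" b' j] that(1) by simp
  qed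
  then show ?thesis using assms by (metis leD le_eq_less_or_eq linorder_neqE_nat)
qed

text \<open>Writer and sequence number identify the invocation, which turns sets of triples into
  sets of operations.\<close>

definition seen :: "nat \<Rightarrow> nat set" where
  "seen a = {b. \<exists>j v. invoked E b j (Update v) \<and> (j, rnd (st (Suc b) j), v) \<in> set (view_of a)}"

lemma seen_mono: "set (view_of a) \<subseteq> set (view_of b) \<Longrightarrow> seen a \<subseteq> seen b"
  unfolding seen_def by blast

lemma snapshot_latest:
  assumes "completes E a k (Snap s)" "i \<in> {1..n}"
  shows "(\<forall>b\<in>seen a. \<forall>v. \<not> invoked E b i (Update v)) \<and> s i = v0 i \<or>
      (\<exists>b\<in>seen a. invoked E b i (Update (s i)) \<and>
        (\<forall>b'\<in>seen a. \<forall>v. invoked E b' i (Update v) \<longrightarrow> b' \<le> b))"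
proof -
  let ?W = "set (view_of a)"
  obtain j where j: "Snap s = respond v0 (fst (pc (st k j))) (view_of a)" "op_view a k j (view_of a)"
    using view_of[OF assms(1)] by blast
  then have s: "s = snapshot v0 (view_of a)" by (simp add: respond_def split: if_splits)
  have own: "(i, rnd (st (Suc b) i), v) \<in> ?W" if b: "b \<in> seen a" "invoked E b i (Update v)" for b v
  proof -
    obtain j' v' where "invoked E b j' (Update v')" "(j', rnd (st (Suc b) j'), v') \<in> ?W"
      using b(1) by (auto simp: seen_def)
    then show ?thesis using invoked_unique[OF b(2)] by blast
  qed
  show ?thesis
  proof (cases "\<exists>q v. (i, q, v) \<in> ?W")
    case False
    then show ?thesis using own s by (auto simp: snapshot_def)
  next
    case True
    \<comment> \<open>\<open>snapshot\<close> chooses by \<open>SOME\<close>, so a triple with the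
      greatest sequence number has to be exhibited first.\<close>
    define Q where "Q = {q. \<exists>v. (i, q, v) \<in> ?W}"
    have "Q = (\<lambda>(_, q, _). q) ` (?W \<inter> {p. fst p = i})" by (force simp: Q_def)
    then have "finite Q" by simp
    have "Max Q \<in> Q" using \<open>finite Q\<close> True by (intro Max_in) (auto simp: Q_def)
    then obtain v where "(i, Max Q, v) \<in> ?W" by (auto simp: Q_def)
    moreover have "\<forall>q v. (i, q, v) \<in> ?W \<longrightarrow> q \<le> Max Q" using \<open>finite Q\<close> by (auto simp: Q_def intro: Max_ge)
    ultimately have "\<exists>v q. (i, q, v) \<in> ?W \<and> (\<forall>q' v'. (i, q', v') \<in> ?W \<longrightarrow> q' \<le> q)" by blast
    then have "\<exists>q. (i, q, s i) \<in> ?W \<and> (\<forall>q' v'. (i, q', v') \<in> ?W \<longrightarrow> q' \<le> q)"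
      using True unfolding s snapshot_def by (simp only: if_True) (rule someI_ex)
    then obtain q where q: "(i, q, s i) \<in> ?W" "\<And>q' v'. (i, q', v') \<in> ?W \<Longrightarrow> q' \<le> q" by blast
    obtain b where b: "invoked E b i (Update (s i))" "rnd (st (Suc b) i) = q"
      using op_view_updates[OF j(2) q(1)] by blast
    have "b \<in> seen a" using b q(1) by (auto simp: seen_def)
    moreover have "b' \<le> b" if "b' \<in> seen a" "invoked E b' i (Update v)" for b' v
      using q(2)[OF own[OF that]] b sequence_numbers[OF that(2) b(1)] by simp
    ultimately show ?thesis using b(1) by blast
  qed
qed

lemma atomic_execution: "atomic n v0 E"
proof (rule atomic_from_views[where V = seen])
  show "\<exists>k r. completes E a k r \<and> k < b" if "invoked E a i op" "invoked E b i op'" "a < b" for a b i op op'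
    using sequential that by blast
next
  fix a assume "completed E a"
  show "seen a \<subseteq> updates E" by (auto simp: seen_def updates_def)
next
  fix a assume "completed E a" "a \<in> updates E"
  then obtain k x i v where k: "completes E a k x" and i: "invoked E a i (Update v)"
    by (auto simp: completed_def updates_def)
  obtain j where "running a k j" "op_view a k j (view_of a)" using view_of[OF k] by blast
  then have "op_view a k i (view_of a)" using running_invoked[OF _ i] by blast
  then have "(i, rnd (st (Suc a) i), v) \<in> set (view_of a)" using op_view_own i by blast
  then show "a \<in> seen a" using i by (auto simp: seen_def)
next
  fix a b assume "completed E a" "completed E b"
  then obtain k x k' x' where "completes E a k x" "completes E b k' x'" by (auto simp: completed_def)
  then have "set (view_of a) \<subseteq> set (view_of b) \<or> set (view_of b) \<subseteq> set (view_of a)"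
    using view_of op_views_comparable by meson
  then show "seen a \<subseteq> seen b \<or> seen b \<subseteq> seen a" using seen_mono by blast
next
  fix a b k x assume a: "completes E a k x" "k < b" and "completed E b"
  then obtain k' x' where "completes E b k' x'" by (auto simp: completed_def)
  then have "set (view_of a) \<subseteq> set (view_of b)" using view_of a op_view_mono by meson
  then show "seen a \<subseteq> seen b" by (rule seen_mono)
next
  fix a b k x assume a: "completes E a k x" and b: "b \<in> seen a"
  obtain j v where j: "invoked E b j (Update v)" "(j, rnd (st (Suc b) j), v) \<in> set (view_of a)"
    using b by (auto simp: seen_def)
  obtain i where "op_view a k i (view_of a)" using view_of[OF a] by blast
  then obtain b' where b': "b' < k" "invoked E b' j (Update v)" "rnd (st (Suc b') j) = rnd (st (Suc b) j)"
    using op_view_updates j(2) by blast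
  then show "b \<le> k" using sequence_numbers[OF j(1) b'(2)] by simp
next
  show "(\<forall>b\<in>seen a. \<forall>v. \<not> invoked E b i (Update v)) \<and> s i = v0 i \<or>
      (\<exists>b\<in>seen a. invoked E b i (Update (s i)) \<and>
        (\<forall>b'\<in>seen a. \<forall>v. invoked E b' i (Update v) \<longrightarrow> b' \<le> b))"
    if "completes E a k (Snap s)" "i \<in> {1..n}" for a k s i
    using snapshot_latest that by blast
next
  fix a k s assume "completes E a k (Snap s)"
  then obtain i where "running a k i" "Snap s = respond v0 (fst (pc (st k i))) (view_of a)" using view_of by blast
  then have "fst (pc (st k i))" "running a k i" by (auto simp: respond_def split: if_splits)
  then show "a \<notin> updates E"
    using running_flag[of a k i] running_invoked[of a k i] by (force simp: updates_def)
qed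

lemma proper_execution: "proper_replies E"
  unfolding proper_replies_def
proof (intro allI impI)
  fix k i x assume r: "reply E k = Some (i, x)"
  then obtain a op where a: "invoked E a i op" "completes E a k x" "running a k i" using reply_completes by blast
  obtain W where "x = respond v0 (fst (pc (st k i))) W" using reply_view[OF a(3) r] by blast
  moreover have "fst (pc (st k i)) = (op = Scan)" using running_flag a by blast
  ultimately have "case op of Update _ \<Rightarrow> x = Ack | Scan \<Rightarrow> \<exists>s. x = Snap s"
    by (auto simp: respond_def split: operation.splits)
  then show "\<exists>a op. invoked E a i op \<and> completes E a k x \<and>
      (case op of Update _ \<Rightarrow> x = Ack | Scan \<Rightarrow> \<exists>s. x = Snap s)" using a by blast
qed

lemma terminating_execution: "terminating E"
  unfolding terminating_def completed_def using operations_complete by blast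

end

section \<open>Complexity\<close>

fun val_encode :: "nat \<times> nat \<times> 'v \<Rightarrow> 'v data" where
  "val_encode (i, s, v) = Tuple [Num i, Num s, Val v]"

definition list_encode :: "('a \<Rightarrow> 'v data) \<Rightarrow> 'a list \<Rightarrow> 'v data" where
  "list_encode e xs = Tuple (map e xs)"

fun atom_encode :: "node \<times> 'v view \<Rightarrow> 'v data" where
  "atom_encode (i, X) = Tuple [Num i, list_encode val_encode X]"

fun item_encode :: "'v item \<Rightarrow> 'v data" where
  "item_encode (Written i s v) = Tuple [Num 0, Num i, Num s, Val v]"
| "item_encode (Joined r) = Tuple [Num 1, Num r]"
| "item_encode (Proposed r m k A) = Tuple [Num 2, Num r, Num m, Num k, list_encode atom_encode A]"
| "item_encode (Committed r W) = Tuple [Num 3, Num r, list_encode val_encode W]"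

fun stage_encode :: "'v stage \<Rightarrow> 'v data" where
  "stage_encode (Resting l W) = Tuple [Num 0, Num l, list_encode val_encode W]"
| "stage_encode (Writing l) = Tuple [Num 1, Num l]"
| "stage_encode (Joining r0 r) = Tuple [Num 2, Num r0, Num r]"
| "stage_encode (Splitting r0 r m k A) = Tuple [Num 3, Num r0, Num r, Num m, Num k, list_encode atom_encode A]"
| "stage_encode (Merging r0 r m k A) = Tuple [Num 4, Num r0, Num r, Num m, Num k, list_encode atom_encode A]"

definition bool_encode :: "bool \<Rightarrow> 'v data" where
  "bool_encode b = Num (if b then 1 else 0)"

definition state_encode :: "(bool \<times> 'v stage, 'v item) node_state \<Rightarrow> 'v data" where
  "state_encode s = Tuple [list_encode item_encode (known s), list_encode item_encode (base s), Num (rnd s),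
     list_encode Num (acks s), bool_encode (busy s), bool_encode (fst (pc s)), stage_encode (snd (pc s))]"

fun msg_encode :: "'v item msg \<Rightarrow> 'v data" where
  "msg_encode (Request k K) = Tuple [Num 0, Num k, list_encode item_encode K]"
| "msg_encode (Answer k K) = Tuple [Num 1, Num k, list_encode item_encode K]"

lemma list_encode_inject: "inj e \<Longrightarrow> list_encode e xs = list_encode e ys \<longleftrightarrow> xs = ys"
  by (auto simp: list_encode_def dest: map_injective)

lemma inj_val_encode: "inj val_encode"
  by (auto simp: inj_def)

lemma inj_atom_encode: "inj atom_encode"
  by (auto simp: inj_def list_encode_inject[OF inj_val_encode])

lemmas encode_inject = list_encode_inject[OF inj_val_encode] list_encode_inject[OF inj_atom_encode]

lemma inj_item_encode: "inj item_encode"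
proof (rule injI)
  show "item_encode x = item_encode y \<Longrightarrow> x = y" for x y :: "'a item"
    by (cases x; cases y) (auto simp: encode_inject)
qed

lemma stage_encode_inject: "stage_encode x = stage_encode y \<longleftrightarrow> x = y"
  by (cases x; cases y) (auto simp: encode_inject)

lemma inj_msg_encode: "inj msg_encode"
proof (rule injI)
  show "msg_encode x = msg_encode y \<Longrightarrow> x = y" for x y :: "'a item msg"
    by (cases x; cases y) (auto simp: list_encode_inject[OF inj_item_encode])
qed

lemma inj_state_encode: "inj state_encode"
proof (rule injI)
  fix x y :: "(bool \<times> 'a stage, 'a item) node_state"
  assume "state_encode x = state_encode y"
  moreover have "inj (Num :: nat \<Rightarrow> 'a data)" by (simp add: inj_def)
  ultimately show "x = y"
    by (auto simp: state_encode_def list_encode_inject[OF \<open>inj Num\<close>] list_encode_inject[OF inj_item_encode]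
        bool_encode_def stage_encode_inject intro!: node_state.equality prod_eqI split: if_splits)
qed

section \<open>The protocol and its logarithmic bound\<close>

lemma protocol_exists:
  fixes v0 :: "node \<Rightarrow> 'v"
  assumes "2 * f < n" "n \<le> 2 ^ L"
  shows "\<exists>P :: ('v, 'v data, 'v data) protocol.
    implements_atomic_snapshot n f v0 P \<and> takes_message_delays n f P (24 + 16 * real L)"
proof -
  interpret runner n f "\<lambda>_. (False, Resting 0 [])" begin_op "advance v0 L"
    by unfold_locales fact
  have exec: "snapshot_execution n f v0 L E" if "execution_of protocol n f E" for E
    by unfold_locales (fact assms that)+
  have "implements_atomic_snapshot n f v0 protocol"
    unfolding implements_atomic_snapshot_def
    using snapshot_execution.proper_execution snapshot_execution.atomic_execution
      snapshot_execution.terminating_execution exec by blast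
  moreover have "takes_message_delays n f protocol (24 + 16 * real L)"
    unfolding takes_message_delays_def
  proof (intro allI impI; elim conjE)
    fix E D a i op
    assume E: "execution_of protocol n f E" and D: "D \<ge> 0" "\<forall>d\<in>message_delays E. d \<le> D"
      and op: "invoked E a i op" "i \<notin> faulty E"
    interpret snapshot_execution n f v0 L E by (rule exec[OF E])
    have "delay_bound D" using D by (simp add: delay_bound_def)
    then show "\<exists>k r. completes E a k r \<and> at_time E k - at_time E a \<le> (24 + 16 * real L) * D"
      using operations_complete[OF op] by blast
  qed
  \<comment> \<open>Injectivity makes \<open>inv\<close> a left inverse of each encoding, as the
    transfer requires.\<close>
  ultimately show ?thesis
    using encode_implements[of "inv state_encode" state_encode "inv msg_encode" msg_encode n f v0 protocol]
      encode_delays[of "inv state_encode" state_encode "inv msg_encode" msg_encode n f protocol]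
      inv_f_f[OF inj_state_encode] inv_f_f[OF inj_msg_encode] by blast
qed

theorem theorem39:
  shows "\<exists>T :: nat \<Rightarrow> real. T \<in> O(\<lambda>n. ln (real n)) \<and>
    (\<forall>(n :: nat) (f :: nat) (v0 :: node \<Rightarrow> 'v). real f < real n / 2 \<longrightarrow>
      (\<exists>P :: ('v, 'v data, 'v data) protocol.
         implements_atomic_snapshot n f v0 P \<and> takes_message_delays n f P (T n)))"
proof -
  \<comment> \<open>For \<open>n > 0\<close> this is the least number of levels with
    \<open>n \<le> 2 ^ L n\<close>.\<close>
  define L where "L n = nat \<lceil>log 2 (real n)\<rceil>" for n
  define T where "T n = 24 + 16 * real (L n)" for n
  have L: "n \<le> 2 ^ L n" if "n > 0" for n
  proof -
    have "real n = 2 powr log 2 (real n)" using that by simp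
    also have "\<dots> \<le> 2 powr real (L n)"
      by (rule powr_mono) (simp_all add: L_def real_nat_ceiling_ge)
    also have "\<dots> = real (2 ^ L n)" by (simp add: powr_realpow)
    finally show ?thesis by linarith
  qed
  have "T \<in> O(\<lambda>n. ln (real n))"
  \<comment> \<open>For \<open>n \<ge> 2\<close> the binary logarithm is at least 1, so rounding up
    adds at most 1 and \<open>24 + 16 * (log 2 n + 1) \<le> 56 * log 2 n\<close>.\<close>
  proof (rule bigoI[where c = "56 / ln 2"])
    show "\<forall>\<^sub>F n in sequentially. norm (T n) \<le> 56 / ln 2 * norm (ln (real n))"
      using eventually_ge_at_top[of 2]
    proof eventually_elim
      case (elim n)
      have ln: "ln 2 \<le> ln (real n)" using elim by simp
      have l: "log 2 (real n) = ln (real n) / ln 2" by (simp add: log_def)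
      have one: "1 \<le> log 2 (real n)" using ln by (simp add: l)
      have "real (L n) \<le> log 2 (real n) + 1" unfolding L_def using one by linarith
      then have "T n \<le> 56 * log 2 (real n)" using one by (simp add: T_def)
      moreover have "0 \<le> T n" by (simp add: T_def)
      moreover have "0 \<le> ln (real n)" using elim by simp
      ultimately show ?case by (simp add: l)
    qed
  qed
  moreover have "\<exists>P :: ('v, 'v data, 'v data) protocol.
      implements_atomic_snapshot n f v0 P \<and> takes_message_delays n f P (T n)"
    if "real f < real n / 2" for n f and v0 :: "node \<Rightarrow> 'v"
  proof -
    have "2 * f < n" using that by linarith
    then show ?thesis unfolding T_def using L by (intro protocol_exists) auto
  qed
  ultimately show ?thesis by blast
qed

end
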